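(* Let $A,B,C$ be complex vector spaces of dimension $3$ and let $X=Seg(\mathbb P A^*\times\mathbb P B^*\times\mathbb P C^* )=Seg(\mathbb P^2\times\mathbb P^2\times\mathbb P^2)\subset\mathbb P(A^*\otimes B^*\otimes C^* )$. Then: (1) The space of quartic equations of $\sigma_3(X)$ is $I_4(\sigma_3(X))=S_{211}A\otimes S_{211}B\otimes S_{211}C$, and it has dimension $27$. (2) $\sigma_4(X)$ is a hypersurface of degree nine, and its equation corresponds to the one-dimensional module $S_{333}A\otimes S_{333}B\otimes S_{333}C\subset S^9(A\otimes B\otimes C)$ (that is, it spans a submodule of this type).
   Context: Work over $\mathbb C$. The Segre variety is the set of classes of decomposable tensors. $\sigma_r(X)$ is the Zariski closure of the union of the linear spans of $r$-tuples of points of $X$. $I_d(Z)\subset S^d(A\otimes B\otimes C)$ is the space of degree $d$ homogeneous polynomials on $A^*\otimes B^*\otimes C^*$ vanishing on $Z$. $S_\pi$ is the Schur functor of the partition $\pi$ (e.g. $211=(2,1,1)$); equalities are of $GL(A)\times GL(B)\times GL(C)$-submodules of $S^d(A\otimes B\otimes C)$; $S_{211}A\otimes S_{211}B\otimes S_{211}C$ denotes its unique copy in $S^4(A\otimes B\otimes C)$, where it has multiplicity one. *)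

theory Defs
  imports Complex_Main "HOL-Library.Function_Algebras" "HOL-Combinatorics.Permutations"
begin

text \<open>
  Every vector space built from $A$, $B$, $C$ is realised as a space of complex-valued functions:
  \<^item> $A^*\otimes B^*\otimes C^*$ is the span of the functions
    $(a,b,c)\mapsto\alpha(a)\beta(b)\gamma(c)$ on $A\times B\times C$;
  \<^item> $S^d(A\otimes B\otimes C)$ consists of functions on $A^*\otimes B^*\otimes C^*$;
  \<^item> $A^{\otimes d}$ is the span of the functions
    $(\alpha_1,\dots,\alpha_d)\mapsto\alpha_1(v_1)\cdots\alpha_d(v_d)$ on $(A^*)^d$.

  A function that is only meaningful on a subset of its type is set to 0 off that subset,
  so that equality of functions is equality on the subset.
\<close>

definition fscale :: "complex \<Rightarrow> ('x \<Rightarrow> complex) \<Rightarrow> ('x \<Rightarrow> complex)" where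
  "fscale z f = (\<lambda>x. z * f x)"

global_interpretation fv: vector_space "fscale :: complex \<Rightarrow> ('x \<Rightarrow> complex) \<Rightarrow> ('x \<Rightarrow> complex)"
  by unfold_locales (auto simp: fscale_def fun_eq_iff algebra_simps)

definition dual :: "(complex \<Rightarrow> 'a \<Rightarrow> 'a) \<Rightarrow> ('a::ab_group_add \<Rightarrow> complex) set" where
  "dual sA = {\<alpha>. Vector_Spaces.linear sA (*) \<alpha>}"

definition GL :: "(complex \<Rightarrow> 'a \<Rightarrow> 'a) \<Rightarrow> ('a::ab_group_add \<Rightarrow> 'a) set" where
  "GL sA = {g. Vector_Spaces.linear sA sA g \<and> bij g}"


section \<open>Projective varieties in $\mathbb P(V)$\<close>

text \<open>Here \<open>V\<close> is a linear subspace of a function space. Every linear form on \<open>V\<close> is the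
  restriction of a linear form on the whole function space.\<close>

definition hom_poly :: "('x \<Rightarrow> complex) set \<Rightarrow> nat \<Rightarrow> (('x \<Rightarrow> complex) \<Rightarrow> complex) set" where
  "hom_poly V d = fv.span {\<lambda>v. if v \<in> V then (\<Prod>i<d. L i v) else 0 | L. \<forall>i<d. L i \<in> dual fscale}"

text \<open>A point of $\mathbb P(V)$ is a line through the origin of \<open>V\<close>, as a set of vectors.\<close>

definition proj_space :: "('x \<Rightarrow> complex) set \<Rightarrow> ('x \<Rightarrow> complex) set set" where
  "proj_space V = {fv.span {v} | v. v \<in> V \<and> v \<noteq> 0}"

definition zero_locus ::
  "('x \<Rightarrow> complex) set \<Rightarrow> (('x \<Rightarrow> complex) \<Rightarrow> complex) set \<Rightarrow> ('x \<Rightarrow> complex) set set" where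
  "zero_locus V S = {p \<in> proj_space V. \<forall>P\<in>S. \<forall>v\<in>p. P v = 0}"

definition zariski_closed :: "('x \<Rightarrow> complex) set \<Rightarrow> ('x \<Rightarrow> complex) set set \<Rightarrow> bool" where
  "zariski_closed V Z \<longleftrightarrow> (\<exists>S \<subseteq> (\<Union>d. hom_poly V d). Z = zero_locus V S)"

definition zariski_closure ::
  "('x \<Rightarrow> complex) set \<Rightarrow> ('x \<Rightarrow> complex) set set \<Rightarrow> ('x \<Rightarrow> complex) set set" where
  "zariski_closure V Y = \<Inter>{Z. zariski_closed V Z \<and> Y \<subseteq> Z}"

definition proj_linear_span ::
  "('x \<Rightarrow> complex) set \<Rightarrow> ('x \<Rightarrow> complex) set set \<Rightarrow> ('x \<Rightarrow> complex) set set" where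
  "proj_linear_span V Y = {q \<in> proj_space V. q \<subseteq> fv.span (\<Union>Y)}"

definition secant_variety ::
  "('x \<Rightarrow> complex) set \<Rightarrow> nat \<Rightarrow> ('x \<Rightarrow> complex) set set \<Rightarrow> ('x \<Rightarrow> complex) set set" where
  "secant_variety V r X =
    zariski_closure V (\<Union>{proj_linear_span V (p ` {..<r}) | p. \<forall>i<r. p i \<in> X})"

definition ideal_deg ::
  "('x \<Rightarrow> complex) set \<Rightarrow> ('x \<Rightarrow> complex) set set \<Rightarrow> nat \<Rightarrow> (('x \<Rightarrow> complex) \<Rightarrow> complex) set" where
  "ideal_deg V Z d = {P \<in> hom_poly V d. \<forall>p\<in>Z. \<forall>v\<in>p. P v = 0}"

text \<open>\<open>Z\<close> is a hypersurface of degree \<open>d\<close> with equation \<open>F\<close>. The degree is that of the reduced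
  hypersurface, so \<open>F\<close> has to generate the homogeneous ideal of \<open>Z\<close>, not merely cut out \<open>Z\<close>.\<close>

definition hypersurface_equation ::
  "('x \<Rightarrow> complex) set \<Rightarrow> ('x \<Rightarrow> complex) set set \<Rightarrow> nat \<Rightarrow> (('x \<Rightarrow> complex) \<Rightarrow> complex) \<Rightarrow> bool" where
  "hypersurface_equation V Z d F \<longleftrightarrow>
     0 < d \<and> F \<in> hom_poly V d \<and> F \<noteq> 0 \<and> Z = zero_locus V {F} \<and>
     (\<forall>e. \<forall>P \<in> ideal_deg V Z e. \<exists>k. \<exists>G \<in> hom_poly V k. P = (\<lambda>v. F v * G v))"


section \<open>The Segre variety\<close>

definition tensor3 ::
  "('a \<Rightarrow> complex) \<Rightarrow> ('b \<Rightarrow> complex) \<Rightarrow> ('c \<Rightarrow> complex) \<Rightarrow> ('a \<times> 'b \<times> 'c \<Rightarrow> complex)" where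
  "tensor3 \<alpha> \<beta> \<gamma> = (\<lambda>(a, b, c). \<alpha> a * \<beta> b * \<gamma> c)"

definition tensor_prod3 ::
  "('a \<Rightarrow> complex) set \<Rightarrow> ('b \<Rightarrow> complex) set \<Rightarrow> ('c \<Rightarrow> complex) set
    \<Rightarrow> ('a \<times> 'b \<times> 'c \<Rightarrow> complex) set" where
  "tensor_prod3 U V W = fv.span {tensor3 u v w | u v w. u \<in> U \<and> v \<in> V \<and> w \<in> W}"

definition dual_tensors ::
  "(complex \<Rightarrow> 'a \<Rightarrow> 'a) \<Rightarrow> (complex \<Rightarrow> 'b \<Rightarrow> 'b) \<Rightarrow> (complex \<Rightarrow> 'c \<Rightarrow> 'c)
    \<Rightarrow> ('a::ab_group_add \<times> 'b::ab_group_add \<times> 'c::ab_group_add \<Rightarrow> complex) set" where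
  "dual_tensors sA sB sC = tensor_prod3 (dual sA) (dual sB) (dual sC)"

definition segre ::
  "(complex \<Rightarrow> 'a \<Rightarrow> 'a) \<Rightarrow> (complex \<Rightarrow> 'b \<Rightarrow> 'b) \<Rightarrow> (complex \<Rightarrow> 'c \<Rightarrow> 'c)
    \<Rightarrow> ('a::ab_group_add \<times> 'b::ab_group_add \<times> 'c::ab_group_add \<Rightarrow> complex) set set" where
  "segre sA sB sC = {fv.span {tensor3 \<alpha> \<beta> \<gamma>} | \<alpha> \<beta> \<gamma>.
     \<alpha> \<in> dual sA \<and> \<alpha> \<noteq> 0 \<and> \<beta> \<in> dual sB \<and> \<beta> \<noteq> 0 \<and> \<gamma> \<in> dual sC \<and> \<gamma> \<noteq> 0}"


section \<open>Schur functors\<close>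

definition tensor_power ::
  "(complex \<Rightarrow> 'a \<Rightarrow> 'a) \<Rightarrow> nat \<Rightarrow> (('a::ab_group_add \<Rightarrow> complex) list \<Rightarrow> complex) set" where
  "tensor_power sA d =
     fv.span {\<lambda>\<alpha>s. if length \<alpha>s = d \<and> set \<alpha>s \<subseteq> dual sA then (\<Prod>i<d. (\<alpha>s ! i) (v i)) else 0
              | v :: nat \<Rightarrow> 'a. True}"

text \<open>The boxes of the Young diagram of a partition \<open>\<lambda>\<close> are numbered $0,1,2,\dots$ row by row.\<close>

definition young_row :: "nat list \<Rightarrow> nat \<Rightarrow> nat set" where
  "young_row l i = {sum_list (take i l) ..< sum_list (take (Suc i) l)}"

definition young_col :: "nat list \<Rightarrow> nat \<Rightarrow> nat set" where
  "young_col l j = {sum_list (take i l) + j | i. i < length l \<and> j < l ! i}"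

definition row_group :: "nat list \<Rightarrow> (nat \<Rightarrow> nat) set" where
  "row_group l = {p. p permutes {..<sum_list l} \<and> (\<forall>i<length l. p ` young_row l i = young_row l i)}"

definition col_group :: "nat list \<Rightarrow> (nat \<Rightarrow> nat) set" where
  "col_group l = {q. q permutes {..<sum_list l} \<and> (\<forall>j. q ` young_col l j = young_col l j)}"

text \<open>$S_\lambda A$ is the image of the Young symmetrizer $\sum_{p,q}\mathrm{sgn}(q)\,pq$ under the
  right action $(v_1\otimes\dots\otimes v_d)\cdot\sigma=v_{\sigma(1)}\otimes\dots\otimes v_{\sigma(d)}$
  on $A^{\otimes d}$; on functions of $(\alpha_1,\dots,\alpha_d)$ this action permutes the arguments
  by $\sigma^{-1}$.\<close>

definition young_symmetrize :: "nat list \<Rightarrow> ('x list \<Rightarrow> complex) \<Rightarrow> ('x list \<Rightarrow> complex)" where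
  "young_symmetrize l t = (\<lambda>\<alpha>s. \<Sum>p\<in>row_group l. \<Sum>q\<in>col_group l.
     of_int (sign q) * t (permute_list (inv (p \<circ> q)) \<alpha>s))"

definition schur_functor ::
  "nat list \<Rightarrow> (complex \<Rightarrow> 'a \<Rightarrow> 'a) \<Rightarrow> (('a::ab_group_add \<Rightarrow> complex) list \<Rightarrow> complex) set" where
  "schur_functor l sA = young_symmetrize l ` tensor_power sA (sum_list l)"


section \<open>Modules of $GL(A)\times GL(B)\times GL(C)$\<close>

definition poly_act ::
  "('a \<Rightarrow> 'a) \<times> ('b \<Rightarrow> 'b) \<times> ('c \<Rightarrow> 'c) \<Rightarrow> (('a \<times> 'b \<times> 'c \<Rightarrow> complex) \<Rightarrow> complex)
    \<Rightarrow> (('a \<times> 'b \<times> 'c \<Rightarrow> complex) \<Rightarrow> complex)" where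
  "poly_act = (\<lambda>(g, h, k) P T. P (\<lambda>(a, b, c). T (g a, h b, k c)))"

text \<open>The action on $A^{\otimes d}\otimes B^{\otimes d}\otimes C^{\otimes d}$.\<close>

definition tensor_act ::
  "('a \<Rightarrow> 'a) \<times> ('b \<Rightarrow> 'b) \<times> ('c \<Rightarrow> 'c)
    \<Rightarrow> (('a \<Rightarrow> complex) list \<times> ('b \<Rightarrow> complex) list \<times> ('c \<Rightarrow> complex) list \<Rightarrow> complex)
    \<Rightarrow> (('a \<Rightarrow> complex) list \<times> ('b \<Rightarrow> complex) list \<times> ('c \<Rightarrow> complex) list \<Rightarrow> complex)" where
  "tensor_act = (\<lambda>(g, h, k) t (\<alpha>s, \<beta>s, \<gamma>s).
     t (map (\<lambda>\<alpha>. \<alpha> \<circ> g) \<alpha>s, map (\<lambda>\<beta>. \<beta> \<circ> h) \<beta>s, map (\<lambda>\<gamma>. \<gamma> \<circ> k) \<gamma>s))"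

definition submodule ::
  "'g set \<Rightarrow> ('g \<Rightarrow> ('x \<Rightarrow> complex) \<Rightarrow> ('x \<Rightarrow> complex)) \<Rightarrow> ('x \<Rightarrow> complex) set
    \<Rightarrow> ('x \<Rightarrow> complex) set \<Rightarrow> bool" where
  "submodule G act N M \<longleftrightarrow> M \<subseteq> N \<and> fv.subspace M \<and> (\<forall>g\<in>G. act g ` M \<subseteq> M)"

definition module_iso ::
  "'g set \<Rightarrow> ('g \<Rightarrow> ('x \<Rightarrow> complex) \<Rightarrow> ('x \<Rightarrow> complex)) \<Rightarrow> ('x \<Rightarrow> complex) set
    \<Rightarrow> ('g \<Rightarrow> ('y \<Rightarrow> complex) \<Rightarrow> ('y \<Rightarrow> complex)) \<Rightarrow> ('y \<Rightarrow> complex) set \<Rightarrow> bool" where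
  "module_iso G act M act' N \<longleftrightarrow> (\<exists>\<phi>. bij_betw \<phi> M N \<and>
     (\<forall>x\<in>M. \<forall>y\<in>M. \<phi> (x + y) = \<phi> x + \<phi> y) \<and>
     (\<forall>z. \<forall>x\<in>M. \<phi> (fscale z x) = fscale z (\<phi> x)) \<and>
     (\<forall>g\<in>G. \<forall>x\<in>M. \<phi> (act g x) = act' g (\<phi> x)))"

definition schur_prod ::
  "nat list \<Rightarrow> (complex \<Rightarrow> 'a \<Rightarrow> 'a) \<Rightarrow> (complex \<Rightarrow> 'b \<Rightarrow> 'b) \<Rightarrow> (complex \<Rightarrow> 'c \<Rightarrow> 'c)
    \<Rightarrow> (('a::ab_group_add \<Rightarrow> complex) list \<times> ('b::ab_group_add \<Rightarrow> complex) list
        \<times> ('c::ab_group_add \<Rightarrow> complex) list \<Rightarrow> complex) set" where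
  "schur_prod l sA sB sC = tensor_prod3 (schur_functor l sA) (schur_functor l sB) (schur_functor l sC)"

text \<open>\<open>M\<close> is a copy of $S_\lambda A\otimes S_\lambda B\otimes S_\lambda C$ in
  $S^d(A\otimes B\otimes C)$, where \<open>d\<close> is the size of \<open>\<lambda>\<close>.\<close>

definition schur_copy ::
  "nat list \<Rightarrow> (complex \<Rightarrow> 'a \<Rightarrow> 'a) \<Rightarrow> (complex \<Rightarrow> 'b \<Rightarrow> 'b) \<Rightarrow> (complex \<Rightarrow> 'c \<Rightarrow> 'c)
    \<Rightarrow> (('a::ab_group_add \<times> 'b::ab_group_add \<times> 'c::ab_group_add \<Rightarrow> complex) \<Rightarrow> complex) set
    \<Rightarrow> bool" where
  "schur_copy l sA sB sC M \<longleftrightarrow>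
     submodule (GL sA \<times> GL sB \<times> GL sC) poly_act (hom_poly (dual_tensors sA sB sC) (sum_list l)) M \<and>
     module_iso (GL sA \<times> GL sB \<times> GL sC) poly_act M tensor_act (schur_prod l sA sB sC)"

end

theory Submission
  imports Defs "HOL-Analysis.Analysis" "HOL-Computational_Algebra.Fundamental_Theorem_Algebra"
begin

text \<open>
  Quartics: if a quartic vanishes on sums of three decomposable tensors, its polarisation vanishes
  at $(t,t,t',t'')$ for decomposable $t,t',t''$. At basis tensors this yields signed exchange rules,
  by which the quartic is determined by 27 of its values. Conversely, the 27 quartics obtained by
  contracting $T^{\otimes 4}$ with three volume forms transform by the matrices of
  $S_{211}A\otimes S_{211}B\otimes S_{211}C$. A family that transforms in this way vanishes at
  $\sum_i a_i\otimes b_i\otimes c_i$, because the stabiliser of that tensor kills its value; as the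
  orbit is dense in the sums of three decomposable tensors, every copy of the module consists of
  equations and, by dimension, is the whole space of equations.

  Strassen's equation: with slices $X,Y,Z$, the quotient $F$ of
  $\det(Y\,\mathrm{adj}(X)\,Z-Z\,\mathrm{adj}(X)\,Y)$ by $\det X$ is a polynomial of degree 9.
  Where $\det X\ne 0$ and $X^{-1}Y$ has distinct eigenvalues one may assume $X=1$ and $Y$ diagonal;
  then $F=0$ means $z_{12}z_{23}z_{31}=z_{13}z_{32}z_{21}$, which generically makes $Z$ a diagonal plus
  a rank one matrix, so that the tensor has rank 4. Hence a polynomial $P$ vanishing on tensors of
  rank 4 vanishes on a dense part of $F=0$. Since $F$ has nine distinct roots on some line, division
  with remainder along lines shows that $F$ divides $P$.
\<close>

section \<open>Homogeneous polynomials on a space of functions\<close>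

text \<open>Density is always used through restriction to lines: there a homogeneous polynomial
  becomes a complex polynomial in one variable, and such a polynomial is 0 as soon as it has too
  many roots. An identity is checked at general points and carried to all others along a line such
  as \<open>L + mat t\<close>, on which the determinant has only finitely many zeros. The ideal is
  found before the variety. Once F is known to divide every form that vanishes on sums of four
  decomposable tensors, it follows both that the secant variety is the locus F = 0 and that F is its
  reduced equation. The line with nine distinct roots certifies that F has no repeated factor. The
  same division argument produces F itself, with det X as divisor and a line on which det X has
  three distinct roots. Modules are compared through matrix coefficients. Since dim A = 3, S_211 A
  is A tensored with its top exterior power and S_333 A is the cube of that power; hence the 27
  coordinates in degree 4 and the cubes of determinants in degree 9.\<close>

lemma linear_fscaleD:
  assumes "L \<in> dual fscale"
  shows "L (u + v) = L u + L v" "L (fscale c u) = c * L u" "L (u - v) = L u - L v" "L 0 = 0"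
proof -
  interpret Vector_Spaces.linear fscale "(*)" L
    using assms by (simp add: dual_def)
  show "L (u + v) = L u + L v" "L (fscale c u) = c * L u" "L (u - v) = L u - L v" "L 0 = 0"
    by (rule add scale diff zero)+
qed

lemma eval_in_dual: "(\<lambda>v. v x) \<in> dual fscale"
  unfolding dual_def mem_Collect_eq
  by (intro Vector_Spaces.linear.intro module_hom.intro module_hom_axioms.intro fv.vector_space_axioms
      vector_space_over_itself.vector_space_axioms fv.module_axioms
      vector_space_over_itself.module_axioms) (auto simp: fscale_def)

lemma hom_poly_subspace: "fv.subspace (hom_poly V d)"
  unfolding hom_poly_def by (rule fv.subspace_span)

lemma hom_poly_prod:
  "(\<And>i. i < d \<Longrightarrow> L i \<in> dual fscale) \<Longrightarrow> (\<lambda>v. if v \<in> V then \<Prod>i<d. L i v else 0) \<in> hom_poly V d"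
  unfolding hom_poly_def by (rule fv.span_base) auto

lemma hom_poly_span_induct [consumes 1, case_names zero add scale prod]:
  assumes "P \<in> hom_poly V d"
    and zero: "R 0"
    and add: "\<And>P Q. R P \<Longrightarrow> R Q \<Longrightarrow> R (P + Q)"
    and scale: "\<And>c P. R P \<Longrightarrow> R (fscale c P)"
    and prod: "\<And>L. (\<And>i. i < d \<Longrightarrow> L i \<in> dual fscale) \<Longrightarrow>
      R (\<lambda>v. if v \<in> V then \<Prod>i<d. L i v else 0)"
  shows "R P"
  using assms(1) unfolding hom_poly_def
proof (induct rule: fv.span_induct)
  case base
  show ?case using zero add scale by (auto simp: fv.subspace_def)
next
  case (step x)
  then show ?case using prod by auto
qed

lemma hom_poly_0: "0 \<in> hom_poly V d"
  using hom_poly_subspace fv.subspace_0 by blast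

lemmas hom_poly_zero = hom_poly_0[unfolded zero_fun_def]

lemma hom_poly_add: "P \<in> hom_poly V d \<Longrightarrow> Q \<in> hom_poly V d \<Longrightarrow> P + Q \<in> hom_poly V d"
  using hom_poly_subspace fv.subspace_add by blast

lemma hom_poly_diff: "P \<in> hom_poly V d \<Longrightarrow> Q \<in> hom_poly V d \<Longrightarrow> P - Q \<in> hom_poly V d"
  using hom_poly_subspace fv.subspace_diff by blast

lemma hom_poly_fscale: "P \<in> hom_poly V d \<Longrightarrow> fscale c P \<in> hom_poly V d"
  using hom_poly_subspace fv.subspace_scale by blast

lemma hom_poly_sum: "(\<And>i. i \<in> A \<Longrightarrow> P i \<in> hom_poly V d) \<Longrightarrow> sum P A \<in> hom_poly V d"
  using hom_poly_subspace fv.subspace_sum by blast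

lemma hom_poly_outside: "P \<in> hom_poly V d \<Longrightarrow> v \<notin> V \<Longrightarrow> P v = 0"
  by (induct rule: hom_poly_span_induct) (auto simp: fscale_def)

lemma hom_poly_const: "(\<lambda>v. if v \<in> V then c else 0) \<in> hom_poly V 0"
proof -
  have "fscale c (\<lambda>v. if v \<in> V then \<Prod>i<0::nat. undefined i v else 0) \<in> hom_poly V 0"
    by (intro hom_poly_fscale hom_poly_prod) auto
  also have "fscale c (\<lambda>v. if v \<in> V then \<Prod>i<0::nat. undefined i v else 0) = (\<lambda>v. if v \<in> V then c else 0)"
    by (auto simp: fscale_def)
  finally show ?thesis .
qed

lemma hom_poly_linear: "L \<in> dual fscale \<Longrightarrow> (\<lambda>v. if v \<in> V then L v else 0) \<in> hom_poly V 1"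
  using hom_poly_prod[of 1 "\<lambda>_. L" V] by (simp cong: if_cong)

lemma hom_poly_mult:
  assumes "P \<in> hom_poly V a" "Q \<in> hom_poly V b"
  shows "(\<lambda>v. P v * Q v) \<in> hom_poly V (a + b)"
  using assms(1)
proof (induct rule: hom_poly_span_induct)
  case zero
  show ?case using hom_poly_0 by (simp add: zero_fun_def)
next
  case (add P Q)
  from hom_poly_add[OF this] show ?case by (simp add: plus_fun_def algebra_simps)
next
  case (scale c P)
  from hom_poly_fscale[OF this, of c] show ?case by (simp add: fscale_def algebra_simps)
next
  case L: (prod L)
  show ?case
    using assms(2)
  proof (induct rule: hom_poly_span_induct)
    case zero
    show ?case using hom_poly_0 by (simp add: zero_fun_def)
  next
    case (add P Q)
    from hom_poly_add[OF this] show ?case by (simp add: plus_fun_def algebra_simps)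
  next
    case (scale c P)
    from hom_poly_fscale[OF this, of c] show ?case by (simp add: fscale_def algebra_simps)
  next
    case M: (prod M)
    define N where "N i = (if i < a then L i else M (i - a))" for i
    have *: "(\<Prod>i<a + b. N i v) = (\<Prod>i<a. L i v) * (\<Prod>i<b. M i v)" for v
      by (induct b) (simp_all add: N_def mult.assoc)
    have "(\<lambda>v. if v \<in> V then \<Prod>i<a + b. N i v else 0) \<in> hom_poly V (a + b)"
      by (rule hom_poly_prod) (use L M in \<open>auto simp: N_def\<close>)
    moreover have "(\<lambda>v. if v \<in> V then \<Prod>i<a + b. N i v else 0) =
      (\<lambda>v. (if v \<in> V then \<Prod>i<a. L i v else 0) * (if v \<in> V then \<Prod>i<b. M i v else 0))"
      by (auto simp: *)
    ultimately show ?case by simp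
  qed
qed

lemma hom_poly_degree_0:
  assumes "P \<in> hom_poly V 0"
  obtains c where "\<And>v. v \<in> V \<Longrightarrow> P v = c"
proof -
  have "\<exists>c. \<forall>v\<in>V. P v = c"
    using assms
  proof (induct rule: hom_poly_span_induct)
    case (add P Q)
    then obtain c d where "\<forall>v\<in>V. P v = c" "\<forall>v\<in>V. Q v = d" by blast
    then have "\<forall>v\<in>V. (P + Q) v = c + d" by simp
    then show ?case by blast
  qed (auto simp: fscale_def)
  then show thesis using that by blast
qed

lemma hom_poly_homogeneous:
  assumes "fv.subspace V" "P \<in> hom_poly V d" "v \<in> V"
  shows "P (fscale c v) = c ^ d * P v"
  using assms(2)
proof (induct rule: hom_poly_span_induct)
  case (prod L)
  have "fscale c v \<in> V" using assms fv.subspace_scale by blast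
  with assms(3) prod show ?case by (simp add: linear_fscaleD prod.distrib)
qed (auto simp: fscale_def algebra_simps)

lemma hom_poly_line_expansion:
  assumes V: "fv.subspace V" and U: "U \<in> V" and P: "P \<in> hom_poly V e"
  obtains p where "\<And>j k. j + k = e \<Longrightarrow> p j \<in> hom_poly V k" "\<And>j. e < j \<Longrightarrow> p j = 0"
    "\<And>v s. v \<in> V \<Longrightarrow> P (v + fscale s U) = (\<Sum>j\<le>e. s ^ j * p j v)"
proof -
  define R where "R e P \<longleftrightarrow> (\<exists>p. (\<forall>j k. j + k = e \<longrightarrow> p j \<in> hom_poly V k) \<and> (\<forall>j>e. p j = 0) \<and>
    (\<forall>v\<in>V. \<forall>s. P (v + fscale s U) = (\<Sum>j\<le>e. s ^ j * p j v)))" for e P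
  have VU: "v + fscale s U \<in> V" if "v \<in> V" for v s
    using V U that by (meson fv.subspace_add fv.subspace_scale)
  have prod: "R d (\<lambda>v. if v \<in> V then \<Prod>i<d. L i v else 0)"
    if "\<And>i. i < d \<Longrightarrow> L i \<in> dual fscale" for L :: "nat \<Rightarrow> ('a \<Rightarrow> complex) \<Rightarrow> complex" and d
    using that
  proof (induct d)
    case 0
    show ?case unfolding R_def
      by (rule exI[of _ "\<lambda>j. if j = 0 then (\<lambda>v. if v \<in> V then 1 else 0) else 0"])
        (auto simp: VU hom_poly_const)
  next
    case (Suc d)
    then obtain p where p: "\<And>j k. j + k = d \<Longrightarrow> p j \<in> hom_poly V k" "\<And>j. d < j \<Longrightarrow> p j = 0"
      "\<And>v s. v \<in> V \<Longrightarrow> (\<Prod>i<d. L i (v + fscale s U)) = (\<Sum>j\<le>d. s ^ j * p j v)"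
      unfolding R_def by (force simp: VU)
    have Ld: "L d \<in> dual fscale" using Suc by simp
    define q where "q j = (\<lambda>v. p j v * (if v \<in> V then L d v else 0)) +
        (case j of 0 \<Rightarrow> 0 | Suc i \<Rightarrow> fscale (L d U) (p i))" for j
    show ?case unfolding R_def
    proof (intro exI[of _ q] conjI allI impI ballI)
      fix j k assume jk: "j + k = Suc d"
      have "(\<lambda>v. p j v * (if v \<in> V then L d v else 0)) \<in> hom_poly V k"
      proof (cases "j \<le> d")
        case True
        then obtain k' where "k = k' + 1" "j + k' = d" using jk
          by (metis Suc_eq_plus1 add_Suc_right le_Suc_ex add_left_cancel)
        then show ?thesis using hom_poly_mult[OF p(1) hom_poly_linear[OF Ld], of j k'] by simp
      next
        case False
        then show ?thesis using p(2)[of j] hom_poly_0 by (simp add: zero_fun_def)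
      qed
      moreover have "(case j of 0 \<Rightarrow> 0 | Suc i \<Rightarrow> fscale (L d U) (p i)) \<in> hom_poly V k"
        using jk p(1) by (auto split: nat.split intro!: hom_poly_fscale hom_poly_0)
      ultimately show "q j \<in> hom_poly V k" unfolding q_def by (rule hom_poly_add)
    next
      fix j assume "Suc d < j"
      then show "q j = 0" using p(2) by (auto simp: q_def fscale_def split: nat.split)
    next
      fix v s assume v: "v \<in> V"
      define w where "w = v + fscale s U"
      have w: "w \<in> V" and Lw: "L d w = L d v + s * L d U"
        using Ld by (simp_all add: w_def VU[OF v] linear_fscaleD)
      have "(\<Prod>i<Suc d. L i w) = (\<Sum>j\<le>d. s ^ j * p j v) * (L d v + s * L d U)"
        using p(3)[OF v, of s] by (simp add: Lw w_def[symmetric])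
      also have "\<dots> = (\<Sum>j\<le>d. s ^ j * (p j v * L d v)) + (\<Sum>j\<le>d. s ^ Suc j * (L d U * p j v))"
        by (simp add: algebra_simps sum_distrib_left sum_distrib_right sum.distrib)
      also have "(\<Sum>j\<le>d. s ^ j * (p j v * L d v)) = (\<Sum>j\<le>Suc d. s ^ j * (p j v * L d v))"
        using p(2) by simp
      also have "(\<Sum>j\<le>d. s ^ Suc j * (L d U * p j v)) =
          (\<Sum>j\<le>Suc d. s ^ j * (case j of 0 \<Rightarrow> 0 | Suc i \<Rightarrow> fscale (L d U) (p i)) v)"
        unfolding sum.atMost_Suc_shift[of _ d] by (simp add: fscale_def)
      also have "(\<Sum>j\<le>Suc d. s ^ j * (p j v * L d v)) + \<dots> = (\<Sum>j\<le>Suc d. s ^ j * q j v)"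
        unfolding sum.distrib[symmetric] using v
        by (intro sum.cong) (simp_all add: q_def distrib_left)
      finally show "(if v + fscale s U \<in> V then \<Prod>i<Suc d. L i (v + fscale s U) else 0) =
          (\<Sum>j\<le>Suc d. s ^ j * q j v)"
        using w unfolding w_def[symmetric] by simp
    qed
  qed
  have "R e P" using P
  proof (induct rule: hom_poly_span_induct)
    case zero
    show ?case unfolding R_def by (rule exI[of _ 0]) (auto simp: hom_poly_0)
  next
    case (add P Q)
    then obtain p q where "\<forall>j k. j + k = e \<longrightarrow> p j \<in> hom_poly V k" "\<forall>j>e. p j = 0"
      "\<forall>v\<in>V. \<forall>s. P (v + fscale s U) = (\<Sum>j\<le>e. s ^ j * p j v)"
      "\<forall>j k. j + k = e \<longrightarrow> q j \<in> hom_poly V k" "\<forall>j>e. q j = 0"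
      "\<forall>v\<in>V. \<forall>s. Q (v + fscale s U) = (\<Sum>j\<le>e. s ^ j * q j v)"
      unfolding R_def by blast
    then show ?case unfolding R_def
      by (intro exI[of _ "p + q"]) (auto simp: algebra_simps sum.distrib intro!: hom_poly_add)
  next
    case (scale c P)
    then obtain p where "\<forall>j k. j + k = e \<longrightarrow> p j \<in> hom_poly V k" "\<forall>j>e. p j = 0"
      "\<forall>v\<in>V. \<forall>s. P (v + fscale s U) = (\<Sum>j\<le>e. s ^ j * p j v)"
      unfolding R_def by blast
    then show ?case unfolding R_def
      by (intro exI[of _ "\<lambda>j. fscale c (p j)"])
        (auto simp: fscale_def[of c] sum_distrib_left algebra_simps
          intro!: hom_poly_fscale[unfolded fscale_def])
  qed (rule prod)
  then show thesis using that unfolding R_def by blast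
qed

lemma hom_poly_on_line:
  assumes "fv.subspace V" "v \<in> V" "w \<in> V" "P \<in> hom_poly V d"
  obtains p where "\<And>t. P (v + fscale t w) = poly p t"
proof -
  obtain p where "\<And>s. P (v + fscale s w) = (\<Sum>j\<le>d. s ^ j * p j v)"
    using hom_poly_line_expansion[OF assms(1,3,4)] assms(2) by metis
  then have "P (v + fscale t w) = poly (\<Sum>j\<le>d. monom (p j v) j) t" for t
    by (simp add: poly_sum poly_monom mult.commute)
  then show thesis by (rule that)
qed

lemma hom_poly_zero_by_line:
  assumes "fv.subspace V" "v \<in> V" "w \<in> V" "P \<in> hom_poly V d"
    and "infinite {t. P (v + fscale t w) = 0}"
  shows "P (v + fscale t w) = 0"
proof -
  obtain p where p: "\<And>t. P (v + fscale t w) = poly p t"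
    using hom_poly_on_line assms by blast
  with assms(5) have "p = 0" using poly_roots_finite by auto
  with p show ?thesis by simp
qed

text \<open>The working form of density: a single direction with finitely many exceptional
  parameters is enough.\<close>

lemma hom_poly_zero_by_cofinite_line:
  assumes "fv.subspace V" "v \<in> V" "w \<in> V" "P \<in> hom_poly V d"
    and "finite {t. P (v + fscale t w) \<noteq> 0}"
  shows "P v = 0"
proof -
  have "infinite (UNIV - {t. P (v + fscale t w) \<noteq> 0})"
    using assms(5) infinite_UNIV_char_0 by (metis finite_Diff2)
  then have "infinite {t. P (v + fscale t w) = 0}"
    by (rule contrapos_nn) (auto elim: finite_subset[rotated])
  then have "P (v + fscale 0 w) = 0"
    using hom_poly_zero_by_line assms by blast
  then show ?thesis by (simp add: fscale_def plus_fun_def)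
qed

section \<open>Divisibility by a polynomial without multiple factors\<close>

lemma sum_lessThan_shift:
  fixes h :: "nat \<Rightarrow> 'a::comm_ring_1"
  shows "(\<Sum>j<n + d. if n \<le> j then s ^ j * h (j - n) else 0) = s ^ n * (\<Sum>i<d. s ^ i * h i)"
  by (induct d) (simp_all add: power_add algebra_simps)

text \<open>The top coefficient \<open>f d\<close> of the divisor is a nonzero constant, so division
  with remainder in \<open>s\<close> introduces no denominators and keeps all coefficients
  homogeneous in \<open>v\<close>. The induction is on the number \<open>m\<close> of terms still to
  be divided.\<close>

lemma hom_poly_line_division:
  assumes f: "\<And>j k. j + k = d \<Longrightarrow> f j \<in> hom_poly V k"
    and c: "\<And>v. v \<in> V \<Longrightarrow> f d v = c" "c \<noteq> 0"
    and p: "\<And>j k. j + k = e \<Longrightarrow> p j \<in> hom_poly V k" "\<And>j. e < j \<Longrightarrow> p j = 0"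
  shows "\<exists>g r. (\<forall>k l. k + d + l = e \<longrightarrow> g k \<in> hom_poly V l) \<and> (\<forall>k. e < k + d \<longrightarrow> g k = 0) \<and>
    (\<forall>j k. j + k = e \<longrightarrow> r j \<in> hom_poly V k) \<and> (\<forall>j>e. r j = 0) \<and>
    (\<forall>v\<in>V. \<forall>s. (\<Sum>j<m. s ^ j * p j v) =
      (\<Sum>j\<le>d. s ^ j * f j v) * (\<Sum>k<m. s ^ k * g k v) + (\<Sum>j<d. s ^ j * r j v))"
  using p
proof (induct m arbitrary: p)
  case 0
  show ?case by (rule exI[of _ 0], rule exI[of _ 0]) (auto simp: hom_poly_0 hom_poly_zero)
next
  case (Suc m)
  consider "m < d" | "d \<le> m" "e < m" | n where "m = n + d" "m \<le> e"
    by (metis add.commute le_Suc_ex not_less)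
  then show ?case
  proof cases
    case 1
    have "(\<Sum>j<Suc m. s ^ j * p j v) = (\<Sum>j<d. s ^ j * (if j \<le> m then p j else 0) v)" for v s
      using 1 by (intro sum.mono_neutral_cong_left) auto
    then show ?thesis
      by (intro exI[of _ 0] exI[of _ "\<lambda>j. if j \<le> m then p j else 0"]) (use Suc.prems in \<open>auto simp: hom_poly_0 hom_poly_zero\<close>)
  next
    case 2
    from Suc.hyps[of p, OF Suc.prems] obtain g r where
      gr: "\<forall>k l. k + d + l = e \<longrightarrow> g k \<in> hom_poly V l" "\<forall>k. e < k + d \<longrightarrow> g k = 0"
      "\<forall>j k. j + k = e \<longrightarrow> r j \<in> hom_poly V k" "\<forall>j>e. r j = 0"
      "\<forall>v\<in>V. \<forall>s. (\<Sum>j<m. s ^ j * p j v) =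
      (\<Sum>j\<le>d. s ^ j * f j v) * (\<Sum>k<m. s ^ k * g k v) + (\<Sum>j<d. s ^ j * r j v)" by blast
    then show ?thesis using Suc.prems(2)[of m] 2 by (intro exI[of _ g] exI[of _ r]) auto
  next
    case 3
    \<comment> \<open>The term \<open>s ^ m * p m\<close> is cancelled by \<open>s ^ n * a\<close>
      times the divisor. This alters only the coefficients with \<open>n \<le> j < m\<close>, where
      the degrees \<open>e - m\<close> and \<open>d - (j - n)\<close> add up to
      \<open>e - j\<close>.\<close>
    define a where "a = fscale (1 / c) (p m)"
    define p' where "p' j = p j - (if n \<le> j \<and> j < m then (\<lambda>v. a v * f (j - n) v) else 0)" for j
    have a: "a \<in> hom_poly V (e - m)" unfolding a_def using 3 Suc.prems(1) by (simp add: hom_poly_fscale)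
    have "p' j \<in> hom_poly V k" if "j + k = e" for j k
    proof -
      have "(\<lambda>v. a v * f (j - n) v) \<in> hom_poly V k" if "n \<le> j" "j < m"
      proof -
        have "k = (e - m) + (d - (j - n))" using that 3 \<open>j + k = e\<close> by auto
        moreover have "(j - n) + (d - (j - n)) = d" using that 3 by auto
        ultimately show ?thesis using hom_poly_mult[OF a f, of "j - n" "d - (j - n)"] by simp
      qed
      then show ?thesis unfolding p'_def using Suc.prems(1)[OF that]
        by (auto intro!: hom_poly_diff hom_poly_0)
    qed
    moreover have "p' j = 0" if "e < j" for j
      using that Suc.prems(2) 3 by (auto simp: p'_def)
    ultimately obtain g r where
      gr: "\<forall>k l. k + d + l = e \<longrightarrow> g k \<in> hom_poly V l" "\<forall>k. e < k + d \<longrightarrow> g k = 0"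
      "\<forall>j k. j + k = e \<longrightarrow> r j \<in> hom_poly V k" "\<forall>j>e. r j = 0"
      "\<And>v s. v\<in>V \<Longrightarrow> (\<Sum>j<m. s ^ j * p' j v) =
      (\<Sum>j\<le>d. s ^ j * f j v) * (\<Sum>k<m. s ^ k * g k v) + (\<Sum>j<d. s ^ j * r j v)"
      using Suc.hyps[of p'] by blast
    \<comment> \<open>The sum in the induction hypothesis stops before \<open>m\<close>, so
      \<open>g k\<close> is uncontrolled from there on and has to be cut off.\<close>
    define g' where "g' k = (if k < m then g k else 0) + (if k = n then a else 0)" for k
    have "g' k \<in> hom_poly V l" if "k + d + l = e" for k l
      using that gr(1) a 3 unfolding g'_def by (auto intro!: hom_poly_add hom_poly_0)
    moreover have "g' k = 0" if "e < k + d" for k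
      using that gr(2) 3 unfolding g'_def by auto
    moreover have "(\<Sum>j<Suc m. s ^ j * p j v) =
          (\<Sum>j\<le>d. s ^ j * f j v) * (\<Sum>k<Suc m. s ^ k * g' k v) + (\<Sum>j<d. s ^ j * r j v)"
      if v: "v \<in> V" for v s
    proof -
      have 1: "(\<Sum>j<m. s ^ j * p j v) = (\<Sum>j<m. s ^ j * p' j v) + a v * (s ^ n * (\<Sum>i<d. s ^ i * f i v))"
      proof -
        have "s ^ j * p j v = s ^ j * p' j v + a v * (if n \<le> j then s ^ j * f (j - n) v else 0)"
          if "j < m" for j
          using that by (simp add: p'_def algebra_simps)
        then show ?thesis
          using 3(1) sum_lessThan_shift[where h = "\<lambda>i. f i v"]
          by (simp add: sum.distrib sum_distrib_left[symmetric])
      qed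
      have 2: "s ^ m * p m v = a v * (s ^ n * (s ^ d * f d v))"
        using c(2) by (simp add: a_def fscale_def c(1)[OF v] 3(1) power_add)
      have 4: "(\<Sum>k<Suc m. s ^ k * g' k v) = (\<Sum>k<m. s ^ k * g k v) + s ^ n * a v"
      proof -
        have "(\<Sum>k<Suc m. if k < m then s ^ k * g k v else 0) = (\<Sum>k<m. s ^ k * g k v)"
          by simp
        moreover have "(\<Sum>k<Suc m. if n = k then s ^ n * a v else 0) = s ^ n * a v"
          using 3(1) by (simp del: sum.lessThan_Suc)
        moreover have "(\<Sum>k<Suc m. s ^ k * g' k v) =
            (\<Sum>k<Suc m. (if k < m then s ^ k * g k v else 0) + (if n = k then s ^ n * a v else 0))"
          by (intro sum.cong) (auto simp: g'_def algebra_simps)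
        ultimately show ?thesis
          by (simp only: sum.distrib)
      qed
      have "(\<Sum>j\<le>d. s ^ j * f j v) = (\<Sum>i<d. s ^ i * f i v) + s ^ d * f d v"
        by (simp add: lessThan_Suc_atMost[symmetric])
      then show ?thesis
        using gr(5)[OF v, of s] 1 2 4 by (simp add: algebra_simps)
    qed
    ultimately show ?thesis using gr(3,4) by blast
  qed
qed

text \<open>If all roots of the perturbed polynomial kept distance \<open>\<epsilon>\<close> from
  \<open>s0\<close>, its value at \<open>s0\<close>, which is \<open>c\<close> times a product over
  the roots, would have norm at least \<open>norm c * \<epsilon> ^ d\<close>. By continuity that
  value tends to 0.\<close>

lemma root_of_perturbed_polynomial:
  fixes \<phi> :: "nat \<Rightarrow> complex \<Rightarrow> complex"
  assumes cont: "\<And>j. isCont (\<phi> j) 0" and lead: "\<And>u. \<phi> d u = c" "c \<noteq> 0"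
    and root: "(\<Sum>j\<le>d. s0 ^ j * \<phi> j 0) = 0" and e: "0 < \<epsilon>"
  shows "\<forall>\<^sub>F u in at 0. \<exists>s. dist s s0 < \<epsilon> \<and> (\<Sum>j\<le>d. s ^ j * \<phi> j u) = 0"
proof -
  have "((\<lambda>u. \<Sum>j\<le>d. s0 ^ j * \<phi> j u) \<longlongrightarrow> (\<Sum>j\<le>d. s0 ^ j * \<phi> j 0)) (at 0)"
    using cont by (auto intro!: tendsto_intros simp: isCont_def)
  then have "((\<lambda>u. \<Sum>j\<le>d. s0 ^ j * \<phi> j u) \<longlongrightarrow> 0) (at 0)"
    by (simp only: root)
  from tendstoD[OF this, of "norm c * \<epsilon> ^ d"]
  have "\<forall>\<^sub>F u in at 0. norm (\<Sum>j\<le>d. s0 ^ j * \<phi> j u) < norm c * \<epsilon> ^ d"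
    using lead(2) e by simp
  then show ?thesis
  proof eventually_elim
    case (elim u)
    define p where "p = (\<Sum>j\<le>d. monom (\<phi> j u) j)"
    have poly_p: "poly p s = (\<Sum>j\<le>d. s ^ j * \<phi> j u)" for s
      by (simp add: p_def poly_sum poly_monom mult.commute)
    have cp: "coeff p j = (if j \<le> d then \<phi> j u else 0)" for j
      by (simp add: p_def coeff_sum)
    have deg: "degree p = d"
      by (rule antisym) (auto intro!: degree_le le_degree simp: cp lead)
    then have lc: "lead_coeff p = c" by (simp add: cp lead)
    obtain r where r: "smult c (\<Prod>i<d. [:- r i, 1:]) = p"
      using complex_poly_decompose'[of p] deg lc by metis
    have prod: "poly p s = c * (\<Prod>i<d. s - r i)" for s
      by (subst r[symmetric]) (simp add: poly_prod)
    have "\<exists>i<d. dist (r i) s0 < \<epsilon>"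
    proof (rule ccontr)
      assume "\<not> ?thesis"
      then have "\<epsilon> \<le> norm (s0 - r i)" if "i < d" for i
        using that by (auto simp: dist_norm norm_minus_commute not_less) (metis not_le)
      then have "(\<Prod>i<d. \<epsilon>) \<le> (\<Prod>i<d. norm (s0 - r i))"
        using e by (intro prod_mono) auto
      then have "norm c * \<epsilon> ^ d \<le> norm (poly p s0)"
        by (simp add: prod norm_mult prod_norm mult_left_mono)
      with elim show False by (simp add: poly_p)
    qed
    then obtain i where i: "i < d" "dist (r i) s0 < \<epsilon>" by blast
    moreover have "poly p (r i) = 0" using i(1) by (auto simp: prod)
    ultimately show ?case by (auto simp: poly_p)
  qed
qed

text \<open>Divide \<open>P\<close> by \<open>F\<close> with respect to a coordinate in which \<open>F\<close> has constant leading
  coefficient. On a line parallel to the coordinate axis and close to the given one, \<open>F\<close> still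
  has \<open>d\<close> distinct roots, all of which are roots of the remainder.\<close>

lemma hom_poly_divisible:
  assumes V: "fv.subspace V"
    and F: "F \<in> hom_poly V d" and P: "P \<in> hom_poly V e" and N: "N \<in> hom_poly V n"
    and U: "U \<in> V" "F U \<noteq> 0" and T: "T \<in> V"
    and S: "finite S" "card S = d"
      "\<And>s. s \<in> S \<Longrightarrow> F (T + fscale s U) = 0" "\<And>s. s \<in> S \<Longrightarrow> N (T + fscale s U) \<noteq> 0"
    and van: "\<And>v. v \<in> V \<Longrightarrow> F v = 0 \<Longrightarrow> N v \<noteq> 0 \<Longrightarrow> P v = 0"
  obtains k G where "G \<in> hom_poly V k" "P = (\<lambda>v. F v * G v)" "P \<noteq> 0 \<Longrightarrow> d + k = e"
proof -
  obtain f where f: "\<And>j k. j + k = d \<Longrightarrow> f j \<in> hom_poly V k"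
      "\<And>v s. v \<in> V \<Longrightarrow> F (v + fscale s U) = (\<Sum>j\<le>d. s ^ j * f j v)"
    using hom_poly_line_expansion[OF V U(1) F] by metis
  obtain p where p: "\<And>j k. j + k = e \<Longrightarrow> p j \<in> hom_poly V k" "\<And>j. e < j \<Longrightarrow> p j = 0"
      "\<And>v s. v \<in> V \<Longrightarrow> P (v + fscale s U) = (\<Sum>j\<le>e. s ^ j * p j v)"
    using hom_poly_line_expansion[OF V U(1) P] by metis
  obtain q where q: "\<And>j k. j + k = n \<Longrightarrow> q j \<in> hom_poly V k"
      "\<And>v s. v \<in> V \<Longrightarrow> N (v + fscale s U) = (\<Sum>j\<le>n. s ^ j * q j v)"
    using hom_poly_line_expansion[OF V U(1) N] by metis
  define c where "c = F U"
  have "0 \<in> V" using V fv.subspace_0 by blast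
  \<comment> \<open>The top coefficient has degree 0 and is therefore constant; at the origin all
    lower coefficients vanish by homogeneity, which leaves \<open>F U\<close>.\<close>
  have fd: "f d v = c" if "v \<in> V" for v
  proof -
    obtain c' where c': "\<And>v. v \<in> V \<Longrightarrow> f d v = c'"
      using f(1)[of d 0] hom_poly_degree_0 by auto
    have "f j 0 = 0" if "j < d" for j
    proof -
      have "f j (fscale 0 0) = 0 ^ (d - j) * f j 0"
        using that by (intro hom_poly_homogeneous[OF V f(1) \<open>0 \<in> V\<close>]) auto
      moreover have "fscale 0 0 = (0 :: 'a \<Rightarrow> complex)" by (auto simp: fscale_def)
      ultimately show ?thesis using that by (metis mult_zero_left power_0_left zero_less_diff less_not_refl)
    qed
    then have "(\<Sum>j\<le>d. 1 ^ j * f j 0) = f d 0"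
      by (simp add: lessThan_Suc_atMost[symmetric])
    moreover have "F (0 + fscale 1 U) = c" by (simp add: c_def fscale_def)
    ultimately show ?thesis using f(2)[OF \<open>0 \<in> V\<close>, of 1] c'[OF that] c'[OF \<open>0 \<in> V\<close>] by simp
  qed
  have c0: "c \<noteq> 0" using U by (simp add: c_def)
  obtain g r where
    g: "\<And>k l. k + d + l = e \<Longrightarrow> g k \<in> hom_poly V l" "\<And>k. e < k + d \<Longrightarrow> g k = 0"
    and r: "\<And>j k. j + k = e \<Longrightarrow> r j \<in> hom_poly V k" "\<And>j. e < j \<Longrightarrow> r j = 0"
    and gr: "\<And>v s. v\<in>V \<Longrightarrow> (\<Sum>j<Suc e. s ^ j * p j v) =
      (\<Sum>j\<le>d. s ^ j * f j v) * (\<Sum>k<Suc e. s ^ k * g k v) + (\<Sum>j<d. s ^ j * r j v)"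
    using hom_poly_line_division[where f = f and p = p and m = "Suc e" and d = d and e = e and V = V and c = c, OF f(1) fd c0 p(1) p(2)] by blast
  \<comment> \<open>\<open>v\<close> is joined to \<open>T\<close> by the line \<open>L\<close>.
    Near \<open>u = 0\<close> the remainder, of degree below \<open>d\<close> in \<open>s\<close>,
    has \<open>d\<close> distinct roots; so \<open>r j\<close> vanishes there, hence on the whole
    line and at \<open>v = L 1\<close>.\<close>
  have rem: "r j v = 0" if v: "v \<in> V" and j: "j < d" for j v
  proof -
    define W where "W = v - T"
    define L where "L u = T + fscale u W" for u
    have W: "W \<in> V" unfolding W_def using V v T fv.subspace_diff by blast
    have L: "L u \<in> V" for u unfolding L_def using V W T by (simp add: fv.subspace_add fv.subspace_scale)
    have L0: "L 0 = T" and L1: "L 1 = v" by (auto simp: L_def W_def fscale_def)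
    have cont: "isCont (\<lambda>u. Q (L u)) u" if Q: "Q \<in> hom_poly V k" for Q k u
    proof -
      obtain w where "\<And>t. Q (T + fscale t W) = poly w t" using hom_poly_on_line[OF V T W Q] by blast
      then show ?thesis by (simp add: L_def)
    qed
    define \<phi> where "\<phi> j u = (if j \<le> d then f j (L u) else 0)" for j u
    have \<phi>: "isCont (\<phi> j) u" for j u
      unfolding \<phi>_def using cont[OF f(1)[of j "d - j"], of u] by (cases "j \<le> d") auto
    have F\<phi>: "F (L u + fscale s U) = (\<Sum>j\<le>d. s ^ j * \<phi> j u)" for u s
      unfolding f(2)[OF L] \<phi>_def by (intro sum.cong) auto
    \<comment> \<open>The hypothesis on \<open>P\<close> applies only where \<open>N\<close> is
      nonzero, so each root over \<open>u = 0\<close> needs a neighbourhood on which this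
      persists.\<close>
    have "\<exists>\<delta>>0. \<forall>u t. norm u < \<delta> \<longrightarrow> dist t s < \<delta> \<longrightarrow> N (L u + fscale t U) \<noteq> 0" if s: "s \<in> S" for s
    proof -
      define \<nu> where "\<nu> x = (\<Sum>j\<le>n. snd x ^ j * q j (L (fst x)))" for x
      have qc: "isCont (\<lambda>x. q j (L (fst x))) x" if "j \<le> n" for j and x :: "complex \<times> complex"
        using isCont_o2[OF isCont_fst[OF continuous_ident] cont[OF q(1)[of j "n - j"]]] that by simp
      have "isCont \<nu> (0, s)" unfolding \<nu>_def by (intro continuous_intros qc) auto
      moreover have "\<nu> (0, s) \<noteq> 0" using S(4)[OF s] q(2)[OF T, of s] by (simp add: \<nu>_def L0)
      ultimately obtain \<delta> where \<delta>: "\<delta> > 0" "\<And>y. dist (0, s) y < \<delta> \<Longrightarrow> \<nu> y \<noteq> 0"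
        using continuous_at_avoid by blast
      have "N (L u + fscale t U) \<noteq> 0" if "norm u < \<delta> / 2" "dist t s < \<delta> / 2" for u t
      proof -
        have "dist (0, s) (u, t) \<le> norm u + dist s t"
          unfolding dist_Pair_Pair using sqrt_sum_squares_le_sum[of "dist 0 u" "dist s t"] by simp
        also have "\<dots> < \<delta>" using that by (simp add: dist_commute)
        finally have "\<nu> (u, t) \<noteq> 0" by (rule \<delta>(2))
        then show ?thesis using q(2)[OF L, of u t] by (simp add: \<nu>_def)
      qed
      then show ?thesis using \<delta>(1) by (intro exI[of _ "\<delta> / 2"]) auto
    qed
    then obtain \<delta> where \<delta>: "\<And>s. s \<in> S \<Longrightarrow> \<delta> s > 0"
      "\<And>s u t. s \<in> S \<Longrightarrow> norm u < \<delta> s \<Longrightarrow> dist t s < \<delta> s \<Longrightarrow> N (L u + fscale t U) \<noteq> 0" by metis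
    have ev: "\<forall>\<^sub>F x in at_right (0::real). x < y" if "y > 0" for y
      using that by (rule order_tendstoD(2)[OF tendsto_ident_at])
    have "\<forall>\<^sub>F x in at_right (0::real). (\<forall>s\<in>S. x < \<delta> s) \<and> (\<forall>s\<in>S. \<forall>t\<in>S. s \<noteq> t \<longrightarrow> x < dist s t / 2) \<and> x > 0"
      by (intro eventually_conj eventually_ball_finite ballI S(1) ev \<delta>(1))
        (auto intro: ev simp: eventually_at_right_less simp del: less_divide_eq_numeral1)
    \<comment> \<open>Roots displaced by less than \<open>\<epsilon>\<close> stay in these
      neighbourhoods, and since \<open>\<epsilon>\<close> is below half of every distance between
      points of \<open>S\<close>, they remain distinct.\<close>
    then obtain \<epsilon> where \<epsilon>: "\<And>s. s \<in> S \<Longrightarrow> \<epsilon> < \<delta> s"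
      "\<And>s t. s \<in> S \<Longrightarrow> t \<in> S \<Longrightarrow> s \<noteq> t \<Longrightarrow> \<epsilon> < dist s t / 2" "\<epsilon> > 0"
      using eventually_happens'[OF trivial_limit_at_right_real] by blast
    have "\<forall>\<^sub>F u in at 0. \<forall>s\<in>S. \<exists>t. dist t s < \<epsilon> \<and> (\<Sum>j\<le>d. t ^ j * \<phi> j u) = 0"
    proof (intro eventually_ball_finite ballI S(1) root_of_perturbed_polynomial)
      fix s assume "s \<in> S"
      then show "(\<Sum>j\<le>d. s ^ j * \<phi> j 0) = 0" using S(3) by (simp add: F\<phi>[symmetric] L0)
    qed (rule \<phi>, simp add: \<phi>_def fd L, rule c0, rule \<epsilon>(3))
    moreover have "\<forall>\<^sub>F u in at (0::complex). norm u < \<epsilon>"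
      using \<epsilon>(3) by (auto simp: eventually_at dist_norm intro!: exI[of _ \<epsilon>])
    ultimately have "\<forall>\<^sub>F u in at 0. r j (L u) = 0"
    proof eventually_elim
      case (elim u)
      then obtain h where h: "\<And>s. s \<in> S \<Longrightarrow> dist (h s) s < \<epsilon>"
        "\<And>s. s \<in> S \<Longrightarrow> (\<Sum>j\<le>d. h s ^ j * \<phi> j u) = 0" by metis
      have inj: "inj_on h S"
      proof (rule inj_onI, rule ccontr)
        fix s t assume st: "s \<in> S" "t \<in> S" "h s = h t" "s \<noteq> t"
        have "dist s t \<le> dist (h s) s + dist (h t) t"
          using dist_triangle3[of s t "h s"] st by simp
        also have "\<dots> < dist s t" using h(1)[OF st(1)] h(1)[OF st(2)] \<epsilon>(2)[OF st(1,2,4)] by simp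
        finally show False by simp
      qed
      define w where "w = (\<Sum>j<d. monom (r j (L u)) j)"
      have "poly w (h s) = 0" if s: "s \<in> S" for s
      proof -
        have F0: "F (L u + fscale (h s) U) = 0" using h(2)[OF s] F\<phi> by simp
        moreover have "N (L u + fscale (h s) U) \<noteq> 0"
          using \<epsilon>(1)[OF s] h(1)[OF s] elim by (intro \<delta>(2)[OF s]) auto
        moreover have "L u + fscale (h s) U \<in> V"
          using V L U by (simp add: fv.subspace_add fv.subspace_scale)
        ultimately have "P (L u + fscale (h s) U) = 0" using van by blast
        then show ?thesis
          using gr[OF L, of "h s" u] F0 f(2)[OF L, of u "h s"] p(3)[OF L, of u "h s"]
          by (simp add: w_def poly_sum poly_monom mult.commute lessThan_Suc_atMost)
      qed
      then have sub: "h ` S \<subseteq> {x. poly w x = 0}" by auto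
      have "w = 0"
      proof (rule ccontr)
        assume "w \<noteq> 0"
        then have "d \<le> degree w"
          using card_poly_roots_bound[of w] card_mono[OF poly_roots_finite sub] inj S(2)
          by (auto simp: card_image)
        moreover have "degree w \<le> d - 1"
          unfolding w_def by (intro degree_sum_le) (auto intro: order.trans[OF degree_monom_le])
        ultimately show False using j by simp
      qed
      then have "coeff w j = 0" by simp
      then show ?case using j by (simp add: w_def coeff_sum)
    qed
    then obtain \<eta> where \<eta>: "\<eta> > 0" "\<And>u. u \<noteq> 0 \<Longrightarrow> dist u 0 < \<eta> \<Longrightarrow> r j (L u) = 0"
      by (auto simp: eventually_at)
    have "infinite (ball (0::complex) \<eta> - {0})"
      using uncountable_ball[OF \<eta>(1), of "0::complex"] by (simp add: uncountable_infinite)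
    moreover have "ball 0 \<eta> - {0} \<subseteq> {t. r j (T + fscale t W) = 0}"
      using \<eta>(2) by (auto simp: L_def dist_commute)
    ultimately have inf: "infinite {t. r j (T + fscale t W) = 0}" using finite_subset by blast
    show ?thesis
    proof (cases "j \<le> e")
      case True
      then show ?thesis
        using hom_poly_zero_by_line[OF V T W r(1)[of j "e - j"] inf, of 1] unfolding L1[unfolded L_def] by simp
    qed (use r(2) in simp)
  qed
  have main: "P v = F v * g 0 v" if v: "v \<in> V" for v
  proof -
    have "v + fscale 0 U = v" by (auto simp: fscale_def)
    then have "F v = (\<Sum>j\<le>d. 0 ^ j * f j v)" "P v = (\<Sum>j<Suc e. 0 ^ j * p j v)"
      using f(2)[OF v, of 0] p(3)[OF v, of 0] by (simp_all add: lessThan_Suc_atMost)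
    moreover have "(\<Sum>k<Suc e. 0 ^ k * g k v) = g 0 v"
      by (subst sum.lessThan_Suc_shift) simp
    ultimately show ?thesis using gr[OF v, of 0] rem[OF v] by simp
  qed
  show thesis
  proof (cases "d \<le> e")
    case True
    have G: "g 0 \<in> hom_poly V (e - d)" using True by (intro g(1)) auto
    moreover have "P = (\<lambda>v. F v * g 0 v)"
      using main hom_poly_outside[OF P] hom_poly_outside[OF F] by (metis mult_zero_left)
    ultimately show thesis using True by (intro that) auto
  next
    case False
    then have "P = 0" using main g(2)[of 0] hom_poly_outside[OF P] by (auto simp: fun_eq_iff)
    then show thesis using that[of 0 0] by (simp add: zero_fun_def hom_poly_0[unfolded zero_fun_def])
  qed
qed

section \<open>Coordinates\<close>

lemma dualI:
  assumes "vector_space sA" "\<And>x y. \<alpha> (x + y) = \<alpha> x + \<alpha> y" "\<And>c x. \<alpha> (sA c x) = c * \<alpha> x"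
  shows "\<alpha> \<in> dual sA"
  using assms unfolding dual_def Vector_Spaces.linear_iff
  by (simp add: vector_space_over_itself.vector_space_axioms)

lemma dualD:
  assumes "\<alpha> \<in> dual sA"
  shows "vector_space sA" "\<alpha> (x + y) = \<alpha> x + \<alpha> y" "\<alpha> (sA c x) = c * \<alpha> x" "\<alpha> 0 = 0"
    "\<alpha> (sum g I) = (\<Sum>i\<in>I. \<alpha> (g i))"
proof -
  interpret Vector_Spaces.linear sA "(*)" \<alpha> using assms by (simp add: dual_def)
  show "vector_space sA" "\<alpha> (x + y) = \<alpha> x + \<alpha> y" "\<alpha> (sA c x) = c * \<alpha> x" "\<alpha> 0 = 0"
    "\<alpha> (sum g I) = (\<Sum>i\<in>I. \<alpha> (g i))"
    by (rule vs1.vector_space_axioms add scale zero sum)+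
qed

lemma dual_0: "vector_space sA \<Longrightarrow> (0 :: 'a::ab_group_add \<Rightarrow> complex) \<in> dual sA"
  by (rule dualI) auto

lemma dual_add: "\<alpha> \<in> dual sA \<Longrightarrow> \<beta> \<in> dual sA \<Longrightarrow> \<alpha> + \<beta> \<in> dual sA"
  by (rule dualI) (auto simp: dualD algebra_simps)

lemma dual_fscale: "\<alpha> \<in> dual sA \<Longrightarrow> fscale c \<alpha> \<in> dual sA"
  by (rule dualI) (auto simp: dualD fscale_def algebra_simps)

lemma dual_compose:
  "\<alpha> \<in> dual sA \<Longrightarrow> Vector_Spaces.linear sA sA g \<Longrightarrow> (\<lambda>x. \<alpha> (g x)) \<in> dual sA"
  unfolding dual_def using Vector_Spaces.linear_compose[of sA sA g "(*)" \<alpha>] by (simp add: o_def)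

text \<open>The index type \<open>3\<close> turns endomorphisms into elements of
  \<open>complex^3^3\<close> and provides the cyclic arithmetic \<open>i + 1\<close>,
  \<open>i + 2\<close> used for the quartics.\<close>

locale coord3 =
  fixes sA :: "complex \<Rightarrow> 'a::ab_group_add \<Rightarrow> 'a" and e :: "3 \<Rightarrow> 'a" and a :: "3 \<Rightarrow> 'a \<Rightarrow> complex"
  assumes vs: "vector_space sA"
    and a_dual: "a i \<in> dual sA"
    and a_e: "a i (e j) = (if i = j then 1 else 0)"
    and basis_expansion: "(\<Sum>i\<in>UNIV. sA (a i x) (e i)) = x"

lemma coord3_exists:
  fixes sA :: "complex \<Rightarrow> 'a::ab_group_add \<Rightarrow> 'a"
  assumes vs: "vector_space sA" and dim: "vector_space.dim sA UNIV = 3"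
  shows "\<exists>e a. coord3 sA e a"
proof -
  interpret vector_space sA by (rule vs)
  obtain B where B: "B \<subseteq> UNIV" "independent B" "UNIV \<subseteq> span B" "card B = 3"
    using basis_exists[of UNIV] dim by metis
  then have fin: "finite B" by (metis card.infinite zero_neq_numeral)
  have "card (UNIV :: 3 set) = card B" using B by simp
  then obtain e where e: "bij_betw e (UNIV :: 3 set) B"
    using finite_same_card_bij[OF finite fin] by blast
  define a where "a i x = representation B x (e i)" for i x
  have eB: "e i \<in> B" for i using e by (auto simp: bij_betw_def)
  have sp: "x \<in> span B" for x using B by auto
  have "coord3 sA e a"
  proof
    show "a i \<in> dual sA" for i
      unfolding a_def using vs
      by (rule dualI) (simp_all add: representation_add[OF B(2) sp sp] representation_scale[OF B(2) sp])
    show "a i (e j) = (if i = j then 1 else 0)" for i j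
      using representation_basis[OF B(2) eB] e by (auto simp: a_def bij_betw_def inj_def)
    show "(\<Sum>i\<in>UNIV. sA (a i x) (e i)) = x" for x
    proof -
      have "(\<Sum>i\<in>UNIV. sA (a i x) (e i)) = (\<Sum>b\<in>B. sA (representation B x b) b)"
        unfolding a_def by (rule sum.reindex_bij_betw[OF e])
      also have "\<dots> = x" by (rule sum_representation_eq[OF B(2) sp fin]) auto
      finally show ?thesis .
    qed
  qed
  then show ?thesis by blast
qed

context coord3
begin

sublocale vector_space sA by (rule vs)

lemma dual_expansion: "\<alpha> \<in> dual sA \<Longrightarrow> \<alpha> x = (\<Sum>i\<in>UNIV. a i x * \<alpha> (e i))"
  by (subst basis_expansion[of x, symmetric]) (simp add: dualD)

lemma coord_eqI: "(\<And>i. a i x = a i y) \<Longrightarrow> x = y"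
  by (subst basis_expansion[of x, symmetric], subst basis_expansion[of y, symmetric]) (simp only:)

lemma a_simps [simp]:
  "a i (x + y) = a i x + a i y" "a i (sA c x) = c * a i x" "a i 0 = 0"
  "a i (sum g I) = (\<Sum>j\<in>I. a i (g j))"
  by (rule dualD[OF a_dual])+

definition lin_of :: "complex^3^3 \<Rightarrow> 'a \<Rightarrow> 'a" where
  "lin_of M x = (\<Sum>i\<in>UNIV. sA (\<Sum>j\<in>UNIV. M $ i $ j * a j x) (e i))"

definition mat_of :: "('a \<Rightarrow> 'a) \<Rightarrow> complex^3^3" where
  "mat_of g = (\<chi> i j. a i (g (e j)))"

lemma a_lin_of: "a i (lin_of M x) = (\<Sum>j\<in>UNIV. M $ i $ j * a j x)"
  by (simp add: lin_of_def a_e if_distrib[of "\<lambda>x. _ * x"] cong: if_cong)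

lemma linear_lin_of: "Vector_Spaces.linear sA sA (lin_of M)"
  unfolding Vector_Spaces.linear_iff
  by (auto intro!: vs coord_eqI simp: a_lin_of algebra_simps sum.distrib sum_distrib_left)

lemma lin_of_mult: "lin_of (M ** N) x = lin_of M (lin_of N x)"
proof (rule coord_eqI)
  fix i
  show "a i (lin_of (M ** N) x) = a i (lin_of M (lin_of N x))"
    by (simp add: a_lin_of matrix_matrix_mult_def sum_3 algebra_simps)
qed

lemma lin_of_one: "lin_of (mat 1) x = x"
  by (rule coord_eqI) (simp add: a_lin_of mat_def if_distrib[of "\<lambda>x. x * _"] cong: if_cong)

lemma lin_of_GL: "det M \<noteq> 0 \<Longrightarrow> lin_of M \<in> GL sA"
proof -
  assume "det M \<noteq> 0"
  then obtain N where N: "M ** N = mat 1" "N ** M = mat 1"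
    using invertible_det_nz[of M] unfolding invertible_def by blast
  have "bij (lin_of M)"
    by (rule o_bij[of "lin_of N"]) (simp_all add: fun_eq_iff lin_of_mult[symmetric] N lin_of_one)
  then show ?thesis using linear_lin_of by (simp add: GL_def)
qed

lemma lin_of_basis: "lin_of M (e j) = (\<Sum>i\<in>UNIV. sA (M $ i $ j) (e i))"
  by (simp add: lin_of_def a_e if_distrib[of "\<lambda>x. _ * x"] cong: if_cong)

lemma linear_on_basis:
  assumes "Vector_Spaces.linear sA sA g"
  shows "g (e j) = (\<Sum>i\<in>UNIV. sA (mat_of g $ i $ j) (e i))"
  by (simp add: mat_of_def basis_expansion)

lemma lin_of_mat_of:
  assumes "Vector_Spaces.linear sA sA g"
  shows "lin_of (mat_of g) = g"
proof
  fix x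
  interpret g: Vector_Spaces.linear sA sA g by (rule assms)
  show "lin_of (mat_of g) x = g x"
  proof (rule coord_eqI)
    fix i
    have "a i (g x) = a i (g (\<Sum>j\<in>UNIV. sA (a j x) (e j)))" by (simp add: basis_expansion)
    also have "\<dots> = a i (lin_of (mat_of g) x)"
      by (simp add: g.sum g.scale a_lin_of mat_of_def mult.commute)
    finally show "a i (lin_of (mat_of g) x) = a i (g x)" by simp
  qed
qed

end

section \<open>Trilinear forms\<close>

definition trilinear where
  "trilinear sA sB sC T \<longleftrightarrow> (\<forall>y z. (\<lambda>x. T (x, y, z)) \<in> dual sA) \<and>
    (\<forall>x z. (\<lambda>y. T (x, y, z)) \<in> dual sB) \<and> (\<forall>x y. (\<lambda>z. T (x, y, z)) \<in> dual sC)"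

definition pull :: "('a \<Rightarrow> 'a) \<Rightarrow> ('b \<Rightarrow> 'b) \<Rightarrow> ('c \<Rightarrow> 'c) \<Rightarrow> ('a \<times> 'b \<times> 'c \<Rightarrow> complex) \<Rightarrow> ('a \<times> 'b \<times> 'c \<Rightarrow> complex)"
  where "pull g h k T = (\<lambda>(x, y, z). T (g x, h y, k z))"

lemma pull_apply [simp]: "pull g h k T (x, y, z) = T (g x, h y, k z)"
  by (simp add: pull_def)

lemma pull_add: "pull g h k (S + T) = pull g h k S + pull g h k T"
  and pull_fscale: "pull g h k (fscale r T) = fscale r (pull g h k T)"
  by (auto simp: fscale_def)

lemma poly_act_pull: "poly_act (g, h, k) P T = P (pull g h k T)"
  by (simp add: poly_act_def pull_def)

lemma trilinear_tensor3:
  assumes "\<alpha> \<in> dual sA" "\<beta> \<in> dual sB" "\<gamma> \<in> dual sC"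
  shows "trilinear sA sB sC (tensor3 \<alpha> \<beta> \<gamma>)"
  unfolding trilinear_def tensor3_def using assms
  by (auto intro!: dualI simp: dualD algebra_simps)

lemma subspace_trilinear:
  assumes "vector_space sA" "vector_space sB" "vector_space sC"
  shows "fv.subspace {T. trilinear sA sB sC T}"
  unfolding fv.subspace_def trilinear_def
  using dual_add[of _ sA, unfolded plus_fun_def] dual_add[of _ sB, unfolded plus_fun_def]
    dual_add[of _ sC, unfolded plus_fun_def] dual_fscale[of _ sA, unfolded fscale_def]
    dual_fscale[of _ sB, unfolded fscale_def] dual_fscale[of _ sC, unfolded fscale_def]
    dual_0[of sA, unfolded zero_fun_def] dual_0[of sB, unfolded zero_fun_def] dual_0[of sC, unfolded zero_fun_def] assms
  by (simp add: fscale_def)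

locale three_coord3 =
  A: coord3 sA e a + B: coord3 sB f b + C: coord3 sC h c
  for sA :: "complex \<Rightarrow> 'a::ab_group_add \<Rightarrow> 'a" and e a
    and sB :: "complex \<Rightarrow> 'b::ab_group_add \<Rightarrow> 'b" and f b
    and sC :: "complex \<Rightarrow> 'c::ab_group_add \<Rightarrow> 'c" and h c
begin

abbreviation "V \<equiv> dual_tensors sA sB sC"

definition ten :: "(3 \<Rightarrow> 3 \<Rightarrow> 3 \<Rightarrow> complex) \<Rightarrow> 'a \<times> 'b \<times> 'c \<Rightarrow> complex" where
  "ten t = (\<Sum>i\<in>UNIV. \<Sum>j\<in>UNIV. \<Sum>k\<in>UNIV. fscale (t i j k) (tensor3 (a i) (b j) (c k)))"

lemma subspace_V: "fv.subspace V"
  by (simp add: dual_tensors_def tensor_prod3_def)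

lemma tensor3_in_V: "\<alpha> \<in> dual sA \<Longrightarrow> \<beta> \<in> dual sB \<Longrightarrow> \<gamma> \<in> dual sC \<Longrightarrow> tensor3 \<alpha> \<beta> \<gamma> \<in> V"
  unfolding dual_tensors_def tensor_prod3_def by (rule fv.span_base) blast

lemma ten_in_V: "ten t \<in> V"
  unfolding ten_def
  by (intro fv.subspace_sum[OF subspace_V] fv.subspace_scale[OF subspace_V] tensor3_in_V
      A.a_dual B.a_dual C.a_dual)

lemma ten_apply: "ten t (x, y, z) = (\<Sum>i\<in>UNIV. \<Sum>j\<in>UNIV. \<Sum>k\<in>UNIV. t i j k * (a i x * b j y * c k z))"
  by (simp add: ten_def fscale_def tensor3_def sum_3)

lemma ten_basis [simp]: "ten t (e i, f j, h k) = t i j k"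
  by (simp add: ten_apply A.a_e B.a_e C.a_e if_distrib[of "\<lambda>x. _ * x"] if_distrib[of "\<lambda>x. x * _"] cong: if_cong)

lemma trilinear_expansion:
  assumes "trilinear sA sB sC T"
  shows "T = ten (\<lambda>i j k. T (e i, f j, h k))"
proof (intro ext, clarify)
  fix x y z
  have "T (x, y, z) = (\<Sum>i\<in>UNIV. a i x * T (e i, y, z))"
    using assms by (intro A.dual_expansion) (simp add: trilinear_def)
  also have "\<dots> = (\<Sum>i\<in>UNIV. a i x * (\<Sum>j\<in>UNIV. b j y * T (e i, f j, z)))"
    by (intro sum.cong arg_cong2[of _ _ _ _ "(*)"] refl B.dual_expansion) (use assms in \<open>simp add: trilinear_def\<close>)
  also have "\<dots> = (\<Sum>i\<in>UNIV. a i x * (\<Sum>j\<in>UNIV. b j y * (\<Sum>k\<in>UNIV. c k z * T (e i, f j, h k))))"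
    by (intro sum.cong arg_cong2[of _ _ _ _ "(*)"] refl C.dual_expansion) (use assms in \<open>simp add: trilinear_def\<close>)
  finally show "T (x, y, z) = ten (\<lambda>i j k. T (e i, f j, h k)) (x, y, z)"
    by (simp add: ten_apply sum_distrib_left algebra_simps)
qed

text \<open>Membership in a span becomes a condition on values, because a trilinear function is a
  combination of the 27 coordinate tensors.\<close>

lemma V_iff: "T \<in> V \<longleftrightarrow> trilinear sA sB sC T"
proof
  assume "T \<in> V"
  then show "trilinear sA sB sC T"
    unfolding dual_tensors_def tensor_prod3_def
    by (induct rule: fv.span_induct)
      (use subspace_trilinear[OF A.vs B.vs C.vs] trilinear_tensor3 in auto)
next
  assume "trilinear sA sB sC T"
  from trilinear_expansion[OF this] show "T \<in> V" using ten_in_V by metis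
qed

lemma V_expansion: "T \<in> V \<Longrightarrow> T = ten (\<lambda>i j k. T (e i, f j, h k))"
  using trilinear_expansion V_iff by blast

lemma V_eqI: "S \<in> V \<Longrightarrow> T \<in> V \<Longrightarrow> (\<And>i j k. S (e i, f j, h k) = T (e i, f j, h k)) \<Longrightarrow> S = T"
  using V_expansion[of S] V_expansion[of T] by simp

lemma V_dual:
  assumes "T \<in> V"
  shows "(\<lambda>x. T (x, y, z)) \<in> dual sA" "(\<lambda>y. T (x, y, z)) \<in> dual sB" "(\<lambda>z. T (x, y, z)) \<in> dual sC"
  using assms unfolding V_iff trilinear_def by auto

lemma V_add: "S \<in> V \<Longrightarrow> T \<in> V \<Longrightarrow> S + T \<in> V"
  and V_fscale: "T \<in> V \<Longrightarrow> fscale r T \<in> V"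
  using subspace_V fv.subspace_add fv.subspace_scale by blast+

lemma pull_in_V:
  assumes T: "T \<in> V" and lin: "Vector_Spaces.linear sA sA g" "Vector_Spaces.linear sB sB g'"
    "Vector_Spaces.linear sC sC g''"
  shows "pull g g' g'' T \<in> V"
  unfolding V_iff trilinear_def
  using dual_compose[OF V_dual(1)[OF T] lin(1)] dual_compose[OF V_dual(2)[OF T] lin(2)]
    dual_compose[OF V_dual(3)[OF T] lin(3)] by simp

text \<open>Polynomials are set to 0 off \<open>V\<close>, so the action preserves them only because
  an invertible substitution also maps the complement of \<open>V\<close> to itself.\<close>

lemma pull_in_V_iff:
  assumes "g \<in> GL sA" "g' \<in> GL sB" "g'' \<in> GL sC"
  shows "pull g g' g'' T \<in> V \<longleftrightarrow> T \<in> V"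
proof
  have lin: "Vector_Spaces.linear s s (inv x)" if "x \<in> GL s"
    for s :: "complex \<Rightarrow> 'z::ab_group_add \<Rightarrow> 'z" and x
  proof -
    interpret Vector_Spaces.linear s s x using that by (simp add: GL_def)
    have bij: "bij x" using that by (simp add: GL_def)
    have xx: "x (inv x y) = y" "inv x (x y) = y" for y
      using bij by (simp_all add: bij_is_surj surj_f_inv_f bij_is_inj)
    show ?thesis unfolding Vector_Spaces.linear_iff
      using vs1.vector_space_axioms xx add scale by metis
  qed
  assume "pull g g' g'' T \<in> V"
  from pull_in_V[OF this lin lin lin, OF assms]
  have "pull (inv g) (inv g') (inv g'') (pull g g' g'' T) \<in> V" .
  moreover have "pull (inv g) (inv g') (inv g'') (pull g g' g'' T) = T"
    using assms by (auto simp: GL_def bij_is_surj surj_f_inv_f)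
  ultimately show "T \<in> V" by simp
qed (use assms pull_in_V in \<open>auto simp: GL_def\<close>)

lemma poly_act_hom_poly:
  assumes g: "g \<in> GL sA" "g' \<in> GL sB" "g'' \<in> GL sC" and P: "P \<in> hom_poly V d"
  shows "poly_act (g, g', g'') P \<in> hom_poly V d"
  using P
proof (induct rule: hom_poly_span_induct)
  case zero
  show ?case by (simp add: poly_act_def zero_fun_def hom_poly_zero)
next
  case (add P Q)
  from hom_poly_add[OF this] show ?case by (simp add: poly_act_def plus_fun_def)
next
  case (scale r P)
  from hom_poly_fscale[OF this, of r] show ?case by (simp add: poly_act_def fscale_def)
next
  case (prod L)
  have "(\<lambda>T. L i (pull g g' g'' T)) \<in> dual fscale" if "i < d" for i
    by (rule dualI[OF fv.vector_space_axioms])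
      (simp_all add: pull_add pull_fscale linear_fscaleD[OF prod[OF that]])
  from hom_poly_prod[of d "\<lambda>i T. L i (pull g g' g'' T)", OF this]
  have "(\<lambda>T. if T \<in> V then \<Prod>i<d. L i (pull g g' g'' T) else 0) \<in> hom_poly V d" .
  then show ?case by (simp add: poly_act_pull[abs_def] pull_in_V_iff[OF g])
qed

end

section \<open>Secant varieties\<close>

lemma zero_locus_closed: "S \<subseteq> (\<Union>d. hom_poly V d) \<Longrightarrow> zariski_closed V (zero_locus V S)"
  unfolding zariski_closed_def by blast

lemma closure_subset_zero_locus:
  assumes "Y \<subseteq> proj_space V" "P \<in> hom_poly V d" "\<And>p v. p \<in> Y \<Longrightarrow> v \<in> p \<Longrightarrow> P v = 0"
  shows "zariski_closure V Y \<subseteq> zero_locus V {P}"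
proof -
  have "zariski_closed V (zero_locus V {P})" using assms(2) by (intro zero_locus_closed) auto
  moreover have "Y \<subseteq> zero_locus V {P}" using assms by (auto simp: zero_locus_def)
  ultimately show ?thesis unfolding zariski_closure_def by blast
qed

text \<open>The zero locus of a form vanishing on \<open>Y\<close> is closed, so it contains the
  closure along with \<open>Y\<close>.\<close>

lemma ideal_deg_closure:
  assumes "Y \<subseteq> proj_space V"
  shows "ideal_deg V (zariski_closure V Y) d = ideal_deg V Y d"
proof
  have "Y \<subseteq> zariski_closure V Y" unfolding zariski_closure_def by blast
  then show "ideal_deg V (zariski_closure V Y) d \<subseteq> ideal_deg V Y d" unfolding ideal_deg_def by blast
  show "ideal_deg V Y d \<subseteq> ideal_deg V (zariski_closure V Y) d"
  proof
    fix P assume "P \<in> ideal_deg V Y d"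
    then show "P \<in> ideal_deg V (zariski_closure V Y) d"
      using closure_subset_zero_locus[OF assms, of P d] by (auto simp: ideal_deg_def zero_locus_def)
  qed
qed

text \<open>Divisibility already settles the set-theoretic part: a closed set containing
  \<open>Y\<close> is cut out by multiples of \<open>F\<close>, so it contains the zero locus of
  \<open>F\<close>.\<close>

lemma hypersurface_equation_closure:
  assumes Y: "Y \<subseteq> proj_space V" and F: "F \<in> ideal_deg V Y d" "F \<noteq> 0" "0 < d"
    and dvd: "\<And>e P. P \<in> ideal_deg V Y e \<Longrightarrow> \<exists>k. \<exists>G \<in> hom_poly V k. P = (\<lambda>v. F v * G v)"
  shows "hypersurface_equation V (zariski_closure V Y) d F"
proof -
  have "zero_locus V {F} \<subseteq> zariski_closure V Y"
    unfolding zariski_closure_def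
  proof (intro Inter_greatest, clarify)
    fix Z p assume "zariski_closed V Z" "Y \<subseteq> Z" and p: "p \<in> zero_locus V {F}"
    then obtain S where S: "S \<subseteq> (\<Union>d. hom_poly V d)" "Z = zero_locus V S"
      unfolding zariski_closed_def by blast
    have "P v = 0" if Pv: "P \<in> S" "v \<in> p" for P v
    proof -
      obtain e where "P \<in> hom_poly V e" using S Pv by blast
      then have "P \<in> ideal_deg V Y e"
        using \<open>Y \<subseteq> Z\<close> S Pv by (auto simp: ideal_deg_def zero_locus_def)
      from dvd[OF this] show ?thesis using p Pv by (auto simp: zero_locus_def)
    qed
    then show "p \<in> Z" using p S by (auto simp: zero_locus_def)
  qed
  moreover have "zariski_closure V Y \<subseteq> zero_locus V {F}"
    using F by (intro closure_subset_zero_locus[OF Y]) (auto simp: ideal_deg_def)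
  ultimately show ?thesis
    using F dvd unfolding hypersurface_equation_def ideal_deg_closure[OF Y]
    by (auto simp: ideal_deg_def)
qed

definition secant_points :: "_ \<Rightarrow> nat \<Rightarrow> _" where
  "secant_points V r X = \<Union>{proj_linear_span V (p ` {..<r}) | p. \<forall>i<r. p i \<in> X}"

lemma secant_variety_closure: "secant_variety V r X = zariski_closure V (secant_points V r X)"
  by (simp add: secant_variety_def secant_points_def)

lemma secant_points_proj_space: "secant_points V r X \<subseteq> proj_space V"
  by (auto simp: secant_points_def proj_linear_span_def)

lemma span_Union_lines:
  assumes "x \<in> fv.span (\<Union>i\<in>I. fv.span {t i})" "finite I"
  obtains c where "x = (\<Sum>i\<in>I. fscale (c i) (t i))"
proof -
  have "\<exists>c. x = (\<Sum>i\<in>I. fscale (c i) (t i))"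
    using assms(1)
  proof (induct rule: fv.span_induct)
    case base
    show ?case unfolding fv.subspace_def
    proof (intro conjI allI ballI impI; simp only: mem_Collect_eq)
      show "\<exists>c. 0 = (\<Sum>i\<in>I. fscale (c i) (t i))"
        by (rule exI[of _ "\<lambda>_. 0"]) simp
    next
      fix x y
      assume "\<exists>c. x = (\<Sum>i\<in>I. fscale (c i) (t i))" "\<exists>c. y = (\<Sum>i\<in>I. fscale (c i) (t i))"
      then obtain c d where "x = (\<Sum>i\<in>I. fscale (c i) (t i))" "y = (\<Sum>i\<in>I. fscale (d i) (t i))" by blast
      then show "\<exists>c. x + y = (\<Sum>i\<in>I. fscale (c i) (t i))"
        by (intro exI[of _ "\<lambda>i. c i + d i"]) (simp add: fv.scale_left_distrib sum.distrib)
    next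
      fix r x
      assume "\<exists>c. x = (\<Sum>i\<in>I. fscale (c i) (t i))"
      then obtain c where "x = (\<Sum>i\<in>I. fscale (c i) (t i))" by blast
      then show "\<exists>c. fscale r x = (\<Sum>i\<in>I. fscale (c i) (t i))"
        by (intro exI[of _ "\<lambda>i. r * c i"]) (simp add: fv.scale_sum_right)
    qed
  next
    case (step x)
    then obtain i k where i: "i \<in> I" "x = fscale k (t i)" by (auto simp: fv.span_singleton)
    then have "x = (\<Sum>j\<in>I. fscale (if j = i then k else 0) (t j))"
      using assms(2) by (simp add: if_distrib[of "\<lambda>r. fscale r _"] cong: if_cong)
    then show ?case by (intro exI[of _ "\<lambda>j. if j = i then k else 0"])
  qed
  then show thesis using that by blast
qed

lemma tensor3_fscale: "tensor3 (fscale r \<alpha>) \<beta> \<gamma> = fscale r (tensor3 \<alpha> \<beta> \<gamma>)"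
  by (auto simp: tensor3_def fscale_def)

context three_coord3
begin

abbreviation "X \<equiv> segre sA sB sC"

text \<open>Scalars are absorbed into the first factor, so a vector in the span of \<open>r\<close>
  points of the Segre variety is a sum of \<open>r\<close> decomposable tensors. Both secant
  varieties enter the rest of the proof through this criterion.\<close>

lemma ideal_deg_secant:
  assumes "0 < r"
  shows "P \<in> ideal_deg V (secant_variety V r X) d \<longleftrightarrow> P \<in> hom_poly V d \<and>
    (\<forall>\<alpha> \<beta> \<gamma>. (\<forall>i<r. \<alpha> i \<in> dual sA \<and> \<beta> i \<in> dual sB \<and> \<gamma> i \<in> dual sC) \<longrightarrow>
      P (\<Sum>i<r. tensor3 (\<alpha> i) (\<beta> i) (\<gamma> i)) = 0)" (is "?l \<longleftrightarrow> ?r")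
proof -
  have "0 \<in> V" using subspace_V fv.subspace_0 by blast
  have nz: "\<alpha> \<noteq> 0 \<and> \<beta> \<noteq> 0 \<and> \<gamma> \<noteq> 0" if "tensor3 \<alpha> \<beta> \<gamma> \<noteq> 0" for \<alpha> \<beta> \<gamma>
    using that by (auto simp: tensor3_def zero_fun_def fun_eq_iff)
  define t0 where "t0 = tensor3 (a 1) (b 1) (c 1)"
  have "t0 (e 1, f 1, h 1) = 1" by (simp add: t0_def tensor3_def A.a_e B.a_e C.a_e)
  then have t0: "t0 \<noteq> 0" by auto
  have t0X: "fv.span {t0} \<in> X"
    unfolding segre_def t0_def mem_Collect_eq
    using nz[OF t0[unfolded t0_def]] A.a_dual B.a_dual C.a_dual by blast
  have "?l \<longleftrightarrow> P \<in> ideal_deg V (secant_points V r X) d"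
    unfolding secant_variety_closure ideal_deg_closure[OF secant_points_proj_space] ..
  also have "\<dots> \<longleftrightarrow> ?r"
  proof
    assume l: "P \<in> ideal_deg V (secant_points V r X) d"
    then have P: "P \<in> hom_poly V d" by (simp add: ideal_deg_def)
    have main: "P v = 0" if "v \<in> V" "v \<noteq> 0" and v: "v = (\<Sum>i<r. t i)"
      and t: "\<And>i. i < r \<Longrightarrow> t i = 0 \<or> fv.span {t i} \<in> X" for v t
    proof -
      \<comment> \<open>A zero summand defines no point of the Segre variety; the point of
        \<open>t0\<close> stands in for it.\<close>
      define p where "p i = (if t i = 0 then fv.span {t0} else fv.span {t i})" for i
      have "v \<in> fv.span (\<Union>(p ` {..<r}))"
        unfolding v
      proof (intro fv.span_sum)
        fix i assume i: "i \<in> {..<r}"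
        show "t i \<in> fv.span (\<Union>(p ` {..<r}))"
        proof (cases "t i = 0")
          case False
          then have "t i \<in> p i" by (auto simp: p_def intro: fv.span_base)
          then show ?thesis using i by (intro fv.span_base) blast
        qed (simp add: fv.span_zero)
      qed
      then have "fv.span {v} \<subseteq> fv.span (\<Union>(p ` {..<r}))"
        using fv.span_minimal[of "{v}"] fv.subspace_span by blast
      then have "fv.span {v} \<in> proj_linear_span V (p ` {..<r})"
        using that by (auto simp: proj_linear_span_def proj_space_def)
      moreover have "\<forall>i<r. p i \<in> X" using t t0X by (auto simp: p_def)
      ultimately have "fv.span {v} \<in> secant_points V r X" unfolding secant_points_def by blast
      then show ?thesis using l fv.span_base[of v "{v}"] by (auto simp: ideal_deg_def)
    qed
    have t0V: "t0 \<in> V" unfolding t0_def by (intro tensor3_in_V A.a_dual B.a_dual C.a_dual)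
    \<comment> \<open>The zero tensor spans no point. Its value comes from homogeneity, and in
      degree 0 from constancy and the value at \<open>t0\<close>.\<close>
    have P0: "P 0 = 0"
    proof (cases "d = 0")
      case True
      have "P t0 = 0"
        by (rule main[of _ "\<lambda>i. if i = 0 then t0 else 0"]) (use t0 t0X t0V assms in auto)
      moreover have "P 0 = P t0"
        using P True \<open>0 \<in> V\<close> t0V by (metis hom_poly_degree_0)
      ultimately show ?thesis by simp
    next
      case False
      then have "P (fscale 0 0) = 0"
        using hom_poly_homogeneous[OF subspace_V P \<open>0 \<in> V\<close>, of 0] by (simp add: power_0_left)
      then show ?thesis by (simp add: fv.scale_zero_right)
    qed
    have "P (\<Sum>i<r. tensor3 (\<alpha> i) (\<beta> i) (\<gamma> i)) = 0"
      if "\<forall>i<r. \<alpha> i \<in> dual sA \<and> \<beta> i \<in> dual sB \<and> \<gamma> i \<in> dual sC" for \<alpha> \<beta> \<gamma>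
    proof (cases "(\<Sum>i<r. tensor3 (\<alpha> i) (\<beta> i) (\<gamma> i)) = 0")
      case False
      show ?thesis
      proof (rule main[OF _ False refl])
        show "(\<Sum>i<r. tensor3 (\<alpha> i) (\<beta> i) (\<gamma> i)) \<in> V"
          using that by (intro fv.subspace_sum[OF subspace_V] tensor3_in_V) auto
        show "tensor3 (\<alpha> i) (\<beta> i) (\<gamma> i) = 0 \<or> fv.span {tensor3 (\<alpha> i) (\<beta> i) (\<gamma> i)} \<in> X" if "i < r" for i
          using nz[of "\<alpha> i" "\<beta> i" "\<gamma> i"] \<open>\<forall>i<r. _ i\<close> that unfolding segre_def by blast
      qed
    qed (use P0 in simp)
    with P show ?r by blast
  next
    assume r: ?r
    have "P u = 0" if q: "q \<in> secant_points V r X" "u \<in> q" for q u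
    proof -
      obtain p where p: "\<forall>i<r. p i \<in> X" "q \<subseteq> fv.span (\<Union>(p ` {..<r}))"
        using q unfolding secant_points_def proj_linear_span_def by blast
      have "\<forall>i. \<exists>\<alpha> \<beta> \<gamma>. i < r \<longrightarrow> p i = fv.span {tensor3 \<alpha> \<beta> \<gamma>} \<and> \<alpha> \<in> dual sA \<and> \<beta> \<in> dual sB \<and> \<gamma> \<in> dual sC"
        using p(1) unfolding segre_def by blast
      then obtain \<alpha> \<beta> \<gamma> where t: "\<And>i. i < r \<Longrightarrow> p i = fv.span {tensor3 (\<alpha> i) (\<beta> i) (\<gamma> i)} \<and>
          \<alpha> i \<in> dual sA \<and> \<beta> i \<in> dual sB \<and> \<gamma> i \<in> dual sC"
        by metis
      have "u \<in> fv.span (\<Union>i\<in>{..<r}. fv.span {tensor3 (\<alpha> i) (\<beta> i) (\<gamma> i)})"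
      proof -
        have "p ` {..<r} = (\<lambda>i. fv.span {tensor3 (\<alpha> i) (\<beta> i) (\<gamma> i)}) ` {..<r}"
          using t by (intro image_cong) auto
        then show ?thesis using p(2) q(2) by auto
      qed
      then obtain k where "u = (\<Sum>i<r. fscale (k i) (tensor3 (\<alpha> i) (\<beta> i) (\<gamma> i)))"
        by (rule span_Union_lines) auto
      then have u: "u = (\<Sum>i<r. tensor3 (fscale (k i) (\<alpha> i)) (\<beta> i) (\<gamma> i))" by (simp add: tensor3_fscale)
      show ?thesis unfolding u
        using r t by (auto simp: dual_fscale)
    qed
    then show "P \<in> ideal_deg V (secant_points V r X) d" using r by (auto simp: ideal_deg_def)
  qed
  finally show ?thesis .
qed

end

section \<open>Quartics vanishing on sums of three decomposable tensors\<close>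

lemma pigeonhole_3:
  fixes w x y z :: 3
  obtains "w = x" | "w = y" | "w = z" | "x = y" | "x = z" | "y = z"
  using exhaust_3[of w] exhaust_3[of x] exhaust_3[of y] exhaust_3[of z] by metis

lemma distinct_3:
  fixes x y z :: 3
  assumes "x \<noteq> y" "x \<noteq> z" "y \<noteq> z"
  shows "y = x + 1 \<and> z = x + 2 \<or> y = x + 2 \<and> z = x + 1"
proof -
  have "(1::3) + 2 = 3" "(2::3) + 1 = 3" "(2::3) + 2 = 1" "(3::3) + 1 = 1" "(3::3) + 2 = 2" "(1::3) + 1 = 2"
    by simp_all
  then show ?thesis
    using assms exhaust_3[of x] exhaust_3[of y] exhaust_3[of z] by metis
qed

text \<open>\<open>q\<close> is the polarisation of a quartic, evaluated at basis tensors, which are indexed by their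
  three factors. Exchanging a factor between two basis tensors that share another one changes the
  sign, hence basis tensors that share two factors give \<open>0\<close>.\<close>

locale exchange_form =
  fixes q :: "3 \<times> 3 \<times> 3 \<Rightarrow> 3 \<times> 3 \<times> 3 \<Rightarrow> 3 \<times> 3 \<times> 3 \<Rightarrow> 3 \<times> 3 \<times> 3 \<Rightarrow> complex"
  assumes s12: "q x y z w = q y x z w" and s23: "q x y z w = q x z y w" and s34: "q x y z w = q x y w z"
    and n1: "q (i, j, k) (i, j', k') z w = - q (i, j', k) (i, j, k') z w"
    and n2: "q (i, j, k) (i', j, k') z w = - q (i', j, k) (i, j, k') z w"
    and n3: "q (i, j, k) (i', j', k) z w = - q (i', j, k) (i, j', k) z w"
begin

lemma s13: "q x y z w = q z y x w"
  by (metis s12 s23)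

lemma s14: "q x y z w = q w y z x"
  by (metis s12 s23 s34)

lemma s24: "q x y z w = q x w z y"
  by (metis s23 s34)

lemma z12 [simp]: "q (i, j, k) (i, j, k') z w = 0" "q (i, j, k) (i, j', k) z w = 0" "q (i, j, k) (i', j, k) z w = 0"
proof -
  show "q (i, j, k) (i, j, k') z w = 0" using n1[of i j k j k'] by simp
  show "q (i, j, k) (i, j', k) z w = 0" using n3[of i j k i j'] by simp
  show "q (i, j, k) (i', j, k) z w = 0" using n2[of i j k i' k z w] s12[of "(i', j, k)" "(i, j, k)"] by simp
qed

lemma z13 [simp]: "q (i, j, k) z (i, j, k') w = 0" "q (i, j, k) z (i, j', k) w = 0" "q (i, j, k) z (i', j, k) w = 0"
  by (subst s23, rule z12)+

lemma z14 [simp]: "q (i, j, k) z w (i, j, k') = 0" "q (i, j, k) z w (i, j', k) = 0" "q (i, j, k) z w (i', j, k) = 0"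
  by (subst s24, rule z12)+

lemma z23 [simp]: "q z (i, j, k) (i, j, k') w = 0" "q z (i, j, k) (i, j', k) w = 0" "q z (i, j, k) (i', j, k) w = 0"
  by (subst s13, subst s12, rule z12)+

lemma z24 [simp]: "q z (i, j, k) w (i, j, k') = 0" "q z (i, j, k) w (i, j', k) = 0" "q z (i, j, k) w (i', j, k) = 0"
  by (subst s34, rule z23)+

lemma z34 [simp]: "q z w (i, j, k) (i, j, k') = 0" "q z w (i, j, k) (i, j', k) = 0" "q z w (i, j, k) (i', j, k) = 0"
  by (subst s23, rule z24)+

lemma m1: "q (i, j, k) (i, j', k') z w = - q (i, j, k') (i, j', k) z w"
  by (subst n1, subst s12) (rule refl)

lemma m2: "q (i, j, k) (i', j, k') z w = - q (i, j, k') (i', j, k) z w"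
  by (subst n2, subst s12) (rule refl)

lemma m3: "q (i, j, k) (i', j', k) z w = - q (i, j', k) (i', j, k) z w"
  by (subst n3, subst s12) (rule refl)

text \<open>By the pigeonhole principle two of the last indices agree. Each coincidence produces a
  pair with two common factors, either at once or after exchanging \<open>i\<close> and
  \<open>l\<close> through \<open>b\<close>; only \<open>k2 = k4\<close> requires a different pair
  of exchanges.\<close>

lemma two_two_aux: "q (i, b, k1) (i, j2, k2) (l, b, k3) (l, j4, k4) = 0"
proof -
  have eq: "q (i, b, k1) (i, j2, k2) (l, b, k3) (l, j4, k4) = - q (l, b, k1) (i, j2, k2) (i, b, k3) (l, j4, k4)"
    by (subst s23, subst n2, subst s23) (rule refl)
  show ?thesis
  proof (cases "k2 = k4 \<and> k1 \<noteq> k2 \<and> k1 \<noteq> k3 \<and> k2 \<noteq> k3")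
    case True
    have "q (i, b, k1) (i, j2, k2) (l, b, k3) (l, j4, k4) = - q (i, j2, k1) (i, b, k2) (l, b, k3) (l, j4, k2)"
      using True by (subst n1) simp
    also have "q (i, j2, k1) (i, b, k2) (l, b, k3) (l, j4, k2) = - q (i, j2, k1) (l, b, k2) (i, b, k3) (l, j4, k2)"
      by (subst s13, subst s12, subst m2, subst s12, subst s13) (simp add: s23)
    finally show ?thesis by simp
  next
    case False
    then consider "k1 = k2" | "k1 = k3" | "k2 = k3" | "k1 = k4" | "k3 = k4"
      by (cases rule: pigeonhole_3[where w = k1 and x = k2 and y = k3 and z = k4]) auto
    then show ?thesis by cases (simp, simp, subst eq, simp, subst eq, simp, simp)
  qed
qed

lemma two_two: "q (i, j1, k1) (i, j2, k2) (l, j3, k3) (l, j4, k4) = 0"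
proof (cases rule: pigeonhole_3[where w = j1 and x = j2 and y = j3 and z = j4])
  case 2
  then show ?thesis by (simp add: two_two_aux)
next
  case 3
  then show ?thesis by (subst s34) (simp add: two_two_aux)
next
  case 4
  then show ?thesis by (subst s12) (simp add: two_two_aux)
next
  case 5
  then show ?thesis by (subst s12, subst s34) (simp add: two_two_aux)
qed simp_all

end

text \<open>The axioms are invariant under cyclic renaming of the three factors, so what is proved
  for first indices carries over to second and third ones.\<close>

lemma exchange_form_rotate:
  assumes "exchange_form q"
  shows "exchange_form (\<lambda>(j, k, i) (j', k', i') (j'', k'', i'') (j3, k3, i3).
    q (i, j, k) (i', j', k') (i'', j'', k'') (i3, j3, k3))"
proof -
  interpret exchange_form q by (rule assms)
  show ?thesis
    by unfold_locales (auto simp: split_beta intro: s12 s23 s34 n1 n2 m3 m1 m2 n3)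
qed

section \<open>Stars: four basis tensors, one of which shares a different factor with each of the
  others\<close>

context exchange_form
begin

lemma two_two_j: "q (i1, j, k1) (i2, j, k2) (i3, l, k3) (i4, l, k4) = 0"
  using exchange_form.two_two[OF exchange_form_rotate[OF exchange_form_axioms]] by simp

lemma two_two_k: "q (i1, j1, k) (i2, j2, k) (i3, j3, l) (i4, j4, l) = 0"
  using exchange_form.two_two[OF exchange_form_rotate[OF exchange_form_rotate[OF exchange_form_axioms]]] by simp

text \<open>Three exchanges through the centre transpose the two free first indices; three exchanges
  make an odd sign. Together with \<open>star_j\<close> and \<open>star_k\<close> this shows that a
  star with distinct indices is determined up to sign by its centre, which accounts for the 27
  values.\<close>

lemma star_i: "q (i, j, k) (i, j2, k2) (i3, j, k3) (i4, j4, k) = - q (i, j, k) (i, j2, k2) (i4, j, k3) (i3, j4, k)"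
proof -
  have "q (i, j, k) (i, j2, k2) (i3, j, k3) (i4, j4, k) = - q (i3, j, k) (i, j2, k2) (i, j, k3) (i4, j4, k)"
    by (subst s23, subst n2, subst s23) (rule refl)
  also have "q (i3, j, k) (i, j2, k2) (i, j, k3) (i4, j4, k) = - q (i4, j, k) (i, j2, k2) (i, j, k3) (i3, j4, k)"
    by (subst s24, subst n3, subst s24) (rule refl)
  also have "q (i4, j, k) (i, j2, k2) (i, j, k3) (i3, j4, k) = - q (i, j, k) (i, j2, k2) (i4, j, k3) (i3, j4, k)"
    by (subst s23, subst n2, subst s23) (rule refl)
  finally show ?thesis by simp
qed

lemma star_j: "q (i, j, k) (i, j2, k2) (i3, j, k3) (i4, j4, k) = - q (i, j, k) (i, j4, k2) (i3, j, k3) (i4, j2, k)"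
proof -
  have "q (i, j, k) (i, j2, k2) (i3, j, k3) (i4, j4, k) = - q (i, j2, k) (i, j, k2) (i3, j, k3) (i4, j4, k)"
    by (rule n1)
  also have "q (i, j2, k) (i, j, k2) (i3, j, k3) (i4, j4, k) = - q (i, j4, k) (i, j, k2) (i3, j, k3) (i4, j2, k)"
    by (subst s24, subst m3, subst s24) (rule refl)
  also have "q (i, j4, k) (i, j, k2) (i3, j, k3) (i4, j2, k) = - q (i, j, k) (i, j4, k2) (i3, j, k3) (i4, j2, k)"
    by (rule n1)
  finally show ?thesis by simp
qed

lemma star_k: "q (i, j, k) (i, j2, k2) (i3, j, k3) (i4, j4, k) = - q (i, j, k) (i, j2, k3) (i3, j, k2) (i4, j4, k)"
proof -
  have "q (i, j, k) (i, j2, k2) (i3, j, k3) (i4, j4, k) = - q (i, j, k2) (i, j2, k) (i3, j, k3) (i4, j4, k)"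
    by (rule m1)
  also have "q (i, j, k2) (i, j2, k) (i3, j, k3) (i4, j4, k) = - q (i, j, k3) (i, j2, k) (i3, j, k2) (i4, j4, k)"
    by (subst s23, subst m2, subst s23) (rule refl)
  also have "q (i, j, k3) (i, j2, k) (i3, j, k2) (i4, j4, k) = - q (i, j, k) (i, j2, k3) (i3, j, k2) (i4, j4, k)"
    by (rule m1)
  finally show ?thesis by simp
qed

context
  assumes ref: "\<And>i j k. q (i, j, k) (i, j + 1, k + 1) (i + 1, j, k + 2) (i + 2, j + 2, k) = 0"
begin

text \<open>If a free index equals that of the centre, two tensors share two factors; if two free
  indices of one kind agree, the four tensors form two pairs with a common factor each. Otherwise
  antisymmetry leads to a reference star.\<close>

lemma star: "q (i, j, k) (i, j2, k2) (i3, j, k3) (i4, j4, k) = 0"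
proof -
  consider "i3 = i \<or> i4 = i \<or> j2 = j \<or> j4 = j \<or> k2 = k \<or> k3 = k" | "i3 = i4" | "j2 = j4" | "k2 = k3"
    | "i \<noteq> i3" "i \<noteq> i4" "i3 \<noteq> i4" "j \<noteq> j2" "j \<noteq> j4" "j2 \<noteq> j4" "k \<noteq> k2" "k \<noteq> k3" "k2 \<noteq> k3"
    by blast
  then show ?thesis
  proof cases
    case 2
    then show ?thesis by (simp add: two_two)
  next
    case 3
    then show ?thesis by (subst s23) (simp add: two_two_j)
  next
    case 4
    then show ?thesis by (subst s24) (simp add: two_two_k)
  next
    case 5
    have i: "q (i, j, k) (i, j2, k2) (i3, j, k3) (i4, j4, k) = 0" if "j2 = j + 1" "j4 = j + 2" "k2 = k + 1" "k3 = k + 2"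
      for j2 j4 k2 k3
    proof -
      consider "i3 = i + 1" "i4 = i + 2" | "i3 = i + 2" "i4 = i + 1" using distinct_3[OF 5(1,2,3)] by blast
      then show ?thesis
      proof cases
        case 1
        then show ?thesis using ref[of i j k] that by simp
      next
        case 2
        then show ?thesis using ref[of i j k] that by (subst star_i) simp
      qed
    qed
    have j: "q (i, j, k) (i, j2, k2) (i3, j, k3) (i4, j4, k) = 0" if "k2 = k + 1" "k3 = k + 2" for k2 k3
      using distinct_3[OF 5(4,5,6)]
    proof
      assume "j2 = j + 1 \<and> j4 = j + 2"
      with i that show ?thesis by blast
    next
      assume "j2 = j + 2 \<and> j4 = j + 1"
      with i that show ?thesis by (subst star_j) simp
    qed
    show ?thesis
      using distinct_3[OF 5(7,8,9)]
    proof
      assume "k2 = k + 1 \<and> k3 = k + 2"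
      then show ?thesis using j[of k2 k3] by blast
    next
      assume "k2 = k + 2 \<and> k3 = k + 1"
      then show ?thesis using j[of k3 k2] star_k[of i j k j2 k2 i3 k3 i4 j4] by auto
    qed
  qed auto
qed

text \<open>Each coincidence among the four last indices gives a star or a pair with two common
  factors, at once or after one exchange.\<close>

lemma share_i_j: "q (i, j, k1) (i, j2, k2) (i3, j, k3) (i4, j4, k4) = 0"
proof (cases rule: pigeonhole_3[where w = k1 and x = k2 and y = k3 and z = k4])
  case 3
  then show ?thesis using star by simp
next
  case 4
  then show ?thesis by (subst n1) simp
next
  case 5
  then show ?thesis by (subst m1) (simp add: star)
next
  case 6
  have "q (i, j, k1) (i, j2, k2) (i3, j, k4) (i4, j4, k4) = - q (i, j, k4) (i, j2, k2) (i3, j, k1) (i4, j4, k4)"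
    by (subst s23, subst m2, subst s23) (rule refl)
  then show ?thesis using 6 star by simp
qed simp_all

text \<open>Exchanging first indices through the common \<open>k\<close> turns the two disjoint
  pairs into a star with centre \<open>(i, j, k)\<close>.\<close>

lemma disjoint_i_j_aux: "q (i, j1, k) (i, j2, k2) (i3, j, k) (i4, j, k4) = 0"
proof -
  have "q (i, j1, k) (i, j2, k2) (i3, j, k) (i4, j, k4) = - q (i3, j1, k) (i, j2, k2) (i, j, k) (i4, j, k4)"
    by (subst s23, subst n3, subst s23) (rule refl)
  also have "q (i3, j1, k) (i, j2, k2) (i, j, k) (i4, j, k4) = q (i, j, k) (i, j2, k2) (i4, j, k4) (i3, j1, k)"
    by (subst s13, subst s34) (rule refl)
  finally show ?thesis by (simp add: star)
qed

lemma disjoint_i_j: "q (i, j1, k1) (i, j2, k2) (i3, j, k3) (i4, j, k4) = 0"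
proof (cases rule: pigeonhole_3[where w = k1 and x = k2 and y = k3 and z = k4])
  case 2
  then show ?thesis by (simp add: disjoint_i_j_aux)
next
  case 3
  then show ?thesis by (subst s34) (simp add: disjoint_i_j_aux)
next
  case 4
  then show ?thesis by (subst s12) (simp add: disjoint_i_j_aux)
next
  case 5
  then show ?thesis by (subst s12, subst s34) (simp add: disjoint_i_j_aux)
qed simp_all

lemma share_i: "q (i, j1, k1) (i, j2, k2) (i3, j3, k3) (i4, j4, k4) = 0"
proof (cases rule: pigeonhole_3[where w = j1 and x = j2 and y = j3 and z = j4])
  case 2
  then show ?thesis by (simp add: share_i_j)
next
  case 3
  then show ?thesis by (subst s34) (simp add: share_i_j)
next
  case 4
  then show ?thesis by (subst s12) (simp add: share_i_j)
next
  case 5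
  then show ?thesis by (subst s12, subst s34) (simp add: share_i_j)
next
  case 6
  then show ?thesis by (simp add: disjoint_i_j)
qed simp_all

lemma form_eq_0: "q x y z w = 0"
proof -
  obtain i1 j1 k1 i2 j2 k2 i3 j3 k3 i4 j4 k4 where
    xyzw: "x = (i1, j1, k1)" "y = (i2, j2, k2)" "z = (i3, j3, k3)" "w = (i4, j4, k4)"
    by (metis prod_cases3)
  show ?thesis
  proof (cases rule: pigeonhole_3[where w = i1 and x = i2 and y = i3 and z = i4])
    case 1
    then show ?thesis by (simp add: xyzw share_i)
  next
    case 2
    then show ?thesis by (subst s23) (simp add: xyzw share_i)
  next
    case 3
    then show ?thesis by (subst s24) (simp add: xyzw share_i)
  next
    case 4
    then show ?thesis by (subst s13) (simp add: xyzw share_i)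
  next
    case 5
    then show ?thesis by (subst s14) (simp add: xyzw share_i)
  next
    case 6
    then show ?thesis by (subst s13, subst s24) (simp add: xyzw share_i)
  qed
qed

end

end

text \<open>Polarisation by the permanent of the linear factors.\<close>

lemma quartic_polarization:
  assumes "P \<in> hom_poly V 4"
  obtains p where "\<And>x y z w. p x y z w = p y x z w" "\<And>x y z w. p x y z w = p x z y w"
    "\<And>x y z w. p x y z w = p x y w z" "\<And>y z w. (\<lambda>x. p x y z w) \<in> dual fscale"
    "\<And>v. v \<in> V \<Longrightarrow> P v = p v v v v"
proof -
  define pol where "pol p P \<longleftrightarrow> (\<forall>x y z w. p x y z w = p y x z w) \<and> (\<forall>x y z w. p x y z w = p x z y w) \<and>
    (\<forall>x y z w. p x y z w = p x y w z) \<and> (\<forall>y z w. (\<lambda>x. p x y z w) \<in> dual fscale) \<and>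
    (\<forall>v\<in>V. P v = p v v v v)" for p P
  define R where "R P \<longleftrightarrow> (\<exists>p. pol p P)" for P
  have "R P" using assms
  proof (induct rule: hom_poly_span_induct)
    case zero
    show ?case unfolding R_def pol_def
      by (rule exI[of _ "\<lambda>x y z w. 0"]) (auto intro!: dualI[OF fv.vector_space_axioms])
  next
    case (add P Q)
    then obtain p p' where pp: "pol p P" "pol p' Q" unfolding R_def by blast
    from pp(1) have p: "\<forall>x y z w. p x y z w = p y x z w" "\<forall>x y z w. p x y z w = p x z y w"
      "\<forall>x y z w. p x y z w = p x y w z" "\<forall>y z w. (\<lambda>x. p x y z w) \<in> dual fscale"
      "\<forall>v\<in>V. P v = p v v v v" unfolding pol_def by blast+
    from pp(2) have p': "\<forall>x y z w. p' x y z w = p' y x z w" "\<forall>x y z w. p' x y z w = p' x z y w"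
      "\<forall>x y z w. p' x y z w = p' x y w z" "\<forall>y z w. (\<lambda>x. p' x y z w) \<in> dual fscale"
      "\<forall>v\<in>V. Q v = p' v v v v" unfolding pol_def by blast+
    show ?case unfolding R_def pol_def
    proof (intro exI[of _ "\<lambda>x y z w. p x y z w + p' x y z w"] conjI allI ballI)
      fix x y z w
      show "p x y z w + p' x y z w = p y x z w + p' y x z w" using p(1) p'(1) by metis
      show "p x y z w + p' x y z w = p x z y w + p' x z y w" using p(2) p'(2) by metis
      show "p x y z w + p' x y z w = p x y w z + p' x y w z" using p(3) p'(3) by metis
      show "(\<lambda>x. p x y z w + p' x y z w) \<in> dual fscale"
        using dual_add[of "\<lambda>x. p x y z w" fscale "\<lambda>x. p' x y z w"] p(4) p'(4) by (simp add: plus_fun_def)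
    qed (use p(5) p'(5) in simp)
  next
    case (scale r P)
    then obtain p where pp: "pol p P" unfolding R_def by blast
    from pp have p: "\<forall>x y z w. p x y z w = p y x z w" "\<forall>x y z w. p x y z w = p x z y w"
      "\<forall>x y z w. p x y z w = p x y w z" "\<forall>y z w. (\<lambda>x. p x y z w) \<in> dual fscale"
      "\<forall>v\<in>V. P v = p v v v v" unfolding pol_def by blast+
    show ?case unfolding R_def pol_def
    proof (intro exI[of _ "\<lambda>x y z w. r * p x y z w"] conjI allI ballI)
      fix x y z w
      show "r * p x y z w = r * p y x z w" using p(1) by metis
      show "r * p x y z w = r * p x z y w" using p(2) by metis
      show "r * p x y z w = r * p x y w z" using p(3) by metis
      show "(\<lambda>x. r * p x y z w) \<in> dual fscale"
        using dual_fscale[of "\<lambda>x. p x y z w" fscale r] p(4) by (simp add: fscale_def)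
    qed (use p(5) in \<open>simp add: fscale_def\<close>)
  next
    case (prod L)
    \<comment> \<open>Permanents of size 2, 3 and 4, each expanded along its first vector argument.
      On the diagonal the last one is 4! = 24 times the product, whence the divisor below.\<close>
    define q2 where "q2 i j z w = L i z * L j w + L j z * L i w" for i j z w
    define q3 where "q3 i j k y z w = L i y * q2 j k z w + L j y * q2 i k z w + L k y * q2 i j z w" for i j k y z w
    define q4 where "q4 x y z w = L 0 x * q3 1 2 3 y z w + L 1 x * q3 0 2 3 y z w + L 2 x * q3 0 1 3 y z w
      + L 3 x * q3 0 1 2 y z w" for x y z w
    have [simp]: "L i (x + y) = L i x + L i y" "L i (fscale r x) = r * L i x" if "i < 4" for i x y r
      using linear_fscaleD[OF prod[OF that]] by auto
    have p: "(\<Prod>i<4. L i v) = L 0 v * L 1 v * L 2 v * L 3 v" for v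
      by (simp add: eval_nat_numeral)
    show ?case unfolding R_def pol_def
    proof (intro exI[of _ "\<lambda>x y z w. q4 x y z w / 24"] conjI allI ballI)
      fix x y z w
      show "q4 x y z w / 24 = q4 y x z w / 24" by (simp add: q4_def q3_def q2_def algebra_simps)
      show "q4 x y z w / 24 = q4 x z y w / 24" by (simp add: q4_def q3_def q2_def algebra_simps)
      show "q4 x y z w / 24 = q4 x y w z / 24" by (simp add: q4_def q3_def q2_def algebra_simps)
      show "(\<lambda>x. q4 x y z w / 24) \<in> dual fscale"
        by (rule dualI[OF fv.vector_space_axioms]) (simp_all add: q4_def algebra_simps add_divide_distrib)
    qed (simp add: p q4_def q3_def q2_def algebra_simps)
  qed
  then obtain p where "pol p P" unfolding R_def by blast
  then show thesis using that[of p] unfolding pol_def by blast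
qed

section \<open>From quartic equations to exchange forms\<close>

context three_coord3
begin

definition basis_tensor :: "3 \<times> 3 \<times> 3 \<Rightarrow> 'a \<times> 'b \<times> 'c \<Rightarrow> complex" where
  "basis_tensor = (\<lambda>(i, j, k). tensor3 (a i) (b j) (c k))"

definition decomposable where
  "decomposable t \<longleftrightarrow> (\<exists>\<alpha>\<in>dual sA. \<exists>\<beta>\<in>dual sB. \<exists>\<gamma>\<in>dual sC. t = tensor3 \<alpha> \<beta> \<gamma>)"

lemma decomposableI [intro]:
  "\<alpha> \<in> dual sA \<Longrightarrow> \<beta> \<in> dual sB \<Longrightarrow> \<gamma> \<in> dual sC \<Longrightarrow> decomposable (tensor3 \<alpha> \<beta> \<gamma>)"
  unfolding decomposable_def by blast

lemma tensor3_add: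
  "tensor3 (\<alpha> + \<alpha>') \<beta> \<gamma> = tensor3 \<alpha> \<beta> \<gamma> + tensor3 \<alpha>' \<beta> \<gamma>"
  "tensor3 \<alpha> (\<beta> + \<beta>') \<gamma> = tensor3 \<alpha> \<beta> \<gamma> + tensor3 \<alpha> \<beta>' \<gamma>"
  "tensor3 \<alpha> \<beta> (\<gamma> + \<gamma>') = tensor3 \<alpha> \<beta> \<gamma> + tensor3 \<alpha> \<beta> \<gamma>'"
  by (auto simp: tensor3_def algebra_simps)

lemma decomposable_basis: "decomposable (basis_tensor x)"
  by (auto simp: basis_tensor_def A.a_dual B.a_dual C.a_dual split: prod.split)

lemma decomposable_fscale: "decomposable t \<Longrightarrow> decomposable (fscale r t)"
  unfolding decomposable_def tensor3_fscale[symmetric] using dual_fscale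
  by (metis tensor3_fscale)

lemma decomposable_in_V: "decomposable t \<Longrightarrow> t \<in> V"
  by (auto simp: decomposable_def tensor3_in_V)

lemma linear_zero_on_V:
  assumes "L \<in> dual fscale" "\<And>x. L (basis_tensor x) = 0" "v \<in> V"
  shows "L v = 0"
proof -
  have "L (tensor3 (a i) (b j) (c k)) = 0" for i j k
    using assms(2)[of "(i, j, k)"] by (simp add: basis_tensor_def)
  then show ?thesis
    by (subst V_expansion[OF assms(3)]) (simp add: ten_def dualD[OF assms(1)])
qed

text \<open>The polarisation of an equation vanishes at decomposable arguments two of which agree.
  Its value on a star is therefore visible, multiplied by 24, as the value of the quartic at the sum
  of the four basis tensors.\<close>

definition star_tensor :: "3 \<Rightarrow> 3 \<Rightarrow> 3 \<Rightarrow> 'a \<times> 'b \<times> 'c \<Rightarrow> complex" where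
  "star_tensor i j k = basis_tensor (i, j, k) + basis_tensor (i, j + 1, k + 1) +
     basis_tensor (i + 1, j, k + 2) + basis_tensor (i + 2, j + 2, k)"

lemma quartic_determined_by_stars:
  assumes P: "P \<in> hom_poly V 4"
    and van: "\<And>t u v. decomposable t \<Longrightarrow> decomposable u \<Longrightarrow> decomposable v \<Longrightarrow> P (t + u + v) = 0"
    and P_star: "\<And>i j k. P (star_tensor i j k) = 0"
  shows "P = 0"
proof -
  obtain p where s: "\<And>x y z w. p x y z w = p y x z w" "\<And>x y z w. p x y z w = p x z y w"
    "\<And>x y z w. p x y z w = p x y w z" and lin: "\<And>y z w. (\<lambda>x. p x y z w) \<in> dual fscale"
    and Pp: "\<And>v. v \<in> V \<Longrightarrow> P v = p v v v v"
    using quartic_polarization[OF P] by blast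
  have add1: "p (x + x') y z w = p x y z w + p x' y z w" and scale1: "p (fscale r x) y z w = r * p x y z w"
    for x x' y z w r
    using linear_fscaleD[OF lin] by blast+
  have add2: "p x (y + y') z w = p x y z w + p x y' z w" and scale2: "p x (fscale r y) z w = r * p x y z w"
    for x y y' z w r
    using add1 scale1 s(1) by metis+
  have add3: "p x y (z + z') w = p x y z w + p x y z' w" and scale3: "p x y (fscale r z) w = r * p x y z w"
    for x y z z' w r
    using add2 scale2 s(2) by metis+
  have add4: "p x y z (w + w') = p x y z w + p x y z w'" and scale4: "p x y z (fscale r w) = r * p x y z w"
    for x y z w w' r
    using add3 scale3 s(3) by metis+
  note ml = add1 add2 add3 add4 scale1 scale2 scale3 scale4
  \<comment> \<open>This is the coefficient of \<open>r ^ 2 * r' * r''\<close> in the expansion of a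
    vanishing quartic. The signed sum over \<open>r'\<close> and \<open>r''\<close> in 1, -1 keeps
    the terms odd in both, and the instances with \<open>r = 0\<close> remove those without
    \<open>t\<close>.\<close>
  have zero: "p t t u v = 0" if t: "decomposable t" and u: "decomposable u" and v: "decomposable v" for t u v
  proof -
    have inV: "fscale r t + fscale r' u + fscale r'' v \<in> V" for r r' r''
      using t u v by (intro V_add V_fscale decomposable_in_V)
    have "p x x x x = 0" if "x = fscale r t + fscale r' u + fscale r'' v" for x r r' r''
      unfolding that Pp[OF inV, symmetric] using t u v by (intro van decomposable_fscale)
    note z = this[OF refl]
    have Z: "r ^ 4 * p t t t t + 4 * r ^ 3 * r' * p t t t u + 4 * r ^ 3 * r'' * p t t t v +
      6 * r ^ 2 * r' ^ 2 * p t t u u + 12 * r ^ 2 * r' * r'' * p t t u v + 6 * r ^ 2 * r'' ^ 2 * p t t v v +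
      4 * r * r' ^ 3 * p t u u u + 12 * r * r' ^ 2 * r'' * p t u u v + 12 * r * r' * r'' ^ 2 * p t u v v +
      4 * r * r'' ^ 3 * p t v v v + r' ^ 4 * p u u u u + 4 * r' ^ 3 * r'' * p u u u v +
      6 * r' ^ 2 * r'' ^ 2 * p u u v v + 4 * r' * r'' ^ 3 * p u v v v + r'' ^ 4 * p v v v v = 0" for r r' r''
      using z[of r r' r'']
        s(1)[of u t] s(1)[of v t] s(1)[of v u] s(2)[of _ u t] s(2)[of _ v t] s(2)[of _ v u]
        s(3)[of _ _ u t] s(3)[of _ _ v t] s(3)[of _ _ v u]
      by (simp add: ml) (simp add: algebra_simps power2_eq_square power3_eq_cube power4_eq_xxxx)
    show ?thesis
      using Z[of 1 1 1] Z[of 1 1 "-1"] Z[of 1 "-1" 1] Z[of 1 "-1" "-1"] Z[of 0 1 1] Z[of 0 1 "-1"]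
      by simp algebra
  qed
  \<comment> \<open>In the square of the decomposable tensor \<open>x + x' + (y + y')\<close> all
    squares vanish, and so do the products of an unprimed with a primed summand. The products of
    \<open>x\<close> with \<open>y\<close> and of \<open>x'\<close> with \<open>y'\<close> remain
    and must cancel.\<close>
  have exch: "p x y u v = - p x' y' u v"
    if "decomposable x" "decomposable y" "decomposable x'" "decomposable y'" "decomposable u" "decomposable v"
      and "decomposable (x + x')" "decomposable (x + y')" "decomposable (y + x')" "decomposable (y + y')"
      and "decomposable (x + x' + (y + y'))" for x y x' y' u v
    using zero[OF that(1,5,6)] zero[OF that(2,5,6)] zero[OF that(3,5,6)] zero[OF that(4,5,6)]
      zero[OF that(7,5,6)] zero[OF that(8,5,6)] zero[OF that(9,5,6)] zero[OF that(10,5,6)]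
      zero[OF that(11,5,6)] s(1)[of y x u v] s(1)[of x' x u v] s(1)[of y' x u v] s(1)[of x' y u v]
      s(1)[of y' y u v] s(1)[of y' x' u v]
    by (simp add: add1 add2) algebra
  define q where "q x y z w = p (basis_tensor x) (basis_tensor y) (basis_tensor z) (basis_tensor w)"
    for x y z w
  note dual_simps = A.a_dual B.a_dual C.a_dual dual_add tensor3_add[symmetric]
  interpret exchange_form q
  proof
    fix x y z w
    show "q x y z w = q y x z w" "q x y z w = q x z y w" "q x y z w = q x y w z"
      unfolding q_def by (rule s)+
  next
    fix i j k i' j' k' z w
    show "q (i, j, k) (i, j', k') z w = - q (i, j', k) (i, j, k') z w"
      unfolding q_def
    proof (intro exch decomposable_basis)
      have "basis_tensor (i, j, k) + basis_tensor (i, j', k) = tensor3 (a i) (b j + b j') (c k)"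
        "basis_tensor (i, j', k') + basis_tensor (i, j, k') = tensor3 (a i) (b j + b j') (c k')"
        for k k' by (auto simp: basis_tensor_def tensor3_add)
      then show "decomposable (basis_tensor (i, j, k) + basis_tensor (i, j', k))"
        "decomposable (basis_tensor (i, j', k') + basis_tensor (i, j, k'))"
        "decomposable (basis_tensor (i, j, k) + basis_tensor (i, j', k) +
          (basis_tensor (i, j', k') + basis_tensor (i, j, k')))"
        by (auto simp: dual_simps)
    qed (auto simp: basis_tensor_def dual_simps)
    show "q (i, j, k) (i', j, k') z w = - q (i', j, k) (i, j, k') z w"
      unfolding q_def
    proof (intro exch decomposable_basis)
      have "basis_tensor (i, j, k) + basis_tensor (i', j, k) = tensor3 (a i + a i') (b j) (c k)"
        "basis_tensor (i', j, k') + basis_tensor (i, j, k') = tensor3 (a i + a i') (b j) (c k')"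
        for k k' by (auto simp: basis_tensor_def tensor3_add)
      then show "decomposable (basis_tensor (i, j, k) + basis_tensor (i', j, k))"
        "decomposable (basis_tensor (i', j, k') + basis_tensor (i, j, k'))"
        "decomposable (basis_tensor (i, j, k) + basis_tensor (i', j, k) +
          (basis_tensor (i', j, k') + basis_tensor (i, j, k')))"
        by (auto simp: dual_simps)
    qed (auto simp: basis_tensor_def dual_simps)
    show "q (i, j, k) (i', j', k) z w = - q (i', j, k) (i, j', k) z w"
      unfolding q_def
    proof (intro exch decomposable_basis)
      have "basis_tensor (i, j, k) + basis_tensor (i', j, k) = tensor3 (a i + a i') (b j) (c k)"
        "basis_tensor (i', j', k) + basis_tensor (i, j', k) = tensor3 (a i + a i') (b j') (c k)"
        for j j' by (auto simp: basis_tensor_def tensor3_add)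
      then show "decomposable (basis_tensor (i, j, k) + basis_tensor (i', j, k))"
        "decomposable (basis_tensor (i', j', k) + basis_tensor (i, j', k))"
        "decomposable (basis_tensor (i, j, k) + basis_tensor (i', j, k) +
          (basis_tensor (i', j', k) + basis_tensor (i, j', k)))"
        by (auto simp: dual_simps)
    qed (auto simp: basis_tensor_def dual_simps)
  qed
  have zero2: "p x y z w = 0" if "x = y \<or> x = z \<or> x = w \<or> y = z \<or> y = w \<or> z = w"
    "decomposable x" "decomposable y" "decomposable z" "decomposable w" for x y z w
    using that zero s by metis
  \<comment> \<open>Only the 24 terms with four different arguments survive.\<close>
  have sum4: "p (x + y + z + w) (x + y + z + w) (x + y + z + w) (x + y + z + w) = 24 * p x y z w"
    if d: "decomposable x" "decomposable y" "decomposable z" "decomposable w" for x y z w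
  proof -
    have perm: "p y x u v = p x y u v" "p z x u v = p x z u v" "p w x u v = p x w u v" "p z y u v = p y z u v"
      "p w y u v = p y w u v" "p w z u v = p z w u v"
      "p v y x u = p v x y u" "p v z x u = p v x z u" "p v w x u = p v x w u" "p v z y u = p v y z u"
      "p v w y u = p v y w u" "p v w z u = p v z w u"
      "p v u y x = p v u x y" "p v u z x = p v u x z" "p v u w x = p v u x w" "p v u z y = p v u y z"
      "p v u w y = p v u y w" "p v u w z = p v u z w" for u v
      using s by metis+
    have z: "p r r u v = 0" "p u r r v = 0" "p u v r r = 0"
      if "r \<in> {x, y, z, w}" "u \<in> {x, y, z, w}" "v \<in> {x, y, z, w}" for r u v
      using that d by (auto intro!: zero2)
    show ?thesis by (simp only: add1 add2 add3 add4 perm z insert_iff simp_thms) simp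
  qed
  have "q x y z w = 0" for x y z w
  proof (rule form_eq_0)
    fix i j k
    have "star_tensor i j k \<in> V" unfolding star_tensor_def by (intro V_add decomposable_in_V decomposable_basis)
    then show "q (i, j, k) (i, j + 1, k + 1) (i + 1, j, k + 2) (i + 2, j + 2, k) = 0"
      using P_star[of i j k] Pp[of "star_tensor i j k"]
      by (simp add: star_tensor_def sum4[OF decomposable_basis decomposable_basis decomposable_basis decomposable_basis] q_def)
  qed
  then have q0: "p (basis_tensor x) (basis_tensor y) (basis_tensor z) (basis_tensor w) = 0" for x y z w
    by (simp add: q_def)
  have q1: "p v (basis_tensor y) (basis_tensor z) (basis_tensor w) = 0" if "v \<in> V" for v y z w
    by (rule linear_zero_on_V[OF lin q0 that])
  have q2: "p v v' (basis_tensor z) (basis_tensor w) = 0" if "v \<in> V" "v' \<in> V" for v v' z w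
    by (rule linear_zero_on_V[OF lin _ that(1)]) (metis q1[OF that(2)] s(1))
  have q3: "p v v' v'' (basis_tensor w) = 0" if "v \<in> V" "v' \<in> V" "v'' \<in> V" for v v' v'' w
    by (rule linear_zero_on_V[OF lin _ that(1)]) (metis q2[OF that(2,3)] s(1,2))
  have q4: "p v v' v'' w = 0" if "v \<in> V" "v' \<in> V" "v'' \<in> V" "w \<in> V" for v v' v'' w
    by (rule linear_zero_on_V[OF lin _ that(1)]) (metis q3[OF that(2,3,4)] s(1,2,3))
  show ?thesis
  proof
    fix v
    show "P v = 0 v" using Pp[of v] q4[of v v v v] hom_poly_outside[OF P, of v] by (cases "v \<in> V") auto
  qed
qed

end

section \<open>The quartic covariant\<close>

text \<open>Lets formulas be treated as polynomials without carrying along the value 0 outside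
  \<open>V\<close>.\<close>

definition poly_on :: "('x \<Rightarrow> complex) set \<Rightarrow> nat \<Rightarrow> (('x \<Rightarrow> complex) \<Rightarrow> complex) \<Rightarrow> bool" where
  "poly_on V d f \<longleftrightarrow> (\<lambda>v. if v \<in> V then f v else 0) \<in> hom_poly V d"

lemma poly_on_add: "poly_on V d f \<Longrightarrow> poly_on V d g \<Longrightarrow> poly_on V d (\<lambda>v. f v + g v)"
  unfolding poly_on_def by (drule (1) hom_poly_add) (simp add: plus_fun_def if_distrib cong: if_cong)

lemma poly_on_diff: "poly_on V d f \<Longrightarrow> poly_on V d g \<Longrightarrow> poly_on V d (\<lambda>v. f v - g v)"
  unfolding poly_on_def by (drule (1) hom_poly_diff) (simp add: fun_diff_def if_distrib cong: if_cong)

lemma poly_on_mult: "poly_on V i f \<Longrightarrow> poly_on V j g \<Longrightarrow> i + j = d \<Longrightarrow> poly_on V d (\<lambda>v. f v * g v)"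
  unfolding poly_on_def by (drule (1) hom_poly_mult) (auto simp: if_distrib cong: if_cong)

lemma poly_on_eval: "poly_on V 1 (\<lambda>v. v x)"
  unfolding poly_on_def by (rule hom_poly_linear[OF eval_in_dual])

lemma poly_on_0: "poly_on V d (\<lambda>v. 0)"
  unfolding poly_on_def using hom_poly_zero by simp

lemma poly_on_const: "poly_on V 0 (\<lambda>v. r)"
  unfolding poly_on_def by (rule hom_poly_const)

lemma poly_on_cmult: "poly_on V d f \<Longrightarrow> poly_on V d (\<lambda>v. r * f v)"
  using poly_on_mult[OF poly_on_const, of V d f d r] by simp

lemma poly_on_sum: "(\<And>i. i \<in> I \<Longrightarrow> poly_on V d (f i)) \<Longrightarrow> poly_on V d (\<lambda>v. \<Sum>i\<in>I. f i v)"
  by (induct I rule: infinite_finite_induct) (auto intro: poly_on_0 poly_on_add)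

text \<open>Contraction of a trilinear map with the volume form of the basis \<open>e\<close>,
  written out over the six permutations.\<close>

definition alt3 :: "(3 \<Rightarrow> 'a) \<Rightarrow> ('a \<Rightarrow> 'a \<Rightarrow> 'a \<Rightarrow> complex) \<Rightarrow> complex" where
  "alt3 e \<Theta> = \<Theta> (e 1) (e 2) (e 3) + \<Theta> (e 2) (e 3) (e 1) + \<Theta> (e 3) (e 1) (e 2)
     - \<Theta> (e 1) (e 3) (e 2) - \<Theta> (e 2) (e 1) (e 3) - \<Theta> (e 3) (e 2) (e 1)"

lemma poly_on_alt3:
  "(\<And>x y z. poly_on V d (\<Theta> x y z)) \<Longrightarrow> poly_on V d (\<lambda>T. alt3 e (\<lambda>x y z. \<Theta> x y z T))"
  unfolding alt3_def by (intro poly_on_add poly_on_diff)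

lemma alt3_cmult: "alt3 e (\<lambda>x y z. r * \<Theta> x y z) = r * alt3 e \<Theta>"
  by (simp add: alt3_def algebra_simps)

lemma dual_alt3:
  assumes "\<And>y1 y2 y3. (\<lambda>x. \<Theta> x y1 y2 y3) \<in> dual sA"
  shows "(\<lambda>x. alt3 f (\<Theta> x)) \<in> dual sA"
proof (rule dualI)
  show "vector_space sA" using assms dualD(1) by blast
qed (simp_all add: alt3_def dualD[OF assms] algebra_simps)

lemma dual_cmult: "\<alpha> \<in> dual sA \<Longrightarrow> (\<lambda>x. r * \<alpha> x) \<in> dual sA"
  using dual_fscale by (simp add: fscale_def)

lemma dual_multc: "\<alpha> \<in> dual sA \<Longrightarrow> (\<lambda>x. \<alpha> x * r) \<in> dual sA"
  using dual_cmult[of \<alpha> sA r] by (simp add: mult.commute)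

lemma (in coord3) alt3_linear:
  assumes g: "Vector_Spaces.linear sA sA g"
    and d1: "\<And>y z. (\<lambda>x. \<Theta> x y z) \<in> dual sA" and d2: "\<And>x z. (\<lambda>y. \<Theta> x y z) \<in> dual sA"
    and d3: "\<And>x y. (\<lambda>z. \<Theta> x y z) \<in> dual sA"
  shows "alt3 (\<lambda>i. g (e i)) \<Theta> = det (mat_of g) * alt3 e \<Theta>"
  unfolding alt3_def det_3
  by (simp add: linear_on_basis[OF g] sum_3 dualD[OF d1] dualD[OF d2] dualD[OF d3]) (simp add: algebra_simps)

context three_coord3
begin

text \<open>The open slots \<open>x\<close>, \<open>y\<close>, \<open>z\<close> lie in three
  different copies of \<open>T\<close>, and volume forms fill the other nine. With all open slots in
  one copy the result would be 0, since exchanging two of the remaining copies would change the sign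
  three times.\<close>

definition cov4 :: "'a \<Rightarrow> 'b \<Rightarrow> 'c \<Rightarrow> ('a \<times> 'b \<times> 'c \<Rightarrow> complex) \<Rightarrow> complex" where
  "cov4 x y z T = alt3 e (\<lambda>x2 x3 x4. alt3 f (\<lambda>y1 y3 y4. alt3 h (\<lambda>z1 z2 z4.
     T (x, y1, z1) * T (x2, y, z2) * T (x3, y3, z) * T (x4, y4, z4))))"

lemma poly_on_cov4: "poly_on V 4 (cov4 x y z)"
proof -
  have "poly_on V 4 (\<lambda>T. T u1 * T u2 * T u3 * T u4)" for u1 u2 u3 u4 :: "'a \<times> 'b \<times> 'c"
    by (rule poly_on_mult[OF poly_on_mult[OF poly_on_mult[OF poly_on_eval poly_on_eval refl] poly_on_eval refl]
        poly_on_eval]) simp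
  then show ?thesis unfolding cov4_def[abs_def] by (intro poly_on_alt3)
qed

lemmas dual_intros = dual_alt3 dual_cmult dual_multc V_dual

lemma cov4_dual:
  assumes "T \<in> V"
  shows "(\<lambda>x. cov4 x y z T) \<in> dual sA" "(\<lambda>y. cov4 x y z T) \<in> dual sB" "(\<lambda>z. cov4 x y z T) \<in> dual sC"
  unfolding cov4_def by (intro dual_intros assms)+

lemma cov4_pull:
  assumes T: "T \<in> V" and lin: "Vector_Spaces.linear sA sA g" "Vector_Spaces.linear sB sB g'"
    "Vector_Spaces.linear sC sC g''"
  shows "cov4 x y z (pull g g' g'' T) =
    det (A.mat_of g) * det (B.mat_of g') * det (C.mat_of g'') * cov4 (g x) (g' y) (g'' z) T"
proof -
  have "cov4 x y z (pull g g' g'' T) =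
    alt3 (\<lambda>i. g (e i)) (\<lambda>x2 x3 x4. alt3 (\<lambda>i. g' (f i)) (\<lambda>y1 y3 y4. alt3 (\<lambda>i. g'' (h i)) (\<lambda>z1 z2 z4.
     T (g x, y1, z1) * T (x2, g' y, z2) * T (x3, y3, g'' z) * T (x4, y4, z4))))"
    by (simp add: cov4_def alt3_def)
  also have "\<dots> = det (C.mat_of g'') * alt3 (\<lambda>i. g (e i)) (\<lambda>x2 x3 x4. alt3 (\<lambda>i. g' (f i)) (\<lambda>y1 y3 y4. alt3 h (\<lambda>z1 z2 z4.
     T (g x, y1, z1) * T (x2, g' y, z2) * T (x3, y3, g'' z) * T (x4, y4, z4))))"
    by (subst C.alt3_linear[OF lin(3)]) (intro dual_intros T | simp add: alt3_cmult)+
  also have "\<dots> = det (C.mat_of g'') * (det (B.mat_of g') * alt3 (\<lambda>i. g (e i)) (\<lambda>x2 x3 x4. alt3 f (\<lambda>y1 y3 y4. alt3 h (\<lambda>z1 z2 z4.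
     T (g x, y1, z1) * T (x2, g' y, z2) * T (x3, y3, g'' z) * T (x4, y4, z4)))))"
    by (subst B.alt3_linear[OF lin(2)]) (intro dual_intros T | simp add: alt3_cmult)+
  also have "\<dots> = det (C.mat_of g'') * (det (B.mat_of g') * (det (A.mat_of g) * cov4 (g x) (g' y) (g'' z) T))"
    unfolding cov4_def
    by (subst A.alt3_linear[OF lin(1)]) (intro dual_intros T | simp)+
  finally show ?thesis by simp
qed

text \<open>Up to the factor 4 the quartics are dual to the star tensors: this makes the 27 quartics
  independent and reads off the coefficients of an equation in terms of them.\<close>

lemma cov4_star:
  "cov4 (e i) (f j) (h k) (star_tensor l m n) = (if i = l \<and> j = m \<and> k = n then 4 else 0)"
proof -
  have num: "(1::3) + 2 = 3" "(2::3) + 1 = 3" "(2::3) + 2 = 1" "(3::3) + 1 = 1" "(3::3) + 2 = 2" "(1::3) + 1 = 2"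
    "(1::3) \<noteq> 2" "(1::3) \<noteq> 3" "(2::3) \<noteq> 1" "(2::3) \<noteq> 3" "(3::3) \<noteq> 1" "(3::3) \<noteq> 2"
    by simp_all
  define T where "T l m n = (\<lambda>(x, y, z). a l x * b m y * c n z + a l x * b (m + 1) y * c (n + 1) z +
      a (l + 1) x * b m y * c (n + 2) z + a (l + 2) x * b (m + 2) y * c n z)" for l m n
  have T: "star_tensor l m n = T l m n" for l m n
    by (auto simp: star_tensor_def T_def basis_tensor_def tensor3_def)
  have main: "cov4 x y z (T l m n) = 4 * a l x * b m y * c n z" for x y z
    using exhaust_3[of l] exhaust_3[of m] exhaust_3[of n]
    by (elim disjE; hypsubst; simp only: cov4_def alt3_def T_def prod.case A.a_e B.a_e C.a_e num if_True if_False
        mult_zero_left mult_zero_right add_0_left add_0_right mult_1_left mult_1_right refl; simp)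
  show ?thesis unfolding T main by (simp add: A.a_e B.a_e C.a_e)
qed

end

section \<open>Modules given by their matrix coefficients\<close>

definition lincomb :: "('i::finite \<Rightarrow> 'x \<Rightarrow> complex) \<Rightarrow> ('i \<Rightarrow> complex) \<Rightarrow> 'x \<Rightarrow> complex" where
  "lincomb Q r = (\<Sum>i\<in>UNIV. fscale (r i) (Q i))"

lemma lincomb_add: "lincomb Q (\<lambda>i. r i + s i) = lincomb Q r + lincomb Q s"
  by (simp add: lincomb_def fv.scale_left_distrib sum.distrib)

lemma lincomb_fscale: "lincomb Q (\<lambda>i. z * r i) = fscale z (lincomb Q r)"
  by (simp add: lincomb_def fv.scale_sum_right)

lemma lincomb_0: "lincomb Q (\<lambda>i. 0) = 0"
  by (simp add: lincomb_def)

lemma lincomb_delta: "lincomb Q (\<lambda>j. if j = i then 1 else 0) = Q i"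
  by (simp add: lincomb_def if_distrib[of "\<lambda>r. fscale r _"] cong: if_cong)

lemma lincomb_sum: "(\<Sum>j\<in>J. fscale (s j) (lincomb Q (r j))) = lincomb Q (\<lambda>i. \<Sum>j\<in>J. s j * r j i)"
  by (induct J rule: infinite_finite_induct)
    (simp_all add: lincomb_0 lincomb_add lincomb_fscale)

lemma lincomb_apply: "lincomb Q r x = (\<Sum>i\<in>UNIV. r i * Q i x)"
proof -
  have "sum g J x = (\<Sum>i\<in>J. g i x)" for g :: "'a \<Rightarrow> 'b \<Rightarrow> complex" and J
    by (induct J rule: infinite_finite_induct) auto
  then show ?thesis by (simp add: lincomb_def fscale_def)
qed

lemma range_lincomb: "range (lincomb Q) = fv.span (range Q)"
proof
  show "range (lincomb Q) \<subseteq> fv.span (range Q)"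
    by (auto simp: lincomb_def intro!: fv.span_sum fv.span_scale) (auto intro: fv.span_base)
  have "Q i \<in> range (lincomb Q)" for i using lincomb_delta by (metis rangeI)
  moreover have "fv.subspace (range (lincomb Q))"
    unfolding fv.subspace_def
    by (auto simp: lincomb_0[of Q, symmetric] lincomb_add[symmetric] lincomb_fscale[symmetric])
  ultimately show "fv.span (range Q) \<subseteq> range (lincomb Q)"
    by (intro fv.span_minimal) auto
qed

lemma
  assumes "inj (lincomb Q)"
  shows inj_of_inj_lincomb: "inj Q" and independent_of_inj_lincomb: "fv.independent (range Q)"
proof -
  show inj: "inj Q"
  proof (rule injI)
    fix i j assume "Q i = Q j"
    then have "lincomb Q (\<lambda>k. if k = i then 1 else 0) = lincomb Q (\<lambda>k. if k = j then 1 else 0)"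
      by (simp only: lincomb_delta)
    from fun_cong[OF injD[OF assms, OF this], of i] show "i = j" by (simp split: if_splits)
  qed
  show "fv.independent (range Q)"
  proof
    assume "fv.dependent (range Q)"
    then obtain u v where u: "v \<in> range Q" "u v \<noteq> 0" "(\<Sum>v\<in>range Q. fscale (u v) v) = 0"
      unfolding fv.dependent_finite[OF finite_imageI[OF finite]] by blast
    then have "lincomb Q (\<lambda>i. u (Q i)) = lincomb Q (\<lambda>i. 0)"
      by (simp add: lincomb_def sum.reindex[OF inj])
    from injD[OF assms, OF this] have "u (Q i) = 0" for i by (rule fun_cong)
    with u show False by auto
  qed
qed

lemma dim_range_lincomb:
  fixes Q :: "'i::finite \<Rightarrow> 'x \<Rightarrow> complex"
  assumes "inj (lincomb Q)"
  shows "fv.dim (range (lincomb Q)) = CARD('i)"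
  unfolding range_lincomb
  using fv.dim_span_eq_card_independent[OF independent_of_inj_lincomb[OF assms]]
    card_image[OF inj_of_inj_lincomb[OF assms]] by simp

text \<open>Serves to identify a copy of the module that is contained in the space of equations with
  the whole of it: both are spanned by families over the same index type.\<close>

lemma range_lincomb_eqI:
  fixes Q R :: "'i::finite \<Rightarrow> 'x \<Rightarrow> complex"
  assumes Q: "inj (lincomb Q)" and sub: "range (lincomb Q) \<subseteq> range (lincomb R)"
  shows "range (lincomb Q) = range (lincomb R)"
proof -
  have QR: "range Q \<subseteq> fv.span (range R)"
    using sub fv.span_superset unfolding range_lincomb by blast
  have "range R \<subseteq> fv.span (range Q)"
  proof (rule ccontr)
    assume "\<not> ?thesis"
    then obtain y where y: "y \<in> range R" "y \<notin> fv.span (range Q)" by blast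
    then have "fv.independent (insert y (range Q))"
      using fv.independent_insertI independent_of_inj_lincomb[OF Q] by blast
    moreover have "insert y (range Q) \<subseteq> fv.span (range R)"
      using fv.span_base[OF y(1)] QR by simp
    ultimately have "card (insert y (range Q)) \<le> card (range R)"
      using fv.independent_span_bound[of "range R" "insert y (range Q)"] by simp
    moreover have "y \<notin> range Q" using y(2) fv.span_base[of y] by metis
    then have "card (insert y (range Q)) = Suc (card (range Q))" by simp
    moreover have "card (range Q) = CARD('i)" using card_image[OF inj_of_inj_lincomb[OF Q]] .
    moreover have "card (range R) \<le> CARD('i)" by (rule card_image_le) simp
    ultimately show False by simp
  qed
  then have "fv.span (range R) \<subseteq> fv.span (range Q)"
    by (intro fv.span_minimal) simp_all
  then show ?thesis using sub unfolding range_lincomb by (intro subset_antisym)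
qed

text \<open>Presents a module by a family together with the matrix by which it transforms.
  Independent families with the same matrix span isomorphic modules, and an isomorphism transports
  the matrix to any other copy.\<close>

definition covariant ::
  "'g set \<Rightarrow> ('g \<Rightarrow> 'i \<Rightarrow> 'i \<Rightarrow> complex) \<Rightarrow> ('g \<Rightarrow> ('x \<Rightarrow> complex) \<Rightarrow> ('x \<Rightarrow> complex)) \<Rightarrow>
    ('i::finite \<Rightarrow> 'x \<Rightarrow> complex) \<Rightarrow> bool" where
  "covariant G \<rho> act Q \<longleftrightarrow> (\<forall>\<gamma>\<in>G. \<forall>i. act \<gamma> (Q i) = lincomb Q (\<rho> \<gamma> i))"

definition linear_act :: "('g \<Rightarrow> ('x \<Rightarrow> complex) \<Rightarrow> ('x \<Rightarrow> complex)) \<Rightarrow> bool" where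
  "linear_act act \<longleftrightarrow> (\<forall>\<gamma> u v. act \<gamma> (u + v) = act \<gamma> u + act \<gamma> v) \<and>
     (\<forall>\<gamma> r u. act \<gamma> (fscale r u) = fscale r (act \<gamma> u))"

lemma act_lincomb:
  fixes Q :: "'i::finite \<Rightarrow> 'x \<Rightarrow> complex"
  assumes "linear_act act" "covariant G \<rho> act Q" "\<gamma> \<in> G"
  shows "act \<gamma> (lincomb Q r) = lincomb Q (\<lambda>j. \<Sum>i\<in>UNIV. r i * \<rho> \<gamma> i j)"
proof -
  have add: "act \<gamma> (u + v) = act \<gamma> u + act \<gamma> v" and scale: "act \<gamma> (fscale s u) = fscale s (act \<gamma> u)" for u v s
    using assms by (auto simp: linear_act_def)
  have "act \<gamma> 0 = 0" using scale[of 0 0] by simp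
  with add have "act \<gamma> (sum g J) = (\<Sum>j\<in>J. act \<gamma> (g j))" for g and J :: "'i set"
    by (induct J rule: infinite_finite_induct) simp_all
  then have "act \<gamma> (lincomb Q r) = (\<Sum>i\<in>UNIV. fscale (r i) (act \<gamma> (Q i)))"
    by (simp add: lincomb_def scale)
  also have "\<dots> = (\<Sum>i\<in>UNIV. fscale (r i) (lincomb Q (\<rho> \<gamma> i)))"
    using assms by (simp add: covariant_def)
  also have "\<dots> = lincomb Q (\<lambda>j. \<Sum>i\<in>UNIV. r i * \<rho> \<gamma> i j)" by (rule lincomb_sum)
  finally show ?thesis .
qed

lemma submodule_lincomb:
  assumes "linear_act act" "covariant G \<rho> act Q" "range (lincomb Q) \<subseteq> N"
  shows "submodule G act N (range (lincomb Q))"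
  unfolding submodule_def
  using assms act_lincomb[OF assms(1,2)] by (auto simp: range_lincomb[symmetric]) (simp add: range_lincomb)

lemma module_iso_lincomb:
  assumes act: "linear_act act" "linear_act act'" and cov: "covariant G \<rho> act Q" "covariant G \<rho> act' R"
    and inj: "inj (lincomb Q)" "inj (lincomb R)"
  shows "module_iso G act (range (lincomb Q)) act' (range (lincomb R))"
proof -
  define \<phi> where "\<phi> x = lincomb R (inv (lincomb Q) x)" for x
  have \<phi>: "\<phi> (lincomb Q r) = lincomb R r" for r
    by (simp add: \<phi>_def inv_f_f[OF inj(1)])
  have "bij_betw \<phi> (range (lincomb Q)) (range (lincomb R))"
    unfolding bij_betw_def
  proof
    show "inj_on \<phi> (range (lincomb Q))"
      using inj by (auto simp: inj_on_def \<phi>)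
    show "\<phi> ` range (lincomb Q) = range (lincomb R)"
      by (auto simp: \<phi> image_iff)
  qed
  moreover have "\<phi> (x + y) = \<phi> x + \<phi> y" if xy: "x \<in> range (lincomb Q)" "y \<in> range (lincomb Q)" for x y
  proof -
    obtain r s where "x = lincomb Q r" "y = lincomb Q s" using xy by blast
    then show ?thesis using \<phi>[of "\<lambda>i. r i + s i"] by (simp add: \<phi> lincomb_add)
  qed
  moreover have "\<phi> (fscale z x) = fscale z (\<phi> x)" if x: "x \<in> range (lincomb Q)" for z x
  proof -
    obtain r where "x = lincomb Q r" using x by blast
    then show ?thesis using \<phi>[of "\<lambda>i. z * r i"] by (simp add: \<phi> lincomb_fscale)
  qed
  moreover have "\<phi> (act \<gamma> x) = act' \<gamma> (\<phi> x)" if \<gamma>: "\<gamma> \<in> G" "x \<in> range (lincomb Q)" for \<gamma> x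
  proof -
    obtain r where "x = lincomb Q r" using \<gamma> by blast
    then show ?thesis
      by (simp add: \<phi> act_lincomb[OF act(1) cov(1) \<gamma>(1)] act_lincomb[OF act(2) cov(2) \<gamma>(1)])
  qed
  ultimately show ?thesis unfolding module_iso_def by blast
qed

text \<open>The family \<open>Q\<close> consists of the preimages of \<open>R\<close>. An abstract
  copy of a module thereby acquires explicit matrix coefficients.\<close>

lemma module_iso_lincombE:
  fixes R :: "'i::finite \<Rightarrow> 'y \<Rightarrow> complex" and act :: "'g \<Rightarrow> ('x \<Rightarrow> complex) \<Rightarrow> ('x \<Rightarrow> complex)"
  assumes act: "linear_act act'" and cov: "covariant G \<rho> act' R" and inj: "inj (lincomb R)"
    and M: "fv.subspace M" "\<And>\<gamma>. \<gamma> \<in> G \<Longrightarrow> act \<gamma> ` M \<subseteq> M"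
    and iso: "module_iso G act M act' (range (lincomb R))"
  obtains Q where "covariant G \<rho> act Q" "M = range (lincomb Q)" "inj (lincomb Q)"
proof -
  obtain \<phi> where bij: "bij_betw \<phi> M (range (lincomb R))"
    and add: "\<And>x y. x \<in> M \<Longrightarrow> y \<in> M \<Longrightarrow> \<phi> (x + y) = \<phi> x + \<phi> y"
    and scale: "\<And>z x. x \<in> M \<Longrightarrow> \<phi> (fscale z x) = fscale z (\<phi> x)"
    and equi: "\<And>\<gamma> x. \<gamma> \<in> G \<Longrightarrow> x \<in> M \<Longrightarrow> \<phi> (act \<gamma> x) = act' \<gamma> (\<phi> x)"
    using iso unfolding module_iso_def by blast
  have R: "R i \<in> range (lincomb R)" for i by (metis lincomb_delta rangeI)
  have "\<forall>i. \<exists>x. x \<in> M \<and> \<phi> x = R i"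
    using R bij_betw_imp_surj_on[OF bij] by (metis imageE)
  then obtain Q where Q: "\<And>i. Q i \<in> M" "\<And>i. \<phi> (Q i) = R i" by metis
  have \<phi>0: "\<phi> 0 = 0" using scale[of 0 0] M(1) by (simp add: fv.subspace_0)
  have \<phi>_sum: "sum g J \<in> M \<and> \<phi> (sum g J) = (\<Sum>j\<in>J. \<phi> (g j))" if "\<And>j. g j \<in> M" for g and J :: "'i set"
    using M(1) that
    by (induct J rule: infinite_finite_induct) (simp_all add: \<phi>0 add fv.subspace_0 fv.subspace_add)
  have Qr: "lincomb Q r \<in> M \<and> \<phi> (lincomb Q r) = lincomb R r" for r
    using \<phi>_sum[of "\<lambda>i. fscale (r i) (Q i)" UNIV] M(1) Q
    by (simp add: lincomb_def fv.subspace_scale scale)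
  have inj\<phi>: "x = y" if "x \<in> M" "y \<in> M" "\<phi> x = \<phi> y" for x y
    using bij that unfolding bij_betw_def inj_on_def by blast
  show thesis
  proof
    show "covariant G \<rho> act Q"
      unfolding covariant_def
    proof (intro ballI allI)
      fix \<gamma> i assume \<gamma>: "\<gamma> \<in> G"
      show "act \<gamma> (Q i) = lincomb Q (\<rho> \<gamma> i)"
      proof (rule inj\<phi>)
        show "act \<gamma> (Q i) \<in> M" using M(2)[OF \<gamma>] Q by blast
        show "\<phi> (act \<gamma> (Q i)) = \<phi> (lincomb Q (\<rho> \<gamma> i))"
          using cov \<gamma> Qr equi[OF \<gamma> Q(1)] Q(2) by (simp add: covariant_def)
      qed (use Qr in blast)
    qed
    show "M = range (lincomb Q)"
    proof
      show "M \<subseteq> range (lincomb Q)"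
      proof
        fix x assume x: "x \<in> M"
        then obtain r where "\<phi> x = lincomb R r" using bij unfolding bij_betw_def by blast
        then have "x = lincomb Q r" using Qr x by (intro inj\<phi>) auto
        then show "x \<in> range (lincomb Q)" by blast
      qed
    qed (use Qr in auto)
    show "inj (lincomb Q)"
    proof (rule injI)
      fix r s assume "lincomb Q r = lincomb Q s"
      then have "lincomb R r = lincomb R s" using Qr by metis
      then show "r = s" by (rule injD[OF inj])
    qed
  qed
qed

lemma linear_act_poly_act: "linear_act poly_act"
  by (auto simp: linear_act_def poly_act_def fscale_def)

lemma linear_act_tensor_act: "linear_act tensor_act"
  by (auto simp: linear_act_def tensor_act_def fscale_def)

section \<open>Covariants of weight one\<close>

text \<open>The determinant is a monic cubic in \<open>t\<close>, so singular matrices are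
  exceptional on every line in the direction of the identity.\<close>

lemma finite_det_shift: "finite {t. det (A + mat t :: complex^3^3) = 0}"
proof -
  define p where "p = [:A$1$1, 1:] * ([:A$2$2, 1:] * [:A$3$3, 1:] - [:A$2$3 * A$3$2:]) +
    [:A$1$2 * (A$2$3 * A$3$1 - A$2$1 * A$3$3), - A$1$2 * A$2$1:] +
    [:A$1$3 * (A$2$1 * A$3$2 - A$2$2 * A$3$1), - A$1$3 * A$3$1:]"
  have "coeff p 3 = 1" by (simp add: p_def eval_nat_numeral)
  then have "p \<noteq> 0" by auto
  moreover have "det (A + mat t) = poly p t" for t
    by (simp add: det_3 mat_def p_def algebra_simps)
  ultimately show ?thesis using poly_roots_finite by simp
qed

context three_coord3
begin

text \<open>Matrix coefficients of the product of three modules of the form A tensored with its top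
  exterior power, which is S_211 A in dimension 3.\<close>

definition rho :: "('a \<Rightarrow> 'a) \<times> ('b \<Rightarrow> 'b) \<times> ('c \<Rightarrow> 'c) \<Rightarrow> 3 \<times> 3 \<times> 3 \<Rightarrow> 3 \<times> 3 \<times> 3 \<Rightarrow> complex" where
  "rho = (\<lambda>(g, g', g'') (i, j, k) (l, m, n).
    det (A.mat_of g) * det (B.mat_of g') * det (C.mat_of g'') *
    (A.mat_of g $ l $ i * B.mat_of g' $ m $ j * C.mat_of g'' $ n $ k))"

abbreviation "G \<equiv> GL sA \<times> GL sB \<times> GL sC"

lemma sum_triple: "(\<Sum>x\<in>(UNIV :: (3 \<times> 3 \<times> 3) set). g x) = (\<Sum>i\<in>UNIV. \<Sum>j\<in>UNIV. \<Sum>k\<in>UNIV. g (i, j, k))"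
  by (simp add: UNIV_Times_UNIV[symmetric] sum.cartesian_product[symmetric] del: UNIV_Times_UNIV)
    (simp add: sum.cartesian_product)

definition unit_tensor :: "'a \<times> 'b \<times> 'c \<Rightarrow> complex" where
  "unit_tensor = (\<Sum>i\<in>UNIV. basis_tensor (i, i, i))"

lemma unit_tensor_apply: "unit_tensor (x, y, z) = (\<Sum>i\<in>UNIV. a i x * b i y * c i z)"
  by (simp add: unit_tensor_def basis_tensor_def tensor3_def sum_3)

lemma unit_tensor_in_V: "unit_tensor \<in> V"
  unfolding unit_tensor_def
  by (intro fv.subspace_sum[OF subspace_V] decomposable_in_V decomposable_basis)

lemma mat_of_lin_of:
  "A.mat_of (A.lin_of M) = M" "B.mat_of (B.lin_of M) = M" "C.mat_of (C.lin_of M) = M"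
  by (simp_all add: A.mat_of_def B.mat_of_def C.mat_of_def A.lin_of_basis B.lin_of_basis C.lin_of_basis
      A.a_e B.a_e C.a_e vec_eq_iff if_distrib[of "\<lambda>x. _ * x"] cong: if_cong)

lemma pull_shift:
  assumes T: "T \<in> V"
  shows "pull (A.lin_of (M + mat t)) g' g'' T = pull (A.lin_of M) g' g'' T + fscale t (pull id g' g'' T)"
    "pull g (B.lin_of (M + mat t)) g'' T = pull g (B.lin_of M) g'' T + fscale t (pull g id g'' T)"
    "pull g g' (C.lin_of (M + mat t)) T = pull g g' (C.lin_of M) T + fscale t (pull g g' id T)"
proof -
  have A: "A.lin_of (M + mat t) x = A.lin_of M x + sA t x" for x
    by (rule A.coord_eqI) (simp add: A.a_lin_of mat_def algebra_simps sum.distrib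
        if_distrib[of "\<lambda>x. _ * x"] cong: if_cong)
  have B: "B.lin_of (M + mat t) x = B.lin_of M x + sB t x" for x
    by (rule B.coord_eqI) (simp add: B.a_lin_of mat_def algebra_simps sum.distrib
        if_distrib[of "\<lambda>x. _ * x"] cong: if_cong)
  have C: "C.lin_of (M + mat t) x = C.lin_of M x + sC t x" for x
    by (rule C.coord_eqI) (simp add: C.a_lin_of mat_def algebra_simps sum.distrib
        if_distrib[of "\<lambda>x. _ * x"] cong: if_cong)
  show "pull (A.lin_of (M + mat t)) g' g'' T = pull (A.lin_of M) g' g'' T + fscale t (pull id g' g'' T)"
    "pull g (B.lin_of (M + mat t)) g'' T = pull g (B.lin_of M) g'' T + fscale t (pull g id g'' T)"
    "pull g g' (C.lin_of (M + mat t)) T = pull g g' (C.lin_of M) T + fscale t (pull g g' id T)"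
    by (auto simp: A B C fscale_def dualD(2)[OF V_dual(1)[OF T]] dualD(3)[OF V_dual(1)[OF T]]
        dualD(2)[OF V_dual(2)[OF T]] dualD(3)[OF V_dual(2)[OF T]]
        dualD(2)[OF V_dual(3)[OF T]] dualD(3)[OF V_dual(3)[OF T]])
qed

text \<open>Invertibility is dropped for one factor at a time, along \<open>M + mat t\<close>.
  Singular matrices matter because every sum of three decomposable tensors is a pull of the unit
  tensor, in general by singular matrices.\<close>

lemma zero_at_pulls:
  assumes P: "P \<in> hom_poly V d" and T: "T \<in> V"
    and z: "\<And>L M N. det L \<noteq> 0 \<Longrightarrow> det M \<noteq> 0 \<Longrightarrow> det N \<noteq> 0 \<Longrightarrow>
      P (pull (A.lin_of L) (B.lin_of M) (C.lin_of N) T) = 0"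
  shows "P (pull (A.lin_of L) (B.lin_of M) (C.lin_of N) T) = 0"
proof -
  note lin = A.linear_lin_of B.linear_lin_of C.linear_lin_of fv.linear_id
    A.linear_id B.linear_id C.linear_id
  note cof = hom_poly_zero_by_cofinite_line[OF subspace_V _ _ P]
  have 1: "P (pull (A.lin_of L) (B.lin_of M) (C.lin_of N) T) = 0" if "det M \<noteq> 0" "det N \<noteq> 0" for L M N
  proof (rule cof[of _ "pull id (B.lin_of M) (C.lin_of N) T"])
    show "finite {t. P (pull (A.lin_of L) (B.lin_of M) (C.lin_of N) T +
        fscale t (pull id (B.lin_of M) (C.lin_of N) T)) \<noteq> 0}"
      using z that by (intro finite_subset[OF _ finite_det_shift[of L]]) (auto simp: pull_shift(1)[OF T, symmetric])
  qed (intro pull_in_V T lin)+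
  have 2: "P (pull (A.lin_of L) (B.lin_of M) (C.lin_of N) T) = 0" if "det N \<noteq> 0" for L M N
  proof (rule cof[of _ "pull (A.lin_of L) id (C.lin_of N) T"])
    show "finite {t. P (pull (A.lin_of L) (B.lin_of M) (C.lin_of N) T +
        fscale t (pull (A.lin_of L) id (C.lin_of N) T)) \<noteq> 0}"
      using 1 that by (intro finite_subset[OF _ finite_det_shift[of M]]) (auto simp: pull_shift(2)[OF T, symmetric])
  qed (intro pull_in_V T lin)+
  show ?thesis
  proof (rule cof[of _ "pull (A.lin_of L) (B.lin_of M) id T"])
    show "finite {t. P (pull (A.lin_of L) (B.lin_of M) (C.lin_of N) T +
        fscale t (pull (A.lin_of L) (B.lin_of M) id T)) \<noteq> 0}"
      using 2 by (intro finite_subset[OF _ finite_det_shift[of N]]) (auto simp: pull_shift(3)[OF T, symmetric])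
  qed (intro pull_in_V T lin)+
qed

lemma pull_unit_tensor:
  "pull (A.lin_of (\<chi> i j. \<alpha> i (e j))) (B.lin_of (\<chi> i j. \<beta> i (f j))) (C.lin_of (\<chi> i j. \<gamma> i (h j))) unit_tensor =
    tensor3 (\<alpha> 1) (\<beta> 1) (\<gamma> 1) + tensor3 (\<alpha> 2) (\<beta> 2) (\<gamma> 2) + tensor3 (\<alpha> 3) (\<beta> 3) (\<gamma> 3)"
  if "\<And>i. \<alpha> i \<in> dual sA" "\<And>i. \<beta> i \<in> dual sB" "\<And>i. \<gamma> i \<in> dual sC"
proof -
  have "a i (A.lin_of (\<chi> i j. \<alpha> i (e j)) x) = \<alpha> i x" for i x
    unfolding A.dual_expansion[OF that(1)[of i], of x] by (simp add: A.a_lin_of mult.commute)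
  moreover have "b i (B.lin_of (\<chi> i j. \<beta> i (f j)) x) = \<beta> i x" for i x
    unfolding B.dual_expansion[OF that(2)[of i], of x] by (simp add: B.a_lin_of mult.commute)
  moreover have "c i (C.lin_of (\<chi> i j. \<gamma> i (h j)) x) = \<gamma> i x" for i x
    unfolding C.dual_expansion[OF that(3)[of i], of x] by (simp add: C.a_lin_of mult.commute)
  ultimately show ?thesis by (auto simp: unit_tensor_apply tensor3_def sum_3)
qed

text \<open>The value at the unit tensor is killed by its stabiliser: a diagonal torus removes all
  weights other than \<open>(i, i, i)\<close>, and the simultaneous transposition of the two other indices
  acts by the sign $(-1)^3$.\<close>

lemma covariant_unit_tensor:
  assumes cov: "covariant G rho poly_act Q"
  shows "Q x unit_tensor = 0"
proof -
  have act: "Q x (pull (A.lin_of L) (B.lin_of M) (C.lin_of N) T) =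
      (\<Sum>y\<in>UNIV. rho (A.lin_of L, B.lin_of M, C.lin_of N) x y * Q y T)"
    if "det L \<noteq> 0" "det M \<noteq> 0" "det N \<noteq> 0" for L M N x T
  proof -
    have "(A.lin_of L, B.lin_of M, C.lin_of N) \<in> G"
      using that by (simp add: A.lin_of_GL B.lin_of_GL C.lin_of_GL)
    then have "poly_act (A.lin_of L, B.lin_of M, C.lin_of N) (Q x) =
        lincomb Q (rho (A.lin_of L, B.lin_of M, C.lin_of N) x)"
      using cov unfolding covariant_def by blast
    from fun_cong[OF this, of T] show ?thesis by (simp add: poly_act_pull lincomb_apply)
  qed
  define diag where "diag u = (\<chi> i j. if i = j then u i else 0)" for u :: "3 \<Rightarrow> complex"
  have det_diag: "det (diag u) = u 1 * u 2 * u 3" for u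
    by (simp add: diag_def det_3)
  have pull_diag: "pull (A.lin_of (diag u)) (B.lin_of (diag v)) (C.lin_of (diag w)) unit_tensor = unit_tensor"
    if "\<And>i. u i * v i * w i = 1" for u v w
  proof -
    have "a i (A.lin_of (diag u) x) = u i * a i x" "b i (B.lin_of (diag v) y) = v i * b i y"
      "c i (C.lin_of (diag w) z) = w i * c i z" for i x y z
      by (simp_all add: A.a_lin_of B.a_lin_of C.a_lin_of diag_def if_distrib[of "\<lambda>x. x * _"] cong: if_cong)
    then have "a i (A.lin_of (diag u) x) * b i (B.lin_of (diag v) y) * c i (C.lin_of (diag w) z) =
        (u i * v i * w i) * (a i x * b i y * c i z)" for i x y z
      by simp
    then show ?thesis by (auto simp: unit_tensor_apply that)
  qed
  have torus: "Q (i, j, k) unit_tensor = u i * v j * w k * Q (i, j, k) unit_tensor"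
    if uvw: "\<And>i. u i * v i * w i = 1" for u v w i j k
  proof -
    have nz: "u i \<noteq> 0" "v i \<noteq> 0" "w i \<noteq> 0" for i using uvw[of i] by auto
    have "u 1 * u 2 * u 3 * (v 1 * v 2 * v 3) * (w 1 * w 2 * w 3) = (u 1 * v 1 * w 1) * (u 2 * v 2 * w 2) * (u 3 * v 3 * w 3)"
      by (simp add: algebra_simps)
    also have "\<dots> = 1" by (simp only: uvw mult_1)
    \<comment> \<open>So the determinants in \<open>rho\<close> cancel on this torus, and only the
      weight \<open>u i * v j * w k\<close> is left.\<close>
    finally have D: "u 1 * u 2 * u 3 * (v 1 * v 2 * v 3) * (w 1 * w 2 * w 3) = 1" .
    have "rho (A.lin_of (diag u), B.lin_of (diag v), C.lin_of (diag w)) (i, j, k) (l, m, n) =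
      (if l = i \<and> m = j \<and> n = k then u i * v j * w k else 0)" for l m n
      using D by (simp add: rho_def mat_of_lin_of det_diag) (simp add: diag_def)
    then have r: "rho (A.lin_of (diag u), B.lin_of (diag v), C.lin_of (diag w)) (i, j, k) y =
      (if y = (i, j, k) then u i * v j * w k else 0)" for y
      by (cases y) auto
    show ?thesis
      using act[of "diag u" "diag v" "diag w" "(i, j, k)" unit_tensor]
      by (simp add: det_diag nz pull_diag[OF uvw] r if_distrib[of "\<lambda>x. x * _"] cong: if_cong)
  qed
  define swp where "swp \<tau> = (\<chi> i j. if i = \<tau> j then 1 else (0::complex))" for \<tau> :: "3 \<Rightarrow> 3"
  have diagonal: "Q (i, i, i) unit_tensor = 0" for i
  proof -
    have "\<exists>\<tau>. det (swp \<tau>) = -1 \<and> \<tau> i = i \<and> (\<forall>i. \<tau> (\<tau> i) = i)"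
      using exhaust_3[of i]
    proof (elim disjE)
      assume "i = 1"
      then show ?thesis by (intro exI[of _ "Transposition.transpose 2 3"]) (simp add: swp_def det_3 Transposition.transpose_def)
    next
      assume "i = 2"
      then show ?thesis by (intro exI[of _ "Transposition.transpose 1 3"]) (simp add: swp_def det_3 Transposition.transpose_def)
    next
      assume "i = 3"
      then show ?thesis by (intro exI[of _ "Transposition.transpose 1 2"]) (simp add: swp_def det_3 Transposition.transpose_def)
    qed
    then obtain \<tau> where \<tau>: "det (swp \<tau>) = -1" "\<tau> i = i" "\<And>i. \<tau> (\<tau> i) = i" by blast
    have eq: "l = \<tau> j \<longleftrightarrow> j = \<tau> l" for l j using \<tau>(3) by metis
    have ab: "a i (A.lin_of (swp \<tau>) x) = a (\<tau> i) x" "b i (B.lin_of (swp \<tau>) y) = b (\<tau> i) y"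
      "c i (C.lin_of (swp \<tau>) z) = c (\<tau> i) z" for i x y z
      by (simp_all add: A.a_lin_of B.a_lin_of C.a_lin_of swp_def eq[of i] if_distrib[of "\<lambda>x. x * _"] cong: if_cong)
    have "bij \<tau>" using \<tau>(3) by (metis bij_betw_byWitness involuntory_imp_bij)
    then have sum_\<tau>: "(\<Sum>i\<in>UNIV. g (\<tau> i)) = (\<Sum>i\<in>UNIV. g i)" for g :: "3 \<Rightarrow> complex"
      by (rule sum.reindex_bij_betw)
    have inv: "pull (A.lin_of (swp \<tau>)) (B.lin_of (swp \<tau>)) (C.lin_of (swp \<tau>)) unit_tensor = unit_tensor"
    proof (intro ext, clarify)
      fix x y z
      show "pull (A.lin_of (swp \<tau>)) (B.lin_of (swp \<tau>)) (C.lin_of (swp \<tau>)) unit_tensor (x, y, z) =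
          unit_tensor (x, y, z)"
        by (simp only: pull_apply unit_tensor_apply ab sum_\<tau>[of "\<lambda>i. a i x * b i y * c i z"])
    qed
    have "rho (A.lin_of (swp \<tau>), B.lin_of (swp \<tau>), C.lin_of (swp \<tau>)) (i, i, i) (l, m, n) =
      (if l = i \<and> m = i \<and> n = i then -1 else 0)" for l m n
      by (simp add: rho_def mat_of_lin_of \<tau>(1)) (simp add: swp_def \<tau>(2))
    then have r: "rho (A.lin_of (swp \<tau>), B.lin_of (swp \<tau>), C.lin_of (swp \<tau>)) (i, i, i) y =
      (if y = (i, i, i) then -1 else 0)" for y
      by (cases y) auto
    show ?thesis
      using act[of "swp \<tau>" "swp \<tau>" "swp \<tau>" "(i, i, i)" unit_tensor]
      by (simp add: \<tau>(1) inv r if_distrib[of "\<lambda>x. x * _"] cong: if_cong)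
  qed
  obtain i j k where x: "x = (i, j, k)" by (metis prod_cases3)
  \<comment> \<open>Off the diagonal some torus element acts with weight 2: the entries 2 and 1/2
    stand at \<open>i\<close> in two factors, and the second of these factors is read at another
    index. The value then equals twice itself.\<close>
  consider "i \<noteq> j" | "i \<noteq> k" | "i = j" "i = k" by blast
  then show ?thesis
  proof cases
    case 1
    then show ?thesis
      using torus[of "\<lambda>r. if r = i then 2 else 1" "\<lambda>r. if r = i then 1/2 else 1" "\<lambda>r. 1" i j k] by (simp add: x)
  next
    case 2
    then show ?thesis
      using torus[of "\<lambda>r. if r = i then 2 else 1" "\<lambda>r. 1" "\<lambda>r. if r = i then 1/2 else 1" i j k] by (simp add: x)
  next
    case 3
    then show ?thesis using diagonal x by simp
  qed
qed

lemma covariant_vanishes: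
  assumes cov: "covariant G rho poly_act Q" and hom: "\<And>x. Q x \<in> hom_poly V d"
    and dec: "decomposable t" "decomposable u" "decomposable v"
  shows "Q x (t + u + v) = 0"
proof -
  have z: "Q x (pull (A.lin_of L) (B.lin_of M) (C.lin_of N) unit_tensor) = 0"
    if "det L \<noteq> 0" "det M \<noteq> 0" "det N \<noteq> 0" for L M N
  proof -
    have "(A.lin_of L, B.lin_of M, C.lin_of N) \<in> G"
      using that by (simp add: A.lin_of_GL B.lin_of_GL C.lin_of_GL)
    then have "poly_act (A.lin_of L, B.lin_of M, C.lin_of N) (Q x) =
        lincomb Q (rho (A.lin_of L, B.lin_of M, C.lin_of N) x)"
      using cov unfolding covariant_def by blast
    then have "poly_act (A.lin_of L, B.lin_of M, C.lin_of N) (Q x) unit_tensor = 0"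
      using covariant_unit_tensor[OF cov] by (simp add: lincomb_apply)
    then show ?thesis by (simp add: poly_act_pull)
  qed
  obtain \<alpha> \<beta> \<gamma> \<alpha>' \<beta>' \<gamma>' \<alpha>'' \<beta>'' \<gamma>'' where
    t: "t = tensor3 \<alpha> \<beta> \<gamma>" "\<alpha> \<in> dual sA" "\<beta> \<in> dual sB" "\<gamma> \<in> dual sC"
    and u: "u = tensor3 \<alpha>' \<beta>' \<gamma>'" "\<alpha>' \<in> dual sA" "\<beta>' \<in> dual sB" "\<gamma>' \<in> dual sC"
    and v: "v = tensor3 \<alpha>'' \<beta>'' \<gamma>''" "\<alpha>'' \<in> dual sA" "\<beta>'' \<in> dual sB" "\<gamma>'' \<in> dual sC"
    using dec unfolding decomposable_def by (elim bexE) blast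
  have num: "(1::3) \<noteq> 2" "(1::3) \<noteq> 3" "(2::3) \<noteq> 3" "(3::3) \<noteq> 1" "(3::3) \<noteq> 2" "(2::3) \<noteq> 1" by simp_all
  define \<alpha>s where "\<alpha>s i = (if i = 1 then \<alpha> else if i = 2 then \<alpha>' else \<alpha>'')" for i :: 3
  define \<beta>s where "\<beta>s i = (if i = 1 then \<beta> else if i = 2 then \<beta>' else \<beta>'')" for i :: 3
  define \<gamma>s where "\<gamma>s i = (if i = 1 then \<gamma> else if i = 2 then \<gamma>' else \<gamma>'')" for i :: 3
  have "t + u + v = pull (A.lin_of (\<chi> i j. \<alpha>s i (e j))) (B.lin_of (\<chi> i j. \<beta>s i (f j)))
      (C.lin_of (\<chi> i j. \<gamma>s i (h j))) unit_tensor"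
  proof (subst pull_unit_tensor)
    show "\<alpha>s i \<in> dual sA" "\<beta>s i \<in> dual sB" "\<gamma>s i \<in> dual sC" for i
      using t u v by (simp_all add: \<alpha>s_def \<beta>s_def \<gamma>s_def)
    show "t + u + v = tensor3 (\<alpha>s 1) (\<beta>s 1) (\<gamma>s 1) + tensor3 (\<alpha>s 2) (\<beta>s 2) (\<gamma>s 2) +
        tensor3 (\<alpha>s 3) (\<beta>s 3) (\<gamma>s 3)"
      by (simp only: \<alpha>s_def \<beta>s_def \<gamma>s_def t u v num if_True if_False refl)
  qed
  then show ?thesis
    by (simp only:) (rule zero_at_pulls[OF hom unit_tensor_in_V], rule z)
qed

section \<open>The 27 quartics span the quartic equations\<close>

definition cov4_family :: "3 \<times> 3 \<times> 3 \<Rightarrow> ('a \<times> 'b \<times> 'c \<Rightarrow> complex) \<Rightarrow> complex" where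
  "cov4_family = (\<lambda>(i, j, k) T. if T \<in> V then cov4 (e i) (f j) (h k) T else 0)"

lemma cov4_family_hom: "cov4_family x \<in> hom_poly V 4"
  using poly_on_cov4 by (simp add: cov4_family_def poly_on_def split: prod.split)

lemma cov4_family_covariant: "covariant G rho poly_act cov4_family"
  unfolding covariant_def
proof (intro ballI allI)
  fix \<gamma> and x :: "3 \<times> 3 \<times> 3" assume \<gamma>: "\<gamma> \<in> G"
  obtain g g' g'' where g: "\<gamma> = (g, g', g'')" by (metis prod_cases3)
  obtain i j k where x: "x = (i, j, k)" by (metis prod_cases3)
  have GL: "g \<in> GL sA" "g' \<in> GL sB" "g'' \<in> GL sC" using \<gamma> g by auto
  then have lin: "Vector_Spaces.linear sA sA g" "Vector_Spaces.linear sB sB g'" "Vector_Spaces.linear sC sC g''"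
    by (auto simp: GL_def)
  show "poly_act \<gamma> (cov4_family x) = lincomb cov4_family (rho \<gamma> x)"
  proof
    fix T
    show "poly_act \<gamma> (cov4_family x) T = lincomb cov4_family (rho \<gamma> x) T"
    proof (cases "T \<in> V")
      case True
      have "cov4 (g (e i)) (g' (f j)) (g'' (h k)) T =
        (\<Sum>l\<in>UNIV. \<Sum>m\<in>UNIV. \<Sum>n\<in>UNIV. A.mat_of g $ l $ i * B.mat_of g' $ m $ j * C.mat_of g'' $ n $ k *
          cov4 (e l) (f m) (h n) T)"
        unfolding A.linear_on_basis[OF lin(1)] B.linear_on_basis[OF lin(2)] C.linear_on_basis[OF lin(3)]
        by (simp add: dualD(2,3,5)[OF cov4_dual(1)[OF True]] dualD(2,3,5)[OF cov4_dual(2)[OF True]]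
            dualD(2,3,5)[OF cov4_dual(3)[OF True]] sum_3) (simp add: algebra_simps)
      then show ?thesis
        using True by (simp add: g x poly_act_pull cov4_family_def pull_in_V_iff[OF GL] cov4_pull[OF True lin]
            lincomb_apply sum_triple rho_def sum_distrib_left mult.assoc)
    next
      case False
      then show ?thesis
        by (simp add: g x poly_act_pull cov4_family_def pull_in_V_iff[OF GL] lincomb_apply sum_triple)
    qed
  qed
qed

lemma star_tensor_in_V: "star_tensor i j k \<in> V"
  unfolding star_tensor_def by (intro V_add decomposable_in_V decomposable_basis)

lemma cov4_family_star: "cov4_family (i, j, k) (star_tensor l m n) = (if (i, j, k) = (l, m, n) then 4 else 0)"
  by (simp add: cov4_family_def star_tensor_in_V cov4_star)

lemma lincomb_cov4_star: "lincomb cov4_family r (star_tensor l m n) = 4 * r (l, m, n)"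
proof -
  have "lincomb cov4_family r (star_tensor l m n) = (\<Sum>x\<in>UNIV. if x = (l, m, n) then 4 * r x else 0)"
    unfolding lincomb_apply by (intro sum.cong refl) (auto simp: cov4_family_star split: prod.split if_splits)
  then show ?thesis by simp
qed

lemma inj_lincomb_cov4: "inj (lincomb cov4_family)"
proof (rule injI)
  fix r s :: "3 \<times> 3 \<times> 3 \<Rightarrow> complex"
  assume eq: "lincomb cov4_family r = lincomb cov4_family s"
  show "r = s"
  proof
    fix x :: "3 \<times> 3 \<times> 3"
    obtain i j k where x: "x = (i, j, k)" by (metis prod_cases3)
    show "r x = s x"
      using fun_cong[OF eq, of "star_tensor i j k"] by (simp add: lincomb_cov4_star x)
  qed
qed

text \<open>Subtracting the combination with the same values at the star tensors leaves an equation
  that is 0 at all of them; \<open>covariant_vanishes\<close> ensures that the difference is still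
  an equation.\<close>

lemma vanishing_quartics:
  assumes P: "P \<in> hom_poly V 4"
    and van: "\<And>t u v. decomposable t \<Longrightarrow> decomposable u \<Longrightarrow> decomposable v \<Longrightarrow> P (t + u + v) = 0"
  shows "P \<in> range (lincomb cov4_family)"
proof -
  define r where "r = (\<lambda>(i, j, k). P (star_tensor i j k) / 4)"
  have lin: "lincomb cov4_family r \<in> hom_poly V 4"
    unfolding lincomb_def by (intro hom_poly_sum hom_poly_fscale cov4_family_hom)
  have "P - lincomb cov4_family r = 0"
  proof (rule quartic_determined_by_stars)
    show "P - lincomb cov4_family r \<in> hom_poly V 4" using P lin by (rule hom_poly_diff)
    show "(P - lincomb cov4_family r) (star_tensor i j k) = 0" for i j k
      by (simp add: lincomb_cov4_star r_def)
    show "(P - lincomb cov4_family r) (t + u + v) = 0" if "decomposable t" "decomposable u" "decomposable v" for t u v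
      using van[OF that] covariant_vanishes[OF cov4_family_covariant cov4_family_hom that]
      by (simp add: lincomb_apply)
  qed
  then have "P = lincomb cov4_family r" by simp
  then show ?thesis by blast
qed

lemma quartics_of_secant_3:
  "ideal_deg V (secant_variety V 3 X) 4 = range (lincomb cov4_family)"
proof
  have dec3: "P (t + u + v) = 0"
    if P: "P \<in> ideal_deg V (secant_variety V 3 X) 4" and dec: "decomposable t" "decomposable u" "decomposable v" for P t u v
  proof -
    obtain \<alpha> \<beta> \<gamma> \<alpha>' \<beta>' \<gamma>' \<alpha>'' \<beta>'' \<gamma>'' where
      t: "t = tensor3 \<alpha> \<beta> \<gamma>" "\<alpha> \<in> dual sA" "\<beta> \<in> dual sB" "\<gamma> \<in> dual sC"
      and u: "u = tensor3 \<alpha>' \<beta>' \<gamma>'" "\<alpha>' \<in> dual sA" "\<beta>' \<in> dual sB" "\<gamma>' \<in> dual sC"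
      and v: "v = tensor3 \<alpha>'' \<beta>'' \<gamma>''" "\<alpha>'' \<in> dual sA" "\<beta>'' \<in> dual sB" "\<gamma>'' \<in> dual sC"
      using dec unfolding decomposable_def by (elim bexE) blast
    have "P (\<Sum>i<3. tensor3 (case i of 0 \<Rightarrow> \<alpha> | Suc 0 \<Rightarrow> \<alpha>' | _ \<Rightarrow> \<alpha>'') (case i of 0 \<Rightarrow> \<beta> | Suc 0 \<Rightarrow> \<beta>' | _ \<Rightarrow> \<beta>'')
        (case i of 0 \<Rightarrow> \<gamma> | Suc 0 \<Rightarrow> \<gamma>' | _ \<Rightarrow> \<gamma>'')) = 0"
      using P t u v by (subst (asm) ideal_deg_secant) (auto split: nat.splits)
    then show ?thesis by (simp add: t u v eval_nat_numeral)
  qed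
  show "ideal_deg V (secant_variety V 3 X) 4 \<subseteq> range (lincomb cov4_family)"
    using vanishing_quartics dec3 by (auto simp: ideal_deg_def)
  show "range (lincomb cov4_family) \<subseteq> ideal_deg V (secant_variety V 3 X) 4"
  proof clarify
    fix r
    have "lincomb cov4_family r \<in> hom_poly V 4"
      unfolding lincomb_def by (intro hom_poly_sum hom_poly_fscale cov4_family_hom)
    then show "lincomb cov4_family r \<in> ideal_deg V (secant_variety V 3 X) 4"
      by (subst ideal_deg_secant)
        (auto simp: eval_nat_numeral lincomb_apply intro!: sum.neutral
          covariant_vanishes[OF cov4_family_covariant cov4_family_hom] decomposableI)
  qed
qed

end

section \<open>The Schur functors of the partitions 211 and 333\<close>

definition alt_sum :: "nat set \<Rightarrow> (nat \<Rightarrow> nat \<Rightarrow> complex) \<Rightarrow> complex" where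
  "alt_sum S F = (\<Sum>q | q permutes S. of_int (sign q) * (\<Prod>i\<in>S. F i (q i)))"

lemma alt_sum_3:
  assumes "r \<noteq> s" "r \<noteq> t" "s \<noteq> t"
  shows "alt_sum {r, s, t} F = F r r * F s s * F t t + F r s * F s t * F t r + F r t * F s r * F t s
    - F r r * F s t * F t s - F r s * F s r * F t t - F r t * F s s * F t r"
proof -
  have f: "finite {s, t}" "r \<notin> {s, t}" "finite {t}" "s \<notin> {t}" using assms by auto
  have t: "{q. q permutes {t}} = {id}" by auto
  show ?thesis
    unfolding alt_sum_def sum_over_permutations_insert[OF f(1,2)] sum_over_permutations_insert[OF f(3,4)] t
    using assms
    by (simp add: sign_swap_id permutation_swap_id sign_compose sign_id Transposition.transpose_def)
qed

text \<open>Permutations preserving each block form the product of the symmetric groups of the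
  blocks, and the sign is multiplicative. A block may be empty: the partition 211 has only two
  columns.\<close>

lemma sum_permutes_three_blocks:
  assumes fin: "finite S" "finite T" "finite U" and disj: "S \<inter> T = {}" "S \<inter> U = {}" "T \<inter> U = {}"
  shows "(\<Sum>q | q permutes (S \<union> T \<union> U) \<and> q ` S = S \<and> q ` T = T \<and> q ` U = U.
      of_int (sign q) * (\<Prod>i\<in>S \<union> T \<union> U. F i (q i))) = alt_sum S F * alt_sum T F * alt_sum U F"
    (is "sum ?f ?C = _")
proof -
  define P where "P S = {q. q permutes S}" for S :: "nat set"
  define j where "j = (\<lambda>(q1, q2 :: nat \<Rightarrow> nat, q3 :: nat \<Rightarrow> nat). q1 \<circ> (q2 \<circ> q3) :: nat \<Rightarrow> nat)"
  define R where "R S q = (\<lambda>x. if x \<in> S then q x else x)" for S :: "nat set" and q :: "nat \<Rightarrow> nat"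
  have R: "R S q permutes S" if "inj q" "q ` S = S" for S q
    by (rule bij_imp_permutes)
      (use that in \<open>auto simp: R_def bij_betw_def inj_on_def inj_def image_iff\<close>)
  have jS: "j (q1, q2, q3) x = q1 x" if "q1 permutes S" "q2 permutes T" "q3 permutes U" "x \<in> S" for q1 q2 q3 x
  proof -
    have "x \<notin> T" "x \<notin> U" using that(4) disj by blast+
    then show ?thesis using permutes_not_in[OF that(2)] permutes_not_in[OF that(3)] by (simp add: j_def)
  qed
  have jT: "j (q1, q2, q3) x = q2 x" if "q1 permutes S" "q2 permutes T" "q3 permutes U" "x \<in> T" for q1 q2 q3 x
  proof -
    have "q2 x \<in> T" using that by (simp add: permutes_in_image)
    then have "q2 x \<notin> S" "x \<notin> U" using that(4) disj by blast+
    then show ?thesis using permutes_not_in[OF that(1)] permutes_not_in[OF that(3)] by (simp add: j_def)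
  qed
  have jU: "j (q1, q2, q3) x = q3 x" if "q1 permutes S" "q2 permutes T" "q3 permutes U" "x \<in> U" for q1 q2 q3 x
  proof -
    have "q3 x \<in> U" using that by (simp add: permutes_in_image)
    then have "q3 x \<notin> S" "q3 x \<notin> T" using disj by blast+
    then show ?thesis using permutes_not_in[OF that(1)] permutes_not_in[OF that(2)] by (simp add: j_def)
  qed
  have j_perm: "j (q1, q2, q3) permutes (S \<union> T \<union> U)"
    if "q1 permutes S" "q2 permutes T" "q3 permutes U" for q1 q2 q3
    unfolding j_def prod.case using that
    by (intro permutes_compose) (auto intro: permutes_subset)
  have "sum ?f ?C = (\<Sum>(q1, q2, q3)\<in>P S \<times> P T \<times> P U. ?f (j (q1, q2, q3)))"
  proof (rule sum.reindex_bij_witness[where i = j and j = "\<lambda>q. (R S q, R T q, R U q)"])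
    fix q assume "q \<in> ?C"
    then have q: "q permutes (S \<union> T \<union> U)" "q ` S = S" "q ` T = T" "q ` U = U" by auto
    have inj: "inj q" using q(1) by (rule permutes_inj)
    show RP: "(R S q, R T q, R U q) \<in> P S \<times> P T \<times> P U" using R[OF inj] q by (auto simp: P_def)
    have RP': "R S q permutes S" "R T q permutes T" "R U q permutes U" using RP by (auto simp: P_def)
    show jR: "j (R S q, R T q, R U q) = q"
    proof
      fix x
      consider "x \<in> S" | "x \<in> T" | "x \<in> U" | "x \<notin> S \<union> T \<union> U" by blast
      then show "j (R S q, R T q, R U q) x = q x"
      proof cases
        case 4
        then show ?thesis using permutes_not_in[OF q(1) 4] permutes_not_in[OF j_perm[OF RP'] 4] by simp
      qed (use jS[OF RP'] jT[OF RP'] jU[OF RP'] in \<open>auto simp: R_def\<close>)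
    qed
    show "(case (R S q, R T q, R U q) of (q1, q2, q3) \<Rightarrow> ?f (j (q1, q2, q3))) = ?f q"
      by (simp add: jR)
  next
    fix x assume "x \<in> P S \<times> P T \<times> P U"
    then obtain q1 q2 q3 where x: "x = (q1, q2, q3)" and q: "q1 permutes S" "q2 permutes T" "q3 permutes U"
      by (auto simp: P_def)
    have "j x ` S = q1 ` S" "j x ` T = q2 ` T" "j x ` U = q3 ` U"
      using jS[OF q] jT[OF q] jU[OF q] by (auto simp: x image_iff)
    then show "j x \<in> ?C" using j_perm[OF q] q by (simp add: x permutes_image)
    have "R S (j x) y = q1 y" "R T (j x) y = q2 y" "R U (j x) y = q3 y" for y
      using jS[OF q, of y] jT[OF q, of y] jU[OF q, of y] q permutes_not_in[of q1 S y] permutes_not_in[of q2 T y]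
        permutes_not_in[of q3 U y] by (auto simp: R_def x)
    then show "(R S (j x), R T (j x), R U (j x)) = x" by (auto simp: x)
  qed
  also have "\<dots> = (\<Sum>(q1, q2, q3)\<in>P S \<times> P T \<times> P U.
      (of_int (sign q1) * (\<Prod>i\<in>S. F i (q1 i))) * ((of_int (sign q2) * (\<Prod>i\<in>T. F i (q2 i))) *
      (of_int (sign q3) * (\<Prod>i\<in>U. F i (q3 i)))))"
  proof (intro sum.cong refl, clarify)
    fix q1 q2 q3 assume "q1 \<in> P S" "q2 \<in> P T" "q3 \<in> P U"
    then have q: "q1 permutes S" "q2 permutes T" "q3 permutes U" by (auto simp: P_def)
    note perm = permutes_imp_permutation[OF fin(1) q(1)] permutes_imp_permutation[OF fin(2) q(2)]
      permutes_imp_permutation[OF fin(3) q(3)]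
    have sg: "sign (j (q1, q2, q3)) = sign q1 * (sign q2 * sign q3)"
      by (simp add: j_def sign_compose perm permutation_compose)
    have "(\<Prod>i\<in>S \<union> T \<union> U. F i (j (q1, q2, q3) i)) =
      (\<Prod>i\<in>S. F i (j (q1, q2, q3) i)) * (\<Prod>i\<in>T. F i (j (q1, q2, q3) i)) * (\<Prod>i\<in>U. F i (j (q1, q2, q3) i))"
      using fin disj by (subst prod.union_disjoint; (subst prod.union_disjoint)?) auto
    also have "\<dots> = (\<Prod>i\<in>S. F i (q1 i)) * (\<Prod>i\<in>T. F i (q2 i)) * (\<Prod>i\<in>U. F i (q3 i))"
      using jS[OF q] jT[OF q] jU[OF q] by simp
    finally show "?f (j (q1, q2, q3)) = (of_int (sign q1) * (\<Prod>i\<in>S. F i (q1 i))) *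
      ((of_int (sign q2) * (\<Prod>i\<in>T. F i (q2 i))) * (of_int (sign q3) * (\<Prod>i\<in>U. F i (q3 i))))"
      by (simp add: sg)
  qed
  also have "\<dots> = alt_sum S F * (alt_sum T F * alt_sum U F)"
    unfolding alt_sum_def P_def[symmetric]
    by (simp add: sum.cartesian_product[symmetric] sum_distrib_left[symmetric] sum_distrib_right[symmetric])
  finally show ?thesis by simp
qed

definition pure_tensor ::
  "(complex \<Rightarrow> 'a \<Rightarrow> 'a) \<Rightarrow> nat \<Rightarrow> (nat \<Rightarrow> 'a::ab_group_add) \<Rightarrow> ('a \<Rightarrow> complex) list \<Rightarrow> complex" where
  "pure_tensor sA d v = (\<lambda>\<alpha>s. if length \<alpha>s = d \<and> set \<alpha>s \<subseteq> dual sA then (\<Prod>i<d. (\<alpha>s ! i) (v i)) else 0)"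

lemma tensor_power_pure: "tensor_power sA d = fv.span (range (pure_tensor sA d))"
  unfolding tensor_power_def pure_tensor_def by (simp add: full_SetCompr_eq)

text \<open>Permuting the covectors by the inverse of \<open>p \<circ> q\<close> amounts to
  permuting the vectors by \<open>p \<circ> q\<close>. For fixed \<open>p\<close> the sum over the
  column group is then a product of determinants, one for each column.\<close>

lemma young_symmetrize_pure:
  assumes d: "d = sum_list l"
    and col: "col_group l = {q. q permutes (S \<union> T \<union> U) \<and> q ` S = S \<and> q ` T = T \<and> q ` U = U}"
    and STU: "{..<d} = S \<union> T \<union> U" "S \<inter> T = {}" "S \<inter> U = {}" "T \<inter> U = {}"
  shows "young_symmetrize l (pure_tensor sA d v) \<alpha>s =
    (if length \<alpha>s = d \<and> set \<alpha>s \<subseteq> dual sA then \<Sum>p\<in>row_group l. \<Prod>B\<leftarrow>[S, T, U]. alt_sum B (\<lambda>i k. (\<alpha>s ! i) (v (p k))) else 0)"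
proof (cases "length \<alpha>s = d \<and> set \<alpha>s \<subseteq> dual sA")
  case True
  have fin: "finite S" "finite T" "finite U"
    using STU(1) by (metis finite_Un finite_lessThan)+
  have "pure_tensor sA d v (permute_list (inv (p \<circ> q)) \<alpha>s) = (\<Prod>i\<in>S \<union> T \<union> U. (\<alpha>s ! i) (v (p (q i))))"
    if "p \<in> row_group l" "q \<in> col_group l" for p q
  proof -
    have pq: "(p \<circ> q) permutes {..<d}"
      using that unfolding row_group_def col_group_def d by (auto intro: permutes_compose)
    note inv = permutes_inv[OF pq]
    have "pure_tensor sA d v (permute_list (inv (p \<circ> q)) \<alpha>s) = (\<Prod>i<d. (\<alpha>s ! inv (p \<circ> q) i) (v i))"
      using True inv by (auto simp: pure_tensor_def permute_list_nth intro!: prod.cong)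
    also have "\<dots> = (\<Prod>i<d. (\<alpha>s ! inv (p \<circ> q) ((p \<circ> q) i)) (v ((p \<circ> q) i)))"
      by (rule prod.reindex_bij_betw[OF permutes_imp_bij[OF pq], symmetric])
    also have "\<dots> = (\<Prod>i\<in>S \<union> T \<union> U. (\<alpha>s ! i) (v (p (q i))))"
      unfolding STU(1)[symmetric] using permutes_inverses(2)[OF pq] by (simp add: o_def)
    finally show ?thesis .
  qed
  then have "young_symmetrize l (pure_tensor sA d v) \<alpha>s =
      (\<Sum>p\<in>row_group l. \<Sum>q\<in>col_group l. of_int (sign q) * (\<Prod>i\<in>S \<union> T \<union> U. (\<alpha>s ! i) (v (p (q i)))))"
    unfolding young_symmetrize_def by (intro sum.cong refl) simp
  also have "\<dots> = (\<Sum>p\<in>row_group l. \<Prod>B\<leftarrow>[S, T, U]. alt_sum B (\<lambda>i k. (\<alpha>s ! i) (v (p k))))"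
    unfolding col
    by (simp add: sum_permutes_three_blocks[OF fin STU(2-4), where F = "\<lambda>i k. (\<alpha>s ! i) (v (p k))" for p] mult.assoc)
  finally show ?thesis using True by simp
next
  case False
  have "pure_tensor sA d v (permute_list (inv (p \<circ> q)) \<alpha>s) = 0"
    if "p \<in> row_group l" "q \<in> col_group l" for p q
  proof (cases "length \<alpha>s = d")
    case True
    have "inv (p \<circ> q) permutes {..<d}"
      using that unfolding row_group_def col_group_def d by (auto intro: permutes_compose permutes_inv)
    then show ?thesis using False True by (simp add: pure_tensor_def)
  qed (simp add: pure_tensor_def)
  then show ?thesis using False by (auto simp: young_symmetrize_def)
qed

lemma young_symmetrize_add: "young_symmetrize l (s + t) = young_symmetrize l s + young_symmetrize l t"
  by (auto simp: young_symmetrize_def algebra_simps sum.distrib)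

lemma young_symmetrize_fscale: "young_symmetrize l (fscale r t) = fscale r (young_symmetrize l t)"
  by (auto simp: young_symmetrize_def fscale_def sum_distrib_left algebra_simps)

lemma schur_functor_eqI:
  fixes sA :: "complex \<Rightarrow> 'a::ab_group_add \<Rightarrow> 'a"
  assumes sub: "fv.subspace M"
    and pure: "\<And>v. young_symmetrize l (pure_tensor sA (sum_list l) v) \<in> M"
    and onto: "\<And>x. x \<in> M \<Longrightarrow> \<exists>v r. x = fscale r (young_symmetrize l (pure_tensor sA (sum_list l) v))"
  shows "schur_functor l sA = M"
proof
  show "schur_functor l sA \<subseteq> M"
    unfolding schur_functor_def tensor_power_pure
  proof clarify
    fix t assume "t \<in> fv.span (range (pure_tensor sA (sum_list l)))"
    then show "young_symmetrize l t \<in> M"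
    proof (induct rule: fv.span_induct)
      case base
      have "young_symmetrize l (0 :: ('a \<Rightarrow> complex) list \<Rightarrow> complex) = 0"
        using young_symmetrize_fscale[of l 0 0] by simp
      then show ?case
        using sub unfolding fv.subspace_def
        by (auto simp: young_symmetrize_add young_symmetrize_fscale)
    qed (use pure in auto)
  qed
  show "M \<subseteq> schur_functor l sA"
  proof
    fix x assume "x \<in> M"
    then obtain v r where "x = young_symmetrize l (fscale r (pure_tensor sA (sum_list l) v))"
      using onto by (metis young_symmetrize_fscale)
    then show "x \<in> schur_functor l sA"
      unfolding schur_functor_def tensor_power_pure
      by (auto intro!: imageI fv.span_scale intro: fv.span_base)
  qed
qed

lemma young_col_3:
  "young_col [x, y, z] j = (if j < x then {j} else {}) \<union> (if j < y then {x + j} else {}) \<union>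
    (if j < z then {x + y + j} else {})"
proof -
  have "i < length [x, y, z] \<longleftrightarrow> i = 0 \<or> i = 1 \<or> i = 2" for i by auto
  then have "k \<in> young_col [x, y, z] j \<longleftrightarrow>
      k = j \<and> j < x \<or> k = x + j \<and> j < y \<or> k = x + y + j \<and> j < z" for k
    unfolding young_col_def mem_Collect_eq by (simp only: conj_disj_distribR ex_disj_distrib conj_disj_distribL) auto
  then show ?thesis by (intro set_eqI) (simp split: if_splits)
qed

lemma GL_dual_iff:
  assumes g: "g \<in> GL sA"
  shows "(\<lambda>x. \<alpha> (g x)) \<in> dual sA \<longleftrightarrow> \<alpha> \<in> dual sA"
proof
  interpret Vector_Spaces.linear sA sA g using g by (simp add: GL_def)
  have "\<And>y. g (inv g y) = y" using g by (simp add: GL_def bij_is_surj surj_f_inv_f)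
  then have \<alpha>: "\<alpha> y = \<alpha> (g (inv g y))" for y by simp
  assume d: "(\<lambda>x. \<alpha> (g x)) \<in> dual sA"
  have surj: "\<exists>x. y = g x" for y using \<open>\<And>y. g (inv g y) = y\<close> by metis
  show "\<alpha> \<in> dual sA"
  proof (rule dualI[OF dualD(1)[OF d]])
    fix y y'
    obtain x x' where "y = g x" "y' = g x'" using surj by metis
    then show "\<alpha> (y + y') = \<alpha> y + \<alpha> y'" using dualD(2)[OF d, of x x'] by (simp add: add)
  next
    fix r y
    obtain x where "y = g x" using surj by metis
    then show "\<alpha> (sA r y) = r * \<alpha> y" using dualD(3)[OF d, of r x] by (simp add: scale)
  qed
qed (use g dual_compose in \<open>auto simp: GL_def\<close>)

section \<open>The two Schur functors in dimension three\<close>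

context coord3
begin

definition vol :: "('a \<Rightarrow> complex) \<Rightarrow> ('a \<Rightarrow> complex) \<Rightarrow> ('a \<Rightarrow> complex) \<Rightarrow> complex" where
  "vol \<alpha> \<beta> \<gamma> = alt3 e (\<lambda>x y z. \<alpha> x * \<beta> y * \<gamma> z)"

lemma vol_alt3:
  assumes "\<alpha> \<in> dual sA" "\<beta> \<in> dual sA" "\<gamma> \<in> dual sA"
  shows "alt3 w (\<lambda>x y z. \<alpha> x * \<beta> y * \<gamma> z) = det (\<chi> i j. a i (w j)) * vol \<alpha> \<beta> \<gamma>"
proof -
  define W where "W = (\<chi> i j. a i (w j))"
  have W: "lin_of W (e j) = w j" for j
    by (rule coord_eqI) (simp add: a_lin_of W_def a_e if_distrib[of "\<lambda>x. _ * x"] cong: if_cong)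
  have mW: "mat_of (lin_of W) = W"
    by (simp add: mat_of_def W) (simp add: W_def)
  have "alt3 w (\<lambda>x y z. \<alpha> x * \<beta> y * \<gamma> z) = alt3 (\<lambda>i. lin_of W (e i)) (\<lambda>x y z. \<alpha> x * \<beta> y * \<gamma> z)"
    by (simp add: W)
  also have "\<dots> = det W * vol \<alpha> \<beta> \<gamma>"
    unfolding vol_def by (subst alt3_linear[OF linear_lin_of]) (intro dual_cmult dual_multc assms | simp add: mW)+
  finally show ?thesis by (simp add: W_def)
qed

lemma vol_GL:
  assumes "g \<in> GL sA" "\<alpha> \<in> dual sA" "\<beta> \<in> dual sA" "\<gamma> \<in> dual sA"
  shows "vol (\<alpha> \<circ> g) (\<beta> \<circ> g) (\<gamma> \<circ> g) = det (mat_of g) * vol \<alpha> \<beta> \<gamma>"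
proof -
  have "vol (\<alpha> \<circ> g) (\<beta> \<circ> g) (\<gamma> \<circ> g) = alt3 (\<lambda>i. g (e i)) (\<lambda>x y z. \<alpha> x * \<beta> y * \<gamma> z)"
    by (simp add: vol_def alt3_def)
  also have "\<dots> = det (mat_of g) * vol \<alpha> \<beta> \<gamma>"
    unfolding vol_alt3[OF assms(2-4)] mat_of_def ..
  finally show ?thesis .
qed

lemma vol_basis: "vol (a 1) (a 2) (a 3) = 1"
  by (simp add: vol_def alt3_def a_e)

lemma alt_sum_vol:
  assumes "\<And>i. i \<in> {r, s, t} \<Longrightarrow> \<alpha>s ! i \<in> dual sA" "r \<noteq> s" "r \<noteq> t" "s \<noteq> t"
  shows "alt_sum {r, s, t} (\<lambda>i k. (\<alpha>s ! i) (w k)) =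
    det (\<chi> i j. a i (w (if j = 1 then r else if j = 2 then s else t))) * vol (\<alpha>s ! r) (\<alpha>s ! s) (\<alpha>s ! t)"
  unfolding alt_sum_3[OF assms(2-4)]
  by (subst vol_alt3[symmetric]) (simp_all add: assms(1) alt3_def)

text \<open>Box 1 is evaluated at \<open>x\<close> and the column of boxes 0, 2, 3 carries the
  volume form: this is the element of S_211 A that corresponds to \<open>x\<close>.\<close>

definition psi :: "'a \<Rightarrow> ('a \<Rightarrow> complex) list \<Rightarrow> complex" where
  "psi x \<alpha>s = (if length \<alpha>s = 4 \<and> set \<alpha>s \<subseteq> dual sA then (\<alpha>s ! 1) x * vol (\<alpha>s ! 0) (\<alpha>s ! 2) (\<alpha>s ! 3) else 0)"

lemma psi_dual: "(\<lambda>x. psi x \<alpha>s) \<in> dual sA"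
proof (cases "length \<alpha>s = 4 \<and> set \<alpha>s \<subseteq> dual sA")
  case True
  then have "\<alpha>s ! 1 \<in> dual sA" by (auto dest: nth_mem)
  then show ?thesis using True by (simp add: psi_def dual_multc)
next
  case False
  then have "(\<lambda>x. psi x \<alpha>s) = 0" by (intro ext) (simp only: psi_def if_False zero_fun_apply)
  then show ?thesis using dual_0[OF vs] by simp
qed

lemma psi_add: "psi (x + y) = psi x + psi y" and psi_scale: "psi (sA r x) = fscale r (psi x)"
  by (auto simp: dualD[OF psi_dual] fscale_def)

lemma psi_GL:
  assumes "g \<in> GL sA"
  shows "psi x (map (\<lambda>\<alpha>. \<alpha> \<circ> g) \<alpha>s) = det (mat_of g) * psi (g x) \<alpha>s"
proof -
  have "set (map (\<lambda>\<alpha>. \<alpha> \<circ> g) \<alpha>s) \<subseteq> dual sA \<longleftrightarrow> set \<alpha>s \<subseteq> dual sA"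
    using GL_dual_iff[OF assms] by (auto simp: o_def)
  moreover have "\<alpha>s ! i \<in> dual sA" if "set \<alpha>s \<subseteq> dual sA" "i < length \<alpha>s" for i
    using that by auto
  ultimately show ?thesis
    unfolding psi_def using vol_GL[OF assms] by simp
qed

text \<open>Only boxes 0 and 1 share a row, so the symmetrizer has two terms. In each of them the
  long column yields a determinant of vectors times the volume form, and the remaining box an
  evaluation.\<close>

lemma young_211:
  "young_symmetrize [2, 1, 1] (pure_tensor sA 4 v) =
    psi (sA (det (\<chi> i j. a i (v (if j = 1 then 0 else if j = 2 then 2 else 3)))) (v 1) +
      sA (det (\<chi> i j. a i (v (if j = 1 then 1 else if j = 2 then 2 else 3)))) (v 0))"
proof
  fix \<alpha>s
  have lt: "{..<4} = {0, 2, 3} \<union> {1 :: nat} \<union> {} \<and> {..<4} = {0, 1, 2, 3 :: nat}" by auto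
  have yc: "young_col [2, 1, 1] 0 = {0, 2, 3}" "young_col [2, 1, 1] 1 = {1}"
    unfolding young_col_3 by auto
  have yc2: "young_col [2, 1, 1] j = {}" if "j \<noteq> 0" "j \<noteq> 1" for j
    using that unfolding young_col_3 by auto
  have col: "col_group [2, 1, 1] =
      {q. q permutes ({0, 2, 3} \<union> {1} \<union> {}) \<and> q ` {0, 2, 3} = {0, 2, 3} \<and> q ` {1} = {1} \<and> q ` {} = {}}"
  proof -
    have "(\<forall>j. q ` young_col [2, 1, 1] j = young_col [2, 1, 1] j) \<longleftrightarrow>
        q ` {0, 2, 3} = {0, 2, 3} \<and> q ` {1} = {1}" for q
      using yc yc2 by (metis image_empty)
    moreover have "{..<sum_list [2, 1, 1 :: nat]} = {0, 2, 3} \<union> {1} \<union> {}" using lt by simp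
    ultimately show ?thesis unfolding col_group_def by simp
  qed
  have row: "row_group [2, 1, 1] = {p. p permutes {0, 1}}"
  proof -
    have 1: "(\<forall>i<length [2, 1, 1 :: nat]. p ` young_row [2, 1, 1] i = young_row [2, 1, 1] i) \<longleftrightarrow>
        p ` {0, 1} = {0, 1} \<and> p 2 = 2 \<and> p 3 = 3" for p
    proof -
      have y: "young_row [2, 1, 1] 0 = {0, 1}" "young_row [2, 1, 1] 1 = {2}" "young_row [2, 1, 1] 2 = {3}"
        by (auto simp: young_row_def)
      have i: "i < length [2, 1, 1 :: nat] \<longleftrightarrow> i = 0 \<or> i = 1 \<or> i = 2" for i by auto
      have all: "(\<forall>i<length [2, 1, 1 :: nat]. A i) \<longleftrightarrow> A 0 \<and> A 1 \<and> A 2" for A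
        unfolding i by blast
      have im: "p ` {2} = {2} \<longleftrightarrow> p 2 = 2" "p ` {3} = {3} \<longleftrightarrow> p 3 = 3" by simp_all
      show ?thesis
        unfolding all[of "\<lambda>i. p ` young_row [2, 1, 1] i = young_row [2, 1, 1] i"] y im by (rule refl)
    qed
    have "p permutes {..<4} \<and> p ` {0, 1} = {0, 1} \<and> p 2 = 2 \<and> p 3 = 3 \<longleftrightarrow> p permutes {0, 1}" for p :: "nat \<Rightarrow> nat"
    proof
      assume p: "p permutes {..<4} \<and> p ` {0, 1} = {0, 1} \<and> p 2 = 2 \<and> p 3 = 3"
      show "p permutes {0, 1}"
      proof (rule permutes_superset)
        show "p permutes {..<4}" using p by blast
        fix x :: nat assume "x \<in> {..<4} - {0, 1}"
        then have "x = 2 \<or> x = 3" by auto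
        then show "p x = x" using p by blast
      qed
    next
      assume p: "p permutes {0, 1}"
      have "p permutes {..<4}" by (rule permutes_subset[OF p]) auto
      moreover have "p 2 = 2" "p 3 = 3" by (rule permutes_not_in[OF p]; simp)+
      ultimately show "p permutes {..<4} \<and> p ` {0, 1} = {0, 1} \<and> p 2 = 2 \<and> p 3 = 3"
        using permutes_image[OF p] by simp
    qed
    then show ?thesis unfolding row_group_def 1 by simp
  qed
  show "young_symmetrize [2, 1, 1] (pure_tensor sA 4 v) \<alpha>s =
    psi (sA (det (\<chi> i j. a i (v (if j = 1 then 0 else if j = 2 then 2 else 3)))) (v 1) +
      sA (det (\<chi> i j. a i (v (if j = 1 then 1 else if j = 2 then 2 else 3)))) (v 0)) \<alpha>s"
  proof (cases "length \<alpha>s = 4 \<and> set \<alpha>s \<subseteq> dual sA")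
    case True
    then have d: "\<alpha>s ! i \<in> dual sA" if "i < 4" for i using that by auto
    have f: "finite {1 :: nat}" "0 \<notin> {1 :: nat}" by auto
    have s1: "{q. q permutes {1 :: nat}} = {id}" by auto
    have alt: "alt_sum {0, 2, 3} (\<lambda>i k. (\<alpha>s ! i) (w k)) =
      det (\<chi> i j. a i (w (if j = 1 then 0 else if j = 2 then 2 else 3))) * vol (\<alpha>s ! 0) (\<alpha>s ! 2) (\<alpha>s ! 3)" for w
      by (rule alt_sum_vol) (auto intro: d)
    have alt1: "alt_sum {1} (\<lambda>i k. (\<alpha>s ! i) (w k)) = (\<alpha>s ! 1) (w 1)" "alt_sum {} (\<lambda>i k. (\<alpha>s ! i) (w k)) = 1" for w
      by (simp_all add: alt_sum_def sign_id)
    have "young_symmetrize [2, 1, 1] (pure_tensor sA 4 v) \<alpha>s =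
      (\<Sum>p\<in>row_group [2, 1, 1]. \<Prod>B\<leftarrow>[{0, 2, 3}, {1}, {}]. alt_sum B (\<lambda>i k. (\<alpha>s ! i) (v (p k))))"
      using True by (subst young_symmetrize_pure[OF _ col]) (auto simp: lt)
    also have "\<dots> = (\<Sum>p | p permutes {0, 1}. alt_sum {0, 2, 3} (\<lambda>i k. (\<alpha>s ! i) (v (p k))) *
        ((\<alpha>s ! 1) (v (p 1)) * 1))"
      unfolding row by (simp only: list.map prod_list.Cons prod_list.Nil alt1 mult_1_right)
    also have "\<dots> = det (\<chi> i j. a i (v (if j = 1 then 0 else if j = 2 then 2 else 3))) *
        vol (\<alpha>s ! 0) (\<alpha>s ! 2) (\<alpha>s ! 3) * (\<alpha>s ! 1) (v 1) +
        det (\<chi> i j. a i (v (if j = 1 then 1 else if j = 2 then 2 else 3))) *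
        vol (\<alpha>s ! 0) (\<alpha>s ! 2) (\<alpha>s ! 3) * (\<alpha>s ! 1) (v 0)"
    proof -
      have two: "(\<Sum>p | p permutes {0, 1}. F p) = F id + F (Transposition.transpose 0 1)"
        for F :: "(nat \<Rightarrow> nat) \<Rightarrow> complex"
        unfolding sum_over_permutations_insert[OF f] s1 by simp
      have "Transposition.transpose 0 1 (if j = 1 then 0 else if j = 2 then 2 else 3) =
        (if j = 1 then 1 else if j = 2 then 2 else (3 :: nat))" for j :: 3
        by (simp add: Transposition.transpose_def)
      then show ?thesis
        unfolding two alt by simp
    qed
    finally show ?thesis
      using True d[of 1] by (simp add: psi_def dualD algebra_simps)
  next
    case False
    then show ?thesis
      by (subst young_symmetrize_pure[OF _ col]) (auto simp: lt psi_def)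
  qed
qed

lemma range_psi_subspace: "fv.subspace (range psi)"
proof -
  have "psi 0 = 0" using psi_scale[of 0 0] by simp
  then show ?thesis
    unfolding fv.subspace_def using psi_add psi_scale by safe (metis rangeI)+
qed

lemma schur_functor_211: "schur_functor [2, 1, 1] sA = range psi"
proof (rule schur_functor_eqI[OF range_psi_subspace])
  show "young_symmetrize [2, 1, 1] (pure_tensor sA (sum_list [2, 1, 1]) v) \<in> range psi" for v
    using young_211[of v] by simp
  fix t assume "t \<in> range psi"
  then obtain x where t: "t = psi x" by blast
  \<comment> \<open>\<open>y\<close> solves y + a_1(y) e_1 = x. With the filling e_1, y, e_2, e_3
    the two determinants are 1 and a_1(y), so the symmetrized tensor is
    \<open>psi x\<close>.\<close>
  define y where "y = x - sA (a 1 x / 2) (e 1)"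
  define v where "v i = (if i = 0 then e 1 else if i = 1 then y else if i = 2 then e 2 else e 3)" for i :: nat
  have a1: "a 1 y = a 1 x / 2" by (simp add: y_def dualD[OF a_dual] a_e diff_conv_add_uminus
      dualD(3)[OF a_dual, of _ "-1", simplified] del: add_uminus_conv_diff)
  have v: "v 0 = e 1" "v 1 = y" "v 2 = e 2" "v 3 = e 3" by (simp_all add: v_def)
  have D: "det (\<chi> i j. a i (v (if j = 1 then 0 else if j = 2 then 2 else 3))) = 1"
    "det (\<chi> i j. a i (v (if j = 1 then 1 else if j = 2 then 2 else 3))) = a 1 y"
    using v by (simp_all add: det_3 a_e)
  have "young_symmetrize [2, 1, 1] (pure_tensor sA 4 v) = psi (sA 1 y + sA (a 1 y) (e 1))"
    unfolding young_211 D v ..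
  also have "\<dots> = psi x" unfolding a1 by (simp add: y_def)
  finally show "\<exists>v r. t = fscale r (young_symmetrize [2, 1, 1] (pure_tensor sA (sum_list [2, 1, 1]) v))"
    by (intro exI[of _ v] exI[of _ 1]) (simp add: t)
qed

text \<open>One volume form for each column of the 3 by 3 diagram, whose boxes are numbered row by
  row.\<close>

definition omega :: "('a \<Rightarrow> complex) list \<Rightarrow> complex" where
  "omega \<alpha>s = (if length \<alpha>s = 9 \<and> set \<alpha>s \<subseteq> dual sA then
     vol (\<alpha>s ! 0) (\<alpha>s ! 3) (\<alpha>s ! 6) * vol (\<alpha>s ! 1) (\<alpha>s ! 4) (\<alpha>s ! 7) * vol (\<alpha>s ! 2) (\<alpha>s ! 5) (\<alpha>s ! 8) else 0)"

lemma omega_GL: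
  assumes "g \<in> GL sA"
  shows "omega (map (\<lambda>\<alpha>. \<alpha> \<circ> g) \<alpha>s) = det (mat_of g) ^ 3 * omega \<alpha>s"
proof -
  have "set (map (\<lambda>\<alpha>. \<alpha> \<circ> g) \<alpha>s) \<subseteq> dual sA \<longleftrightarrow> set \<alpha>s \<subseteq> dual sA"
    using GL_dual_iff[OF assms] by (auto simp: o_def)
  moreover have "\<alpha>s ! i \<in> dual sA" if "set \<alpha>s \<subseteq> dual sA" "i < length \<alpha>s" for i
    using that by auto
  ultimately show ?thesis
    unfolding omega_def using vol_GL[OF assms] by (simp add: power3_eq_cube)
qed

text \<open>Each column contributes a determinant times a volume form. \<open>D\<close> is the
  product of the three determinants; its value on the filling with rows e_1, e_2, e_3 is recorded in
  order to show that the image is not 0.\<close>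

lemma young_333:
  obtains D where "young_symmetrize [3, 3, 3] (pure_tensor sA 9 v) = fscale (\<Sum>p\<in>row_group [3, 3, 3]. D (v \<circ> p)) omega"
    "\<And>w. w 0 = e 1 \<and> w 1 = e 1 \<and> w 2 = e 1 \<and> w 3 = e 2 \<and> w 4 = e 2 \<and> w 5 = e 2 \<and> w 6 = e 3 \<and> w 7 = e 3 \<and> w 8 = e 3
      \<Longrightarrow> D w = 1"
proof -
  have lt: "{..<9} = {0, 3, 6} \<union> {1, 4, 7} \<union> {2, 5, 8 :: nat}" by auto
  have yc: "young_col [3, 3, 3] 0 = {0, 3, 6}" "young_col [3, 3, 3] 1 = {1, 4, 7}" "young_col [3, 3, 3] 2 = {2, 5, 8}"
    unfolding young_col_3 by auto
  have yc2: "young_col [3, 3, 3] j = {}" if "j \<noteq> 0" "j \<noteq> 1" "j \<noteq> 2" for j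
    using that unfolding young_col_3 by auto
  have col: "col_group [3, 3, 3] =
      {q. q permutes ({0, 3, 6} \<union> {1, 4, 7} \<union> {2, 5, 8}) \<and> q ` {0, 3, 6} = {0, 3, 6} \<and> q ` {1, 4, 7} = {1, 4, 7} \<and>
        q ` {2, 5, 8} = {2, 5, 8}}"
  proof -
    have "(\<forall>j. q ` young_col [3, 3, 3] j = young_col [3, 3, 3] j) \<longleftrightarrow>
        q ` {0, 3, 6} = {0, 3, 6} \<and> q ` {1, 4, 7} = {1, 4, 7} \<and> q ` {2, 5, 8} = {2, 5, 8}" for q
      using yc yc2 by (metis image_empty)
    moreover have "{..<sum_list [3, 3, 3 :: nat]} = {0, 3, 6} \<union> {1, 4, 7} \<union> {2, 5, 8}" using lt by simp
    ultimately show ?thesis unfolding col_group_def by simp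
  qed
  define W where "W w r s t = det (\<chi> i j. a i (w (if j = 1 then r else if j = 2 then s else t)))"
    for w :: "nat \<Rightarrow> 'a" and r s t
  define D where "D w = W w 0 3 6 * W w 1 4 7 * W w 2 5 8" for w
  have "young_symmetrize [3, 3, 3] (pure_tensor sA 9 v) \<alpha>s = fscale (\<Sum>p\<in>row_group [3, 3, 3]. D (v \<circ> p)) omega \<alpha>s" for \<alpha>s
  proof (cases "length \<alpha>s = 9 \<and> set \<alpha>s \<subseteq> dual sA")
    case True
    then have d: "\<alpha>s ! i \<in> dual sA" if "i < 9" for i using that by auto
    have alt: "alt_sum {r, s, t} (\<lambda>i k. (\<alpha>s ! i) (v (p k))) = W (v \<circ> p) r s t * vol (\<alpha>s ! r) (\<alpha>s ! s) (\<alpha>s ! t)"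
      if rst: "r < s" "s < t" "t < 9" for r s t p
    proof -
      have "\<alpha>s ! i \<in> dual sA" if "i \<in> {r, s, t}" for i using that rst d by auto
      from alt_sum_vol[OF this, where w = "v \<circ> p"] rst show ?thesis by (simp add: W_def o_def)
    qed
    have "young_symmetrize [3, 3, 3] (pure_tensor sA 9 v) \<alpha>s =
      (\<Sum>p\<in>row_group [3, 3, 3]. alt_sum {0, 3, 6} (\<lambda>i k. (\<alpha>s ! i) (v (p k))) *
        (alt_sum {1, 4, 7} (\<lambda>i k. (\<alpha>s ! i) (v (p k))) * alt_sum {2, 5, 8} (\<lambda>i k. (\<alpha>s ! i) (v (p k)))))"
      using True by (subst young_symmetrize_pure[OF _ col]) (auto simp: lt)
    also have "\<dots> = (\<Sum>p\<in>row_group [3, 3, 3]. D (v \<circ> p) * omega \<alpha>s)"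
      using True by (simp add: alt omega_def D_def algebra_simps)
    finally show ?thesis by (simp add: fscale_def sum_distrib_right)
  next
    case False
    then show ?thesis
      by (subst young_symmetrize_pure[OF _ col]) (auto simp: lt omega_def fscale_def)
  qed
  then have 1: "young_symmetrize [3, 3, 3] (pure_tensor sA 9 v) = fscale (\<Sum>p\<in>row_group [3, 3, 3]. D (v \<circ> p)) omega"
    by (rule ext)
  have 2: "D w = 1" if "w 0 = e 1 \<and> w 1 = e 1 \<and> w 2 = e 1 \<and> w 3 = e 2 \<and> w 4 = e 2 \<and> w 5 = e 2 \<and> w 6 = e 3 \<and> w 7 = e 3 \<and> w 8 = e 3" for w
    using that by (simp add: D_def W_def det_3 a_e)
  show thesis by (rule that[OF 1 2])
qed

lemma schur_functor_333: "schur_functor [3, 3, 3] sA = range (\<lambda>r. fscale r omega)"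
proof (rule schur_functor_eqI)
  show "fv.subspace (range (\<lambda>r. fscale r omega))"
    unfolding fv.span_singleton[symmetric] by (rule fv.subspace_span)
  show "young_symmetrize [3, 3, 3] (pure_tensor sA (sum_list [3, 3, 3]) v) \<in> range (\<lambda>r. fscale r omega)" for v
    by (rule young_333[of v]) (simp, rule rangeI)
  \<comment> \<open>The row group fixes this filling, since it is constant along rows. All terms of
    the symmetrizer agree, and it yields \<open>omega\<close> times the order of the row
    group.\<close>
  define v where "v i = (if i < 3 then e 1 else if i < 6 then e 2 else e 3)" for i :: nat
  obtain D where D: "young_symmetrize [3, 3, 3] (pure_tensor sA 9 v) = fscale (\<Sum>p\<in>row_group [3, 3, 3]. D (v \<circ> p)) omega"
    "\<And>w. w 0 = e 1 \<and> w 1 = e 1 \<and> w 2 = e 1 \<and> w 3 = e 2 \<and> w 4 = e 2 \<and> w 5 = e 2 \<and> w 6 = e 3 \<and> w 7 = e 3 \<and> w 8 = e 3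
      \<Longrightarrow> D w = 1" by (rule young_333[of v]) (rule that)
  have Dp: "D (v \<circ> p) = 1" if "p \<in> row_group [3, 3, 3]" for p
  proof (rule D(2))
    have y: "young_row [3, 3, 3] 0 = {0, 1, 2}" "young_row [3, 3, 3] 1 = {3, 4, 5}" "young_row [3, 3, 3] 2 = {6, 7, 8}"
      by (auto simp: young_row_def)
    have "p ` young_row [3, 3, 3] i = young_row [3, 3, 3] i" if "i < 3" for i
      using \<open>p \<in> row_group _\<close> that by (simp add: row_group_def)
    from this[of 0] this[of 1] this[of 2]
    have im: "p ` {0, 1, 2} = {0, 1, 2}" "p ` {3, 4, 5} = {3, 4, 5}" "p ` {6, 7, 8} = {6, 7, 8}"
      unfolding y by simp_all
    have "p i < 3" if "i \<in> {0, 1, 2}" for i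
      using imageI[OF that, of p] unfolding im by auto
    moreover have "3 \<le> p i \<and> p i < 6" if "i \<in> {3, 4, 5}" for i
      using imageI[OF that, of p] unfolding im by auto
    moreover have "6 \<le> p i" if "i \<in> {6, 7, 8}" for i
      using imageI[OF that, of p] unfolding im by auto
    ultimately have "p 0 < 3" "p 1 < 3" "p 2 < 3" "3 \<le> p 3 \<and> p 3 < 6" "3 \<le> p 4 \<and> p 4 < 6" "3 \<le> p 5 \<and> p 5 < 6"
      "6 \<le> p 6" "6 \<le> p 7" "6 \<le> p 8"
      by simp_all
    then show "(v \<circ> p) 0 = e 1 \<and> (v \<circ> p) 1 = e 1 \<and> (v \<circ> p) 2 = e 1 \<and> (v \<circ> p) 3 = e 2 \<and> (v \<circ> p) 4 = e 2 \<and>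
      (v \<circ> p) 5 = e 2 \<and> (v \<circ> p) 6 = e 3 \<and> (v \<circ> p) 7 = e 3 \<and> (v \<circ> p) 8 = e 3"
      by (simp add: v_def)
  qed
  define N where "N = card (row_group [3, 3, 3])"
  have "finite (row_group [3, 3, 3])"
    by (rule finite_subset[OF _ finite_permutations[of "{..<sum_list [3, 3, 3 :: nat]}"]]) (auto simp: row_group_def)
  moreover have "id \<in> row_group [3, 3, 3]" by (simp add: row_group_def permutes_id)
  ultimately have N: "N \<noteq> 0" by (auto simp: N_def)
  have Dv: "young_symmetrize [3, 3, 3] (pure_tensor sA 9 v) = fscale (of_nat N) omega"
    using D(1) Dp by (simp add: N_def)
  fix t assume "t \<in> range (\<lambda>r. fscale r omega)"
  then obtain r where "t = fscale r omega" by blast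
  then show "\<exists>v r. t = fscale r (young_symmetrize [3, 3, 3] (pure_tensor sA (sum_list [3, 3, 3]) v))"
    using N by (intro exI[of _ v] exI[of _ "r / of_nat N"]) (simp add: Dv)
qed

end

section \<open>The Schur products and their copies among the polynomials\<close>

context three_coord3
begin

definition schur_basis_211 where
  "schur_basis_211 = (\<lambda>(i, j, k). tensor3 (A.psi (e i)) (B.psi (f j)) (C.psi (h k)))"

lemma psi_expansion:
  "A.psi x \<alpha>s = (\<Sum>i\<in>UNIV. a i x * A.psi (e i) \<alpha>s)" "B.psi y \<beta>s = (\<Sum>i\<in>UNIV. b i y * B.psi (f i) \<beta>s)"
  "C.psi z \<gamma>s = (\<Sum>i\<in>UNIV. c i z * C.psi (h i) \<gamma>s)"
  by (rule A.dual_expansion[OF A.psi_dual] B.dual_expansion[OF B.psi_dual] C.dual_expansion[OF C.psi_dual])+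

lemma tensor3_psi:
  "tensor3 (A.psi x) (B.psi y) (C.psi z) = lincomb schur_basis_211 (\<lambda>(i, j, k). a i x * b j y * c k z)"
proof (intro ext, clarify)
  fix \<alpha>s \<beta>s \<gamma>s
  show "tensor3 (A.psi x) (B.psi y) (C.psi z) (\<alpha>s, \<beta>s, \<gamma>s) =
      lincomb schur_basis_211 (\<lambda>(i, j, k). a i x * b j y * c k z) (\<alpha>s, \<beta>s, \<gamma>s)"
    unfolding tensor3_def lincomb_apply sum_triple schur_basis_211_def prod.case
      psi_expansion(1)[of x] psi_expansion(2)[of y] psi_expansion(3)[of z]
    by (simp add: sum_3) (simp add: algebra_simps)
qed

lemma schur_prod_211: "schur_prod [2, 1, 1] sA sB sC = range (lincomb schur_basis_211)"
  unfolding schur_prod_def tensor_prod3_def A.schur_functor_211 B.schur_functor_211 C.schur_functor_211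
proof
  show "fv.span {tensor3 u v w |u v w. u \<in> range A.psi \<and> v \<in> range B.psi \<and> w \<in> range C.psi}
      \<subseteq> range (lincomb schur_basis_211)"
    by (rule fv.span_minimal) (auto simp: tensor3_psi, simp add: range_lincomb)
  show "range (lincomb schur_basis_211) \<subseteq>
      fv.span {tensor3 u v w |u v w. u \<in> range A.psi \<and> v \<in> range B.psi \<and> w \<in> range C.psi}"
    unfolding range_lincomb by (rule fv.span_mono) (auto simp: schur_basis_211_def, blast)
qed

lemma inj_schur_basis_211: "inj (lincomb schur_basis_211)"
proof (rule injI)
  fix r s :: "3 \<times> 3 \<times> 3 \<Rightarrow> complex"
  assume eq: "lincomb schur_basis_211 r = lincomb schur_basis_211 s"
  \<comment> \<open>Slot 1 reads the vector, while slots 0, 2, 3 carry the dual basis, on which the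
    volume form is 1.\<close>
  have psi: "A.psi (e i) [a 1, a j, a 2, a 3] = (if j = i then 1 else 0)"
    "B.psi (f i) [b 1, b j, b 2, b 3] = (if j = i then 1 else 0)"
    "C.psi (h i) [c 1, c j, c 2, c 3] = (if j = i then 1 else 0)" for i j
    by (simp_all add: A.psi_def B.psi_def C.psi_def A.a_dual B.a_dual C.a_dual A.a_e B.a_e C.a_e
        A.vol_basis B.vol_basis C.vol_basis)
  have ev: "lincomb schur_basis_211 r ([a 1, a i, a 2, a 3], [b 1, b j, b 2, b 3], [c 1, c k, c 2, c 3]) = r (i, j, k)"
    for r i j k
  proof -
    have "lincomb schur_basis_211 r ([a 1, a i, a 2, a 3], [b 1, b j, b 2, b 3], [c 1, c k, c 2, c 3]) =
      (\<Sum>x\<in>UNIV. if x = (i, j, k) then r x else 0)"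
      unfolding lincomb_apply
      by (intro sum.cong refl) (auto simp: schur_basis_211_def tensor3_def psi split: prod.split)
    then show ?thesis by simp
  qed
  show "r = s"
  proof
    fix x :: "3 \<times> 3 \<times> 3"
    show "r x = s x" using ev[of r] ev[of s] eq by (cases x) metis
  qed
qed

lemma schur_basis_211_covariant: "covariant G rho tensor_act schur_basis_211"
  unfolding covariant_def
proof (intro ballI allI)
  fix \<gamma> and x :: "3 \<times> 3 \<times> 3" assume \<gamma>: "\<gamma> \<in> G"
  obtain g g' g'' where g: "\<gamma> = (g, g', g'')" by (metis prod_cases3)
  obtain i j k where x: "x = (i, j, k)" by (metis prod_cases3)
  have GL: "g \<in> GL sA" "g' \<in> GL sB" "g'' \<in> GL sC" using \<gamma> g by auto
  have "tensor_act \<gamma> (schur_basis_211 x) = fscale (det (A.mat_of g) * det (B.mat_of g') * det (C.mat_of g''))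
      (tensor3 (A.psi (g (e i))) (B.psi (g' (f j))) (C.psi (g'' (h k))))"
    by (auto simp: g x tensor_act_def schur_basis_211_def tensor3_def fscale_def
        A.psi_GL[OF GL(1)] B.psi_GL[OF GL(2)] C.psi_GL[OF GL(3)])
  also have "\<dots> = lincomb schur_basis_211 (rho \<gamma> x)"
    unfolding tensor3_psi lincomb_fscale[symmetric]
    by (rule arg_cong[of _ _ "lincomb schur_basis_211"])
      (auto simp: rho_def g x A.mat_of_def B.mat_of_def C.mat_of_def)
  finally show "tensor_act \<gamma> (schur_basis_211 x) = lincomb schur_basis_211 (rho \<gamma> x)" .
qed

lemma schur_copy_211: "schur_copy [2, 1, 1] sA sB sC (range (lincomb cov4_family))"
  unfolding schur_copy_def schur_prod_211
proof
  show "submodule G poly_act (hom_poly V (sum_list [2, 1, 1])) (range (lincomb cov4_family))"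
  proof (rule submodule_lincomb[OF linear_act_poly_act cov4_family_covariant])
    show "range (lincomb cov4_family) \<subseteq> hom_poly V (sum_list [2, 1, 1])"
      using cov4_family_hom by (auto simp: lincomb_def intro!: hom_poly_sum hom_poly_fscale)
  qed
  show "module_iso G poly_act (range (lincomb cov4_family)) tensor_act (range (lincomb schur_basis_211))"
    by (rule module_iso_lincomb[OF linear_act_poly_act linear_act_tensor_act cov4_family_covariant
          schur_basis_211_covariant inj_lincomb_cov4 inj_schur_basis_211])
qed

lemma schur_copy_211_unique:
  assumes "schur_copy [2, 1, 1] sA sB sC M"
  shows "M = range (lincomb cov4_family)"
proof -
  have M: "M \<subseteq> hom_poly V 4" "fv.subspace M" "\<And>\<gamma>. \<gamma> \<in> G \<Longrightarrow> poly_act \<gamma> ` M \<subseteq> M"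
    and iso: "module_iso G poly_act M tensor_act (range (lincomb schur_basis_211))"
    using assms unfolding schur_copy_def submodule_def schur_prod_211 by (simp, simp, blast, simp)
  obtain Q where Q: "covariant G rho poly_act Q" "M = range (lincomb Q)" "inj (lincomb Q)"
    using module_iso_lincombE[OF linear_act_tensor_act schur_basis_211_covariant inj_schur_basis_211 M(2,3) iso] .
  have hom: "Q x \<in> hom_poly V 4" for x
  proof -
    have "Q x \<in> range (lincomb Q)" by (subst lincomb_delta[of Q x, symmetric]) (rule rangeI)
    then show ?thesis using M(1) Q(2) by blast
  qed
  have "Q x \<in> range (lincomb cov4_family)" for x
    by (rule vanishing_quartics[OF hom]) (rule covariant_vanishes[OF Q(1) hom])
  then have "range (lincomb Q) \<subseteq> range (lincomb cov4_family)"
    unfolding range_lincomb by (intro fv.span_minimal) auto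
  then show ?thesis unfolding Q(2) by (rule range_lincomb_eqI[OF Q(3)])
qed

lemma dim_quartics: "fv.dim (range (lincomb cov4_family)) = 27"
  using dim_range_lincomb[OF inj_lincomb_cov4] by simp

text \<open>Indexed by \<open>unit\<close>, so that the results on families of matrix coefficients
  also cover the one-dimensional module.\<close>

definition schur_basis_333 :: "unit \<Rightarrow> _" where
  "schur_basis_333 _ = tensor3 A.omega B.omega C.omega"

lemma lincomb_unit: "lincomb Q r = fscale (r ()) (Q ())"
  by (simp add: lincomb_def UNIV_unit)

lemma range_lincomb_unit: "range (lincomb Q) = range (\<lambda>r. fscale r (Q ()))"
  by (auto simp: lincomb_unit image_iff)

lemma inj_lincomb_unit:
  assumes "Q () \<noteq> 0"
  shows "inj (lincomb Q)"
  by (rule injI, rule ext) (use assms in \<open>auto simp: lincomb_unit\<close>)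

lemma schur_prod_333: "schur_prod [3, 3, 3] sA sB sC = range (lincomb schur_basis_333)"
  unfolding schur_prod_def tensor_prod3_def A.schur_functor_333 B.schur_functor_333 C.schur_functor_333
proof
  show "fv.span {tensor3 u v w |u v w. u \<in> range (\<lambda>r. fscale r A.omega) \<and> v \<in> range (\<lambda>r. fscale r B.omega) \<and>
      w \<in> range (\<lambda>r. fscale r C.omega)} \<subseteq> range (lincomb schur_basis_333)"
  proof (rule fv.span_minimal)
    have "tensor3 (fscale r A.omega) (fscale s B.omega) (fscale t C.omega) =
        lincomb schur_basis_333 (\<lambda>_. r * s * t)" for r s t
      by (auto simp: lincomb_unit schur_basis_333_def tensor3_def fscale_def)
    then show "{tensor3 u v w |u v w. u \<in> range (\<lambda>r. fscale r A.omega) \<and> v \<in> range (\<lambda>r. fscale r B.omega) \<and>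
      w \<in> range (\<lambda>r. fscale r C.omega)} \<subseteq> range (lincomb schur_basis_333)" by auto
  qed (simp add: range_lincomb)
  have "A.omega \<in> range (\<lambda>r. fscale r A.omega)" "B.omega \<in> range (\<lambda>r. fscale r B.omega)"
    "C.omega \<in> range (\<lambda>r. fscale r C.omega)"
    by (metis fv.scale_one rangeI)+
  then show "range (lincomb schur_basis_333) \<subseteq>
    fv.span {tensor3 u v w |u v w. u \<in> range (\<lambda>r. fscale r A.omega) \<and> v \<in> range (\<lambda>r. fscale r B.omega) \<and>
      w \<in> range (\<lambda>r. fscale r C.omega)}"
    unfolding range_lincomb by (intro fv.span_mono image_subsetI) (simp only: schur_basis_333_def mem_Collect_eq, blast)
qed

lemma inj_schur_basis_333: "inj (lincomb schur_basis_333)"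
proof (rule inj_lincomb_unit)
  have "A.omega [a 1, a 1, a 1, a 2, a 2, a 2, a 3, a 3, a 3] = 1" "B.omega [b 1, b 1, b 1, b 2, b 2, b 2, b 3, b 3, b 3] = 1"
    "C.omega [c 1, c 1, c 1, c 2, c 2, c 2, c 3, c 3, c 3] = 1"
    by (simp_all add: A.omega_def B.omega_def C.omega_def A.a_dual B.a_dual C.a_dual
        A.vol_basis B.vol_basis C.vol_basis)
  then have "schur_basis_333 () ([a 1, a 1, a 1, a 2, a 2, a 2, a 3, a 3, a 3],
      [b 1, b 1, b 1, b 2, b 2, b 2, b 3, b 3, b 3], [c 1, c 1, c 1, c 2, c 2, c 2, c 3, c 3, c 3]) = 1"
    by (simp add: schur_basis_333_def tensor3_def)
  then show "schur_basis_333 () \<noteq> 0" by auto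
qed

lemma dim_schur_prod_333: "fv.dim (schur_prod [3, 3, 3] sA sB sC) = 1"
  unfolding schur_prod_333 using dim_range_lincomb[OF inj_schur_basis_333] by simp

definition rho_det :: "('a \<Rightarrow> 'a) \<times> ('b \<Rightarrow> 'b) \<times> ('c \<Rightarrow> 'c) \<Rightarrow> unit \<Rightarrow> unit \<Rightarrow> complex" where
  "rho_det = (\<lambda>(g, g', g'') _ _. (det (A.mat_of g) * det (B.mat_of g') * det (C.mat_of g'')) ^ 3)"

lemma schur_basis_333_covariant: "covariant G rho_det tensor_act schur_basis_333"
  unfolding covariant_def
  by (auto simp: tensor_act_def schur_basis_333_def tensor3_def fscale_def lincomb_unit rho_det_def
      A.omega_GL B.omega_GL C.omega_GL power_mult_distrib)

lemma schur_copy_333: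
  assumes F: "F \<in> hom_poly V 9" "F \<noteq> 0"
    and inv: "\<And>g g' g'' T. (g, g', g'') \<in> G \<Longrightarrow>
      F (pull g g' g'' T) = (det (A.mat_of g) * det (B.mat_of g') * det (C.mat_of g'')) ^ 3 * F T"
  shows "schur_copy [3, 3, 3] sA sB sC (fv.span {F})"
proof -
  define Q where "Q = (\<lambda>_::unit. F)"
  have r: "fv.span {F} = range (lincomb Q)"
    by (simp add: range_lincomb_unit fv.span_singleton Q_def)
  have cov: "covariant G rho_det poly_act Q"
    unfolding covariant_def
    by (auto simp: Q_def poly_act_pull inv lincomb_unit rho_det_def fscale_def)
  have inj: "inj (lincomb Q)" by (rule inj_lincomb_unit) (use F in \<open>simp add: Q_def\<close>)
  show ?thesis
    unfolding schur_copy_def schur_prod_333 r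
  proof
    show "submodule G poly_act (hom_poly V (sum_list [3, 3, 3])) (range (lincomb Q))"
    proof (rule submodule_lincomb[OF linear_act_poly_act cov])
      show "range (lincomb Q) \<subseteq> hom_poly V (sum_list [3, 3, 3])"
        using F by (auto simp: lincomb_unit Q_def intro!: hom_poly_fscale)
    qed
    show "module_iso G poly_act (range (lincomb Q)) tensor_act (range (lincomb schur_basis_333))"
      by (rule module_iso_lincomb[OF linear_act_poly_act linear_act_tensor_act cov
          schur_basis_333_covariant inj inj_schur_basis_333])
  qed
qed

end

section \<open>Identities for 3 by 3 matrices\<close>

type_synonym mat3 = "complex^3^3"

definition msc :: "complex \<Rightarrow> mat3 \<Rightarrow> mat3" where
  "msc r M = (\<chi> i j. r * M $ i $ j)"

definition adj3 :: "mat3 \<Rightarrow> mat3" where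
  "adj3 M = vector
    [vector [M$2$2 * M$3$3 - M$2$3 * M$3$2, M$1$3 * M$3$2 - M$1$2 * M$3$3, M$1$2 * M$2$3 - M$1$3 * M$2$2],
     vector [M$2$3 * M$3$1 - M$2$1 * M$3$3, M$1$1 * M$3$3 - M$1$3 * M$3$1, M$1$3 * M$2$1 - M$1$1 * M$2$3],
     vector [M$2$1 * M$3$2 - M$2$2 * M$3$1, M$1$2 * M$3$1 - M$1$1 * M$3$2, M$1$1 * M$2$2 - M$1$2 * M$2$1]]"

definition dg :: "(3 \<Rightarrow> complex) \<Rightarrow> mat3" where
  "dg x = (\<chi> i j. if i = j then x i else 0)"

definition outer :: "(3 \<Rightarrow> complex) \<Rightarrow> (3 \<Rightarrow> complex) \<Rightarrow> mat3" where
  "outer u v = (\<chi> i j. u i * v j)"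

text \<open>For invertible X this is det X times X times the commutator of X^-1 Y and X^-1 Z; the
  adjugate keeps the expression polynomial.\<close>

definition comm3 :: "mat3 \<Rightarrow> mat3 \<Rightarrow> mat3 \<Rightarrow> mat3" where
  "comm3 X Y Z = Y ** adj3 X ** Z - Z ** adj3 X ** Y"

lemmas mat3_simps = vec_eq_iff forall_3 matrix_matrix_mult_def sum_3 vector_3

lemma msc_mult: "msc r M ** N = msc r (M ** N)" "M ** msc r N = msc r (M ** N)"
  and msc_msc: "msc r (msc s M) = msc (r * s) M"
  and msc_diff: "msc r (M - N) = msc r M - msc r N"
  and mat_mult: "mat r ** M = msc r M" "M ** mat r = msc r M"
  by (simp_all add: mat3_simps msc_def mat_def algebra_simps)

lemma mat3_distrib:
  fixes M N L :: mat3
  shows "M ** (N + L) = M ** N + M ** L" "(N + L) ** M = N ** M + L ** M"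
    "M ** (N - L) = M ** N - M ** L" "(N - L) ** M = N ** M - L ** M"
  by (simp_all add: mat3_simps algebra_simps)

lemma det_msc: "det (msc r M) = r ^ 3 * det M"
  by (simp add: msc_def det_3 power3_eq_cube algebra_simps)

lemma adj3_right: "M ** adj3 M = mat (det M)" and adj3_left: "adj3 M ** M = mat (det M)"
  by (simp_all add: mat3_simps adj3_def mat_def det_3) (simp_all add: algebra_simps)

lemma adj3_mult: "adj3 (M ** N) = adj3 N ** adj3 M"
  by (simp add: mat3_simps adj3_def) (simp add: algebra_simps)

lemma adj3_adj3: "adj3 (adj3 M) = msc (det M) M"
  by (simp add: mat3_simps adj3_def msc_def det_3) (simp add: algebra_simps)

lemma det_adj3: "det (adj3 M) = det M ^ 2"
  by (simp add: adj3_def det_3 vector_3) (simp add: power2_eq_square algebra_simps)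

lemma adj3_msc: "adj3 (msc r M) = msc (r ^ 2) (adj3 M)"
  by (simp add: mat3_simps adj3_def msc_def power2_eq_square algebra_simps)

lemma rank_one_if_adj3_eq_0:
  assumes "adj3 M = 0"
  obtains u v where "M = outer u v"
proof (cases "\<exists>p q. M $ p $ q \<noteq> 0")
  case False
  then have "M = outer (\<lambda>_. 0) (\<lambda>_. 0)" by (simp add: vec_eq_iff outer_def)
  then show thesis by (rule that)
next
  case True
  then obtain p q where pq: "M $ p $ q \<noteq> 0" by blast
  have "\<forall>i j. adj3 M $ i $ j = 0" using assms by simp
  then have minors: "M$2$2 * M$3$3 = M$2$3 * M$3$2" "M$1$3 * M$3$2 = M$1$2 * M$3$3" "M$1$2 * M$2$3 = M$1$3 * M$2$2"
    "M$2$3 * M$3$1 = M$2$1 * M$3$3" "M$1$1 * M$3$3 = M$1$3 * M$3$1" "M$1$3 * M$2$1 = M$1$1 * M$2$3"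
    "M$2$1 * M$3$2 = M$2$2 * M$3$1" "M$1$2 * M$3$1 = M$1$1 * M$3$2" "M$1$1 * M$2$2 = M$1$2 * M$2$1"
    by (auto simp: adj3_def forall_3 vector_3)
  note m = minors minors[symmetric]
  have c: "a * b = c * d" if "b * a = c * d \<or> a * b = d * c \<or> b * a = d * c" for a b c d :: complex
    using that by (auto simp: mult.commute)
  have "\<forall>i j p q. M $ i $ j * M $ p $ q = M $ i $ q * M $ p $ j"
    unfolding forall_3
    by (intro conjI; (rule refl | rule mult.commute | rule m |
        (rule c, rule disjI1, rule m) | (rule c, rule disjI2, rule disjI1, rule m) |
        (rule c, rule disjI2, rule disjI2, rule m)))
  then have eq: "M $ i $ j * M $ p $ q = M $ i $ q * M $ p $ j" for i j by blast
  have "M $ i $ j = M $ i $ q * (M $ p $ j / M $ p $ q)" for i j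
    unfolding times_divide_eq_right eq[symmetric] using pq by (rule nonzero_mult_div_cancel_right[symmetric])
  then have "M = outer (\<lambda>i. M $ i $ q) (\<lambda>j. M $ p $ j / M $ p $ q)"
    unfolding vec_eq_iff outer_def vec_lambda_beta by blast
  then show thesis by (rule that)
qed

lemma det_diff_outer: "det (outer p r - outer q s) = 0"
  by (simp add: det_3 outer_def) (simp add: algebra_simps)

lemma mult_outer: "M ** outer u v = outer (\<lambda>i. \<Sum>k\<in>UNIV. M $ i $ k * u k) v"
  "outer u v ** M = outer u (\<lambda>j. \<Sum>k\<in>UNIV. v k * M $ k $ j)"
  by (simp_all add: mat3_simps outer_def algebra_simps)

text \<open>The adjugate of a singular matrix has rank at most one, so \<open>comm3\<close> is a
  difference of two matrices of rank at most one. This is what makes the numerator divisible by det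
  X.\<close>

lemma det_comm3_singular:
  assumes "det X = 0"
  shows "det (comm3 X Y Z) = 0"
proof -
  have "adj3 (adj3 X) = 0" using assms by (simp add: adj3_adj3 msc_def vec_eq_iff)
  then obtain u v where "adj3 X = outer u v" by (rule rank_one_if_adj3_eq_0)
  then show ?thesis by (simp add: comm3_def mult_outer det_diff_outer)
qed

lemma comm3_mult: "comm3 (H ** X ** K) (H ** Y ** K) (H ** Z ** K) = msc (det H * det K) (H ** comm3 X Y Z ** K)"
proof -
  have "H ** Y ** K ** adj3 (H ** X ** K) ** (H ** Z ** K) = msc (det H * det K) (H ** (Y ** adj3 X ** Z) ** K)"
    for Y Z
  proof -
    have "H ** Y ** K ** adj3 (H ** X ** K) ** (H ** Z ** K) =
        H ** Y ** (K ** adj3 K) ** adj3 X ** (adj3 H ** H) ** Z ** K"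
      by (simp add: adj3_mult matrix_mul_assoc)
    also have "\<dots> = msc (det H * det K) (H ** (Y ** adj3 X ** Z) ** K)"
      unfolding adj3_right adj3_left by (simp add: mat_mult msc_mult msc_msc matrix_mul_assoc mult.commute)
    finally show ?thesis .
  qed
  then show ?thesis
    unfolding comm3_def
    by (simp add: msc_diff[symmetric] mat3_distrib)
qed

lemma det_comm3_mult:
  "det (comm3 (H ** X ** K) (H ** Y ** K) (H ** Z ** K)) = (det H * det K) ^ 4 * det (comm3 X Y Z)"
  by (simp add: comm3_mult det_msc det_mul power_mult_distrib algebra_simps eval_nat_numeral)

lemma comm3_shear:
  "comm3 X (Y + msc r X) Z = comm3 X Y Z" "comm3 X Y (Z + msc r X) = comm3 X Y Z"
  "comm3 X (Y + msc r Z) Z = comm3 X Y Z" "comm3 X Y (Z + msc r Y) = comm3 X Y Z"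
proof -
  have *: "msc r X ** adj3 X ** Z = Z ** adj3 X ** msc r X" for r X Z
  proof -
    have "msc r X ** adj3 X ** Z = msc r (X ** adj3 X ** Z)" by (simp add: msc_mult)
    also have "\<dots> = msc r (Z ** (adj3 X ** X))" by (simp add: adj3_right adj3_left mat_mult)
    finally show ?thesis by (simp add: msc_mult matrix_mul_assoc)
  qed
  show "comm3 X (Y + msc r X) Z = comm3 X Y Z" "comm3 X Y (Z + msc r X) = comm3 X Y Z"
    by (simp_all add: comm3_def mat3_distrib *)
  show "comm3 X (Y + msc r Z) Z = comm3 X Y Z" "comm3 X Y (Z + msc r Y) = comm3 X Y Z"
    by (simp_all add: comm3_def mat3_distrib msc_mult)
qed

lemma comm3_msc:
  "comm3 (msc r X) Y Z = msc (r ^ 2) (comm3 X Y Z)" "comm3 X (msc r Y) Z = msc r (comm3 X Y Z)"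
  "comm3 X Y (msc r Z) = msc r (comm3 X Y Z)"
  by (simp_all add: comm3_def adj3_msc msc_mult msc_diff)

lemma comm3_swap: "comm3 X Z Y = msc (- 1) (comm3 X Y Z)"
  by (simp add: comm3_def msc_diff) (simp add: msc_def vec_eq_iff)

text \<open>Multiplying \<open>comm3 X Y Z\<close> by X adj(Y) on the left and by adj(Y) X on the
  right gives a multiple of \<open>comm3 Y X Z\<close>. The common factor is kept, so that the
  identity holds for singular matrices too, and is cancelled later where both determinants are
  nonzero.\<close>

lemma det_comm3_swap:
  "det X ^ 2 * det Y ^ 3 * (det Y * det (comm3 X Y Z)) = - (det X ^ 2 * det Y ^ 3 * (det X * det (comm3 Y X Z)))"
proof -
  have 1: "X ** adj3 Y ** (Y ** adj3 X ** Z) ** adj3 Y ** X = msc (det X * det Y) (Z ** adj3 Y ** X)"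
  proof -
    have "X ** adj3 Y ** (Y ** adj3 X ** Z) ** adj3 Y ** X = X ** (adj3 Y ** Y) ** adj3 X ** Z ** adj3 Y ** X"
      by (simp add: matrix_mul_assoc)
    then show ?thesis
      unfolding adj3_left by (simp add: mat_mult msc_mult msc_msc adj3_right mult.commute)
  qed
  have 2: "X ** adj3 Y ** (Z ** adj3 X ** Y) ** adj3 Y ** X = msc (det X * det Y) (X ** adj3 Y ** Z)"
  proof -
    have "X ** adj3 Y ** (Z ** adj3 X ** Y) ** adj3 Y ** X = X ** adj3 Y ** Z ** adj3 X ** (Y ** adj3 Y) ** X"
      by (simp add: matrix_mul_assoc)
    also have "\<dots> = msc (det Y) (X ** adj3 Y ** Z ** (adj3 X ** X))"
      unfolding adj3_right by (simp add: mat_mult msc_mult matrix_mul_assoc)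
    finally show ?thesis
      unfolding adj3_left by (simp add: mat_mult msc_msc mult.commute)
  qed
  have "X ** adj3 Y ** comm3 X Y Z ** adj3 Y ** X = msc (- det X * det Y) (comm3 Y X Z)"
  proof -
    have "X ** adj3 Y ** comm3 X Y Z ** adj3 Y ** X =
        msc (det X * det Y) (Z ** adj3 Y ** X) - msc (det X * det Y) (X ** adj3 Y ** Z)"
      unfolding 1[symmetric] 2[symmetric] comm3_def by (simp add: mat3_distrib)
    then show ?thesis by (simp add: comm3_def) (simp add: msc_def vec_eq_iff algebra_simps)
  qed
  from arg_cong[OF this, of det] show ?thesis
    by (simp add: det_mul det_adj3 det_msc power_mult_distrib) (simp add: algebra_simps eval_nat_numeral)
qed

text \<open>The diagonal of \<open>comm3\<close> is 0, so its determinant is the sum over the two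
  3-cycles. The adjugate contributes equal products to both, and the antisymmetric factors y_i z_j -
  z_i y_j contribute opposite ones.\<close>

lemma det_comm3_diag_outer: "det (comm3 (dg x + msc k (outer u v)) (dg y) (dg z)) = 0"
proof -
  let ?X = "dg x + msc k (outer u v)"
  have entry: "comm3 ?X (dg y) (dg z) $ i $ j = adj3 ?X $ i $ j * (y i * z j - z i * y j)" for i j
    by (simp add: comm3_def matrix_matrix_mult_def dg_def if_distrib[of "\<lambda>x. x * _"] if_distrib[of "\<lambda>x. _ * x"]
        algebra_simps cong: if_cong)
  have "adj3 ?X $ 1 $ 2 = - k * u 1 * v 2 * x 3" "adj3 ?X $ 2 $ 3 = - k * u 2 * v 3 * x 1"
    "adj3 ?X $ 3 $ 1 = - k * u 3 * v 1 * x 2" "adj3 ?X $ 1 $ 3 = - k * u 1 * v 3 * x 2"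
    "adj3 ?X $ 3 $ 2 = - k * u 3 * v 2 * x 1" "adj3 ?X $ 2 $ 1 = - k * u 2 * v 1 * x 3"
    by (simp_all add: adj3_def vector_3 dg_def msc_def outer_def algebra_simps)
  then show ?thesis
    by (simp add: det_3 entry) (simp add: algebra_simps)
qed

text \<open>The entry of \<open>comm3\<close> at (i, j) is x_k (y_i x_j - y_j x_i) z_ij, with k the
  third index. Again only the two 3-cycles contribute, and the antisymmetric minors put the minus
  sign between them.\<close>

lemma det_comm3_diag:
  "det (comm3 (dg x) (dg y) Z) = x 1 * x 2 * x 3 *
    ((y 1 * x 2 - y 2 * x 1) * (y 2 * x 3 - y 3 * x 2) * (y 3 * x 1 - y 1 * x 3) *
     (Z$1$2 * Z$2$3 * Z$3$1 - Z$1$3 * Z$3$2 * Z$2$1))"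
proof -
  have "adj3 (dg x) = dg (\<lambda>i. if i = 1 then x 2 * x 3 else if i = 2 then x 1 * x 3 else x 1 * x 2)"
    by (simp add: mat3_simps adj3_def dg_def mult.commute)
  then show ?thesis
    by (simp add: comm3_def det_3 matrix_matrix_mult_def sum_3 dg_def) (simp add: algebra_simps)
qed

lemma det_dg: "det (dg x) = x 1 * x 2 * x 3"
  by (simp add: dg_def det_3)

text \<open>Discriminant of the cubic \<open>det (msc t X - Y)\<close> in \<open>t\<close>. For
  invertible X it detects whether X^-1 Y has distinct eigenvalues, and it is polynomial in the
  entries of X and Y.\<close>

definition disc3 :: "mat3 \<Rightarrow> mat3 \<Rightarrow> complex" where
  "disc3 X Y = (let p = det X; q = - (\<Sum>i\<in>UNIV. (adj3 X ** Y) $ i $ i);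
     r = (\<Sum>i\<in>UNIV. (X ** adj3 Y) $ i $ i); s = - det Y
   in q^2 * r^2 - 4 * p * r^3 - 4 * q^3 * s - 27 * p^2 * s^2 + 18 * p * q * r * s)"

lemma det_pencil: "det (msc t X - Y) = t ^ 3 * det X - t ^ 2 * (\<Sum>i\<in>UNIV. (adj3 X ** Y) $ i $ i) +
    t * (\<Sum>i\<in>UNIV. (X ** adj3 Y) $ i $ i) - det Y"
  by (simp add: det_3 sum_3 matrix_matrix_mult_def adj3_def vector_3 msc_def)
    (simp add: algebra_simps power2_eq_square power3_eq_cube)

lemma cubic_roots:
  fixes p :: complex
  assumes "p \<noteq> 0" "q^2 * r^2 - 4 * p * r^3 - 4 * q^3 * s - 27 * p^2 * s^2 + 18 * p * q * r * s \<noteq> 0"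
  obtains t where "\<And>i::3. p * t i ^ 3 + q * t i ^ 2 + r * t i + s = 0" "t 1 \<noteq> t 2" "t 2 \<noteq> t 3" "t 1 \<noteq> t 3"
proof -
  define P where "P = [:s, r, q, p:]"
  have deg: "degree P = 3" and lc: "coeff P 3 = p" using assms(1) by (simp_all add: P_def eval_nat_numeral)
  obtain root where "smult (lead_coeff P) (\<Prod>i<degree P. [:- root i, 1:]) = P"
    by (rule complex_poly_decompose')
  then have "smult p (\<Prod>i<3. [:- root i, 1:]) = P"
    unfolding deg lc .
  then have "P = smult p ([:- root 0, 1:] * [:- root 1, 1:] * [:- root 2, 1:])"
    by (simp add: eval_nat_numeral)
  then have c: "q = - p * (root 0 + root 1 + root 2)" "r = p * (root 0 * root 1 + root 0 * root 2 + root 1 * root 2)"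
    "s = - p * root 0 * root 1 * root 2"
    unfolding P_def by (simp_all add: algebra_simps)
  have "q^2 * r^2 - 4 * p * r^3 - 4 * q^3 * s - 27 * p^2 * s^2 + 18 * p * q * r * s =
      p ^ 4 * ((root 0 - root 1) * (root 1 - root 2) * (root 0 - root 2)) ^ 2"
    unfolding c by algebra
  then have "root 0 \<noteq> root 1" "root 1 \<noteq> root 2" "root 0 \<noteq> root 2" using assms(2) by auto
  moreover have "p * x ^ 3 + q * x ^ 2 + r * x + s = p * (x - root 0) * (x - root 1) * (x - root 2)" for x
    unfolding c by algebra
  ultimately show thesis
    by (intro that[of "\<lambda>i. if i = 1 then root 0 else if i = 2 then root 1 else root 2"]) auto
qed

text \<open>The roots of the pencil give vectors with Y v = t X v. They are the columns of
  \<open>K\<close>, and \<open>H\<close> is the inverse of \<open>X ** K\<close>.\<close>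

lemma simultaneous_diagonalization:
  assumes X: "det X \<noteq> 0" and disc: "disc3 X Y \<noteq> 0"
  obtains H K y where "det H \<noteq> 0" "det K \<noteq> 0" "H ** X ** K = mat 1" "H ** Y ** K = dg y"
    "y 1 \<noteq> y 2" "y 2 \<noteq> y 3" "y 1 \<noteq> y 3"
proof -
  obtain t where t: "\<And>i::3. det X * t i ^ 3 + - (\<Sum>i\<in>UNIV. (adj3 X ** Y) $ i $ i) * t i ^ 2 +
      (\<Sum>i\<in>UNIV. (X ** adj3 Y) $ i $ i) * t i + - det Y = 0" "t 1 \<noteq> t 2" "t 2 \<noteq> t 3" "t 1 \<noteq> t 3"
    by (rule cubic_roots[OF X disc[unfolded disc3_def Let_def]]) (rule that)
  have "det (msc (t i) X - Y) = 0" for i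
    using t(1)[of i] unfolding det_pencil by (simp add: algebra_simps)
  then have "\<exists>v. v \<noteq> 0 \<and> (msc (t i) X - Y) *v v = 0" for i
    using invertible_det_nz[of "msc (t i) X - Y"]
    unfolding invertible_left_inverse matrix_left_invertible_ker by blast
  then obtain v where v: "\<And>i. v i \<noteq> 0" "\<And>i. (msc (t i) X - Y) *v v i = 0" by metis
  have vX: "Y *v v i = t i *s (X *v v i)" for i
  proof -
    have "(msc (t i) X - Y) *v v i = t i *s (X *v v i) - Y *v v i"
      by (simp add: matrix_vector_mult_def msc_def vec_eq_iff sum_3 algebra_simps)
    then show ?thesis using v(2)[of i] by simp
  qed
  define K where "K = (\<chi> i j. v j $ i)"
  have Kv: "K *v w = w $ 1 *s v 1 + w $ 2 *s v 2 + w $ 3 *s v 3" for w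
    by (simp add: K_def matrix_vector_mult_def vec_eq_iff sum_3 algebra_simps)
  have X_inj: "w = 0" if "X *v w = 0" for w
    using X that invertible_det_nz[of X]
    unfolding invertible_left_inverse matrix_left_invertible_ker by blast
  have step: "(r 1 * t 1) *s v 1 + (r 2 * t 2) *s v 2 + (r 3 * t 3) *s v 3 = 0"
    if "r 1 *s v 1 + r 2 *s v 2 + r 3 *s v 3 = 0" for r :: "3 \<Rightarrow> complex"
  proof (rule X_inj)
    have "Y *v (r 1 *s v 1 + r 2 *s v 2 + r 3 *s v 3) = 0" by (simp add: that)
    then show "X *v ((r 1 * t 1) *s v 1 + (r 2 * t 2) *s v 2 + (r 3 * t 3) *s v 3) = 0"
      by (simp add: matrix_vector_right_distrib vector_scalar_commute vX vec_eq_iff algebra_simps)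
  qed
  have "det K \<noteq> 0"
  proof -
    have "w = 0" if w: "K *v w = 0" for w
    proof -
      have s0: "w $ 1 *s v 1 + w $ 2 *s v 2 + w $ 3 *s v 3 = 0" using w by (simp add: Kv)
      from step[of "\<lambda>i. w $ i", OF s0]
      have s1: "(w $ 1 * t 1) *s v 1 + (w $ 2 * t 2) *s v 2 + (w $ 3 * t 3) *s v 3 = 0" .
      from step[of "\<lambda>i. w $ i * t i", OF s1]
      have s2: "(w $ 1 * t 1 * t 1) *s v 1 + (w $ 2 * t 2 * t 2) *s v 2 + (w $ 3 * t 3 * t 3) *s v 3 = 0" .
      have z: "w $ 1 * v 1 $ k = 0 \<and> w $ 2 * v 2 $ k = 0 \<and> w $ 3 * v 3 $ k = 0" for k
      proof -
        have e: "w $ 1 * v 1 $ k + w $ 2 * v 2 $ k + w $ 3 * v 3 $ k = 0"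
          "w $ 1 * t 1 * v 1 $ k + w $ 2 * t 2 * v 2 $ k + w $ 3 * t 3 * v 3 $ k = 0"
          "w $ 1 * t 1 * t 1 * v 1 $ k + w $ 2 * t 2 * t 2 * v 2 $ k + w $ 3 * t 3 * t 3 * v 3 $ k = 0"
          using s0 s1 s2 by (simp_all add: vec_eq_iff)
        \<comment> \<open>Elimination in the Vandermonde system of the three relations.\<close>
        have "(t 1 - t 2) * (t 1 - t 3) * (w $ 1 * v 1 $ k) = 0" "(t 2 - t 1) * (t 2 - t 3) * (w $ 2 * v 2 $ k) = 0"
          "(t 3 - t 1) * (t 3 - t 2) * (w $ 3 * v 3 $ k) = 0"
          using e by algebra+
        then show ?thesis using t(2-4) by auto
      qed
      have "w $ i = 0" for i
      proof -
        obtain k where "v i $ k \<noteq> 0" using v(1)[of i] by (auto simp: vec_eq_iff)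
        then show ?thesis using z[of k] exhaust_3[of i] by auto
      qed
      then show ?thesis by (simp add: vec_eq_iff)
    qed
    then show ?thesis
      using invertible_det_nz[of K] unfolding invertible_left_inverse matrix_left_invertible_ker by blast
  qed
  then have "det (X ** K) \<noteq> 0" using X by (simp add: det_mul)
  then obtain H where H: "H ** (X ** K) = mat 1" 
    using invertible_det_nz[of "X ** K"] unfolding invertible_def by blast
  have "det H \<noteq> 0"
    using arg_cong[OF H, of det] by (auto simp: det_mul)
  have YK: "Y ** K = X ** K ** dg t"
  proof -
    have "(Y ** K) $ i $ j = (Y *v v j) $ i" "(X ** K ** dg t) $ i $ j = t j * (X *v v j) $ i" for i j
      by (simp_all add: matrix_matrix_mult_def matrix_vector_mult_def K_def dg_def
          if_distrib[of "\<lambda>x. _ * x"] if_distrib[of "\<lambda>x. x * _"] mult.commute cong: if_cong)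
    then show ?thesis using vX by (simp add: vec_eq_iff)
  qed
  have "H ** Y ** K = H ** (X ** K) ** dg t"
    using YK by (simp add: matrix_mul_assoc[symmetric])
  then have "H ** Y ** K = dg t" unfolding H by (simp add: mat_mult msc_def vec_eq_iff)
  moreover have "H ** X ** K = mat 1" using H by (simp add: matrix_mul_assoc)
  ultimately show thesis using that[of H K t] \<open>det H \<noteq> 0\<close> \<open>det K \<noteq> 0\<close> t by blast
qed

section \<open>Strassen's equation\<close>

definition poly_fun :: "(complex \<Rightarrow> complex) \<Rightarrow> bool" where
  "poly_fun g \<longleftrightarrow> (\<exists>p. \<forall>t. g t = poly p t)"

lemma poly_fun_const: "poly_fun (\<lambda>t. r)"
  unfolding poly_fun_def by (rule exI[of _ "[:r:]"]) simp

lemma poly_fun_cmult: "poly_fun g \<Longrightarrow> poly_fun (\<lambda>t. r * g t)"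
  unfolding poly_fun_def by (metis poly_smult)

lemma poly_fun_mult: "poly_fun g \<Longrightarrow> poly_fun k \<Longrightarrow> poly_fun (\<lambda>t. g t * k t)"
  unfolding poly_fun_def by (metis poly_mult)

lemma poly_fun_power: "poly_fun g \<Longrightarrow> poly_fun (\<lambda>t. g t ^ n)"
  unfolding poly_fun_def by (metis poly_power)

lemma poly_fun_eq:
  assumes "poly_fun g" "poly_fun k" "finite S" "\<And>t. t \<notin> S \<Longrightarrow> g t = k t"
  shows "g 0 = k 0"
proof -
  obtain p q where p: "\<And>t. g t = poly p t" and q: "\<And>t. k t = poly q t"
    using assms unfolding poly_fun_def by metis
  have "p - q = 0"
  proof (rule ccontr)
    assume "p - q \<noteq> 0"
    then have "finite {t. poly (p - q) t = 0}" by (rule poly_roots_finite)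
    moreover have "- S \<subseteq> {t. poly (p - q) t = 0}" using assms(4) p q by auto
    ultimately have "finite (- S)" by (rule finite_subset[rotated])
    then show False using assms(3) infinite_UNIV_char_0[where 'a = complex] by (simp add: finite_compl)
  qed
  then show ?thesis by (simp add: p q)
qed

lemma poly_fun_det_shift: "poly_fun (\<lambda>t. det (A + mat t :: mat3))"
proof -
  have "det (A + mat t) = poly [:det A, (\<Sum>i\<in>UNIV. adj3 A $ i $ i), (\<Sum>i\<in>UNIV. A $ i $ i), 1:] t" for t
    by (simp add: det_3 mat_def sum_3 adj3_def vector_3) (simp add: algebra_simps)
  then show ?thesis unfolding poly_fun_def by blast
qed

text \<open>Points with a = d = 0 are limits of points with nonzero products: for nonzero b, c, e, f
  the line a = t e f, d = t b c stays on the hypersurface. Afterwards these four coordinates are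
  shifted away from 0.\<close>

lemma binomial_zero_aux:
  assumes line: "\<And>a a' b b' c c' d d' e e' f f'.
      poly_fun (\<lambda>t. g (a + t * a') (b + t * b') (c + t * c') (d + t * d') (e + t * e') (f + t * f'))"
    and zero: "\<And>a b c d e f. a * b * c = d * e * f \<Longrightarrow> a * b * c \<noteq> 0 \<Longrightarrow> g a b c d e f = 0"
  shows "g 0 b c 0 e f = (0 :: complex)"
proof -
  have 1: "g 0 b c 0 e f = 0" if nz: "b \<noteq> 0" "c \<noteq> 0" "e \<noteq> 0" "f \<noteq> 0" for b c e f
    using poly_fun_eq[OF line[of 0 "e * f" b 0 c 0 0 "b * c" e 0 f 0] poly_fun_const[of 0], of "{0}"] nz
    by (simp add: zero)
  show ?thesis
    using poly_fun_eq[OF line[of 0 0 b 1 c 1 0 0 e 1 f 1] poly_fun_const[of 0], of "{- b, - c, - e, - f}"]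
    by (simp add: 1 add_eq_0_iff)
qed

text \<open>If the products vanish, a factor on each side is 0, and renaming the variables brings
  all nine cases to a = d = 0.\<close>

lemma binomial_zero:
  assumes line: "\<And>a a' b b' c c' d d' e e' f f'.
      poly_fun (\<lambda>t. g (a + t * a') (b + t * b') (c + t * c') (d + t * d') (e + t * e') (f + t * f'))"
    and zero: "\<And>a b c d e f. a * b * c = d * e * f \<Longrightarrow> a * b * c \<noteq> 0 \<Longrightarrow> g a b c d e f = 0"
    and eq: "a * b * c = d * e * f"
  shows "g a b c d e f = (0 :: complex)"
proof (cases "a * b * c = 0")
  case True
  then have "a = 0 \<or> b = 0 \<or> c = 0" "d = 0 \<or> e = 0 \<or> f = 0" using eq by auto
  then consider "a = 0" "d = 0" | "a = 0" "e = 0" | "a = 0" "f = 0" | "b = 0" "d = 0" | "b = 0" "e = 0"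
    | "b = 0" "f = 0" | "c = 0" "d = 0" | "c = 0" "e = 0" | "c = 0" "f = 0" by blast
  then show ?thesis
  proof cases
    case 1
    show ?thesis unfolding 1 by (rule binomial_zero_aux[of g]) (rule line, rule zero, simp_all)
  next
    case 2
    show ?thesis unfolding 2
      by (rule binomial_zero_aux[of "\<lambda>a b c e d f. g a b c d e f"]) (rule line, rule zero, simp_all add: ac_simps)
  next
    case 3
    show ?thesis unfolding 3
      by (rule binomial_zero_aux[of "\<lambda>a b c f e d. g a b c d e f"]) (rule line, rule zero, simp_all add: ac_simps)
  next
    case 4
    show ?thesis unfolding 4
      by (rule binomial_zero_aux[of "\<lambda>b a c d e f. g a b c d e f"]) (rule line, rule zero, simp_all add: ac_simps)
  next
    case 5
    show ?thesis unfolding 5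
      by (rule binomial_zero_aux[of "\<lambda>b a c e d f. g a b c d e f"]) (rule line, rule zero, simp_all add: ac_simps)
  next
    case 6
    show ?thesis unfolding 6
      by (rule binomial_zero_aux[of "\<lambda>b a c f e d. g a b c d e f"]) (rule line, rule zero, simp_all add: ac_simps)
  next
    case 7
    show ?thesis unfolding 7
      by (rule binomial_zero_aux[of "\<lambda>c b a d e f. g a b c d e f"]) (rule line, rule zero, simp_all add: ac_simps)
  next
    case 8
    show ?thesis unfolding 8
      by (rule binomial_zero_aux[of "\<lambda>c b a e d f. g a b c d e f"]) (rule line, rule zero, simp_all add: ac_simps)
  next
    case 9
    show ?thesis unfolding 9
      by (rule binomial_zero_aux[of "\<lambda>c b a f e d. g a b c d e f"]) (rule line, rule zero, simp_all add: ac_simps)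
  qed
qed (use zero eq in blast)

text \<open>The off-diagonal entries are listed as the two 3-cycles 12, 23, 31 and 13, 32, 21, the
  two sides of the binomial equation.\<close>

definition zmat :: "(3 \<Rightarrow> complex) \<Rightarrow> complex \<Rightarrow> complex \<Rightarrow> complex \<Rightarrow> complex \<Rightarrow> complex \<Rightarrow> complex \<Rightarrow> mat3" where
  "zmat x z12 z23 z31 z13 z32 z21 =
    vector [vector [x 1, z12, z13], vector [z21, x 2, z23], vector [z31, z32, x 3]]"

lemma disc3_diag_cyclic:
  "disc3 (dg x) (zmat y z12 z23 z31 0 0 0) =
    (let p = x 1 * x 2 * x 3; q = - (x 2 * x 3 * y 1 + x 1 * x 3 * y 2 + x 1 * x 2 * y 3);
       r = x 1 * y 2 * y 3 + x 2 * y 1 * y 3 + x 3 * y 1 * y 2; s = - (y 1 * y 2 * y 3 + z12 * z23 * z31)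
     in q^2 * r^2 - 4 * p * r^3 - 4 * q^3 * s - 27 * p^2 * s^2 + 18 * p * q * r * s)"
proof -
  have "(\<Sum>i\<in>UNIV. (adj3 (dg x) ** zmat y z12 z23 z31 0 0 0) $ i $ i) = x 2 * x 3 * y 1 + x 1 * x 3 * y 2 + x 1 * x 2 * y 3"
    "(\<Sum>i\<in>UNIV. (dg x ** adj3 (zmat y z12 z23 z31 0 0 0)) $ i $ i) = x 1 * y 2 * y 3 + x 2 * y 1 * y 3 + x 3 * y 1 * y 2"
    "det (zmat y z12 z23 z31 0 0 0) = y 1 * y 2 * y 3 + z12 * z23 * z31"
    by (simp_all add: sum_3 matrix_matrix_mult_def adj3_def dg_def zmat_def vector_3 det_3 algebra_simps)
  then show ?thesis by (simp only: disc3_def det_dg)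
qed

definition poly_mat_on where
  "poly_mat_on V d M \<longleftrightarrow> (\<forall>j k. poly_on V d (\<lambda>T. (M T :: mat3) $ j $ k))"

lemma poly_mat_on_mult: "poly_mat_on V i M \<Longrightarrow> poly_mat_on V j N \<Longrightarrow> i + j = d \<Longrightarrow> poly_mat_on V d (\<lambda>T. M T ** N T)"
  unfolding poly_mat_on_def matrix_matrix_mult_def by (auto intro!: poly_on_sum poly_on_mult)

lemma poly_mat_on_diff: "poly_mat_on V d M \<Longrightarrow> poly_mat_on V d N \<Longrightarrow> poly_mat_on V d (\<lambda>T. M T - N T)"
  unfolding poly_mat_on_def by (auto intro!: poly_on_diff)

lemma poly_mat_on_adj3:
  assumes "poly_mat_on V i M" "d = 2 * i"
  shows "poly_mat_on V d (\<lambda>T. adj3 (M T))"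
proof -
  have m: "poly_on V i (\<lambda>T. M T $ j $ k)" for j k using assms by (simp add: poly_mat_on_def)
  have "poly_on V d (\<lambda>T. M T $ j $ k * M T $ l $ m)" for j k l m
    by (rule poly_on_mult[OF m m]) (use assms in simp)
  then show ?thesis
    unfolding poly_mat_on_def forall_3 adj3_def vector_3 by (intro conjI poly_on_diff)
qed

lemma poly_on_det:
  assumes "poly_mat_on V i M" "d = 3 * i"
  shows "poly_on V d (\<lambda>T. det (M T))"
proof -
  have m: "poly_on V i (\<lambda>T. M T $ j $ k)" for j k using assms by (simp add: poly_mat_on_def)
  have "poly_on V d (\<lambda>T. M T $ j $ k * M T $ l $ m * M T $ n $ r)" for j k l m n r
    by (rule poly_on_mult[OF poly_on_mult[OF m m refl] m]) (use assms in simp)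
  then show ?thesis unfolding det_3 by (intro poly_on_add poly_on_diff)
qed

lemma (in coord3) mat_of_lin_of: "mat_of (lin_of M) = M"
  by (simp add: vec_eq_iff mat_of_def a_lin_of a_e if_distrib[of "\<lambda>x. _ * x"] cong: if_cong)

lemma (in coord3) det_mat_of:
  assumes "g \<in> GL sA"
  shows "det (mat_of g) \<noteq> 0"
proof -
  have g: "Vector_Spaces.linear sA sA g" "bij g" using assms by (auto simp: GL_def)
  interpret g: Vector_Spaces.linear sA sA g by (rule g(1))
  have gi: "g (inv g y) = y" for y using g(2) by (simp add: bij_is_surj surj_f_inv_f)
  have gi': "inv g (g y) = y" for y using g(2) by (simp add: bij_is_inj)
  have "Vector_Spaces.linear sA sA (inv g)"
    unfolding Vector_Spaces.linear_iff using vs gi gi' g.add g.scale by metis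
  then have *: "lin_of (mat_of g ** mat_of (inv g)) x = x" for x
    by (simp add: lin_of_mult lin_of_mat_of g(1) gi)
  have 1: "mat_of (lin_of N) = mat 1" if "\<And>x. lin_of N x = x" for N
    by (simp add: mat_of_def that a_e mat_def)
  have "mat_of g ** mat_of (inv g) = mat_of (lin_of (mat_of g ** mat_of (inv g)))"
    by (simp only: mat_of_lin_of)
  also have "\<dots> = mat 1" by (rule 1) (rule *)
  finally have "mat_of g ** mat_of (inv g) = mat 1" .
  from arg_cong[OF this, of det] show ?thesis by (auto simp: det_mul)
qed

section \<open>Strassen's polynomial, its invariance and its divisibility property\<close>

context three_coord3
begin

definition slice :: "('a \<times> 'b \<times> 'c \<Rightarrow> complex) \<Rightarrow> 'a \<Rightarrow> mat3" where
  "slice T x = (\<chi> j k. T (x, f j, h k))"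

definition ten3 :: "mat3 \<Rightarrow> mat3 \<Rightarrow> mat3 \<Rightarrow> 'a \<times> 'b \<times> 'c \<Rightarrow> complex" where
  "ten3 L Y Z = ten (\<lambda>i j k. (if i = 1 then L else if i = 2 then Y else Z) $ j $ k)"

lemma ten3_in_V [simp]: "ten3 L Y Z \<in> V"
  by (simp add: ten3_def ten_in_V)

lemma ten3_basis: "ten3 L Y Z (e i, f j, h k) = (if i = 1 then L else if i = 2 then Y else Z) $ j $ k"
  by (simp add: ten3_def)

lemma slice_ten3 [simp]: "slice (ten3 L Y Z) (e 1) = L" "slice (ten3 L Y Z) (e 2) = Y" "slice (ten3 L Y Z) (e 3) = Z"
  by (simp_all add: slice_def ten3_basis vec_eq_iff)

lemma ten3_eqI:
  assumes "T \<in> V" "slice T (e 1) = L" "slice T (e 2) = Y" "slice T (e 3) = Z"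
  shows "T = ten3 L Y Z"
proof (rule V_eqI[OF assms(1) ten3_in_V])
  fix i j k
  have "T (e i, f j, h k) = slice T (e i) $ j $ k" by (simp add: slice_def)
  then show "T (e i, f j, h k) = ten3 L Y Z (e i, f j, h k)"
    using exhaust_3[of i] assms(2-4) by (auto simp: ten3_basis)
qed

lemma ten3_slice: "T \<in> V \<Longrightarrow> T = ten3 (slice T (e 1)) (slice T (e 2)) (slice T (e 3))"
  by (rule ten3_eqI) auto

lemma ten3_line: "ten3 L Y Z + fscale t (ten3 X' Y' Z') = ten3 (L + msc t X') (Y + msc t Y') (Z + msc t Z')"
  by (rule ten3_eqI[OF V_add[OF ten3_in_V V_fscale[OF ten3_in_V]]])
    (simp_all add: slice_def ten3_basis fscale_def msc_def vec_eq_iff)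

lemma poly_mat_on_slice: "poly_mat_on V 1 (\<lambda>T. slice T x)"
  by (simp add: poly_mat_on_def slice_def poly_on_eval[simplified])

lemma poly_on_strassen_num: "poly_on V 12 (\<lambda>T. det (comm3 (slice T (e 1)) (slice T (e 2)) (slice T (e 3))))"
proof -
  note sl = poly_mat_on_slice
  have "poly_mat_on V 4 (\<lambda>T. slice T y ** adj3 (slice T x) ** slice T z)" for x y z
    by (rule poly_mat_on_mult[OF poly_mat_on_mult[OF sl poly_mat_on_adj3[OF sl refl] refl] sl]) simp
  then show ?thesis
    unfolding comm3_def by (intro poly_on_det[of V 4] poly_mat_on_diff) simp_all
qed

text \<open>The division theorem applies with divisor det X, since the numerator vanishes where det
  X does. The auxiliary polynomial is the constant 1, and on the chosen line det X has the roots 0,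
  1, 2.\<close>

lemma strassen_exists:
  "\<exists>F. F \<in> hom_poly V 9 \<and> (\<forall>T\<in>V. det (slice T (e 1)) * F T = det (comm3 (slice T (e 1)) (slice T (e 2)) (slice T (e 3))))"
proof -
  define D where "D T = (if T \<in> V then det (slice T (e 1)) else 0)" for T
  define Q where "Q T = (if T \<in> V then det (comm3 (slice T (e 1)) (slice T (e 2)) (slice T (e 3))) else 0)" for T
  define O1 where "O1 T = (if T \<in> V then 1 else 0 :: complex)" for T
  have "poly_on V 3 (\<lambda>T. det (slice T (e 1)))" by (rule poly_on_det[OF poly_mat_on_slice]) simp
  then have D: "D \<in> hom_poly V 3" by (simp add: poly_on_def D_def[abs_def])
  have Q: "Q \<in> hom_poly V 12"
    using poly_on_strassen_num by (simp add: poly_on_def Q_def[abs_def])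
  have O1: "O1 \<in> hom_poly V 0" unfolding O1_def by (rule hom_poly_const)
  define U where "U = ten3 (mat 1) 0 0"
  define T where "T = ten3 (dg (\<lambda>i. if i = 1 then 0 else if i = 2 then - 1 else - 2)) 0 0"
  have line: "T + fscale s U = ten3 (dg (\<lambda>i. if i = 1 then s else if i = 2 then s - 1 else s - 2)) 0 0" for s
    unfolding T_def U_def ten3_line
    by (rule arg_cong3[of _ _ _ _ _ _ ten3]) (simp_all add: vec_eq_iff dg_def mat_def msc_def)
  have UV: "U \<in> V" "T \<in> V" by (simp_all add: U_def T_def)
  have DU: "D U \<noteq> 0" by (simp add: D_def UV) (simp add: U_def)
  have S: "finite {0, 1, 2 :: complex}" "card {0, 1, 2 :: complex} = 3" by simp_all
  obtain k F where F: "F \<in> hom_poly V k" "Q = (\<lambda>v. D v * F v)" "Q \<noteq> 0 \<Longrightarrow> 3 + k = 12"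
  proof (rule hom_poly_divisible[OF subspace_V D Q O1 UV(1) DU UV(2) S])
    show "D (T + fscale s U) = 0" "O1 (T + fscale s U) \<noteq> 0" if "s \<in> {0, 1, 2}" for s
      unfolding line D_def O1_def using that by (auto simp: det_dg)
    show "Q v = 0" if "v \<in> V" "D v = 0" for v
      using that det_comm3_singular by (simp add: Q_def D_def)
  qed (rule that)
  \<comment> \<open>A nonzero value of the numerator fixes the degree of the quotient as 12 - 3 = 9;
    the zero polynomial would have every degree.\<close>
  have "Q (ten3 (dg (\<lambda>_. 1)) (dg (\<lambda>i. if i = 1 then 0 else if i = 2 then 1 else 2)) (zmat (\<lambda>_. 0) 1 1 1 0 0 0)) \<noteq> 0"
    by (simp add: Q_def det_comm3_diag zmat_def vector_3)
  then have "Q \<noteq> 0" by auto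
  with F have "F \<in> hom_poly V 9" by simp
  moreover have "\<forall>T\<in>V. det (slice T (e 1)) * F T = det (comm3 (slice T (e 1)) (slice T (e 2)) (slice T (e 3)))"
  proof
    fix T assume "T \<in> V"
    with fun_cong[OF F(2), of T] show "det (slice T (e 1)) * F T = det (comm3 (slice T (e 1)) (slice T (e 2)) (slice T (e 3)))"
      by (simp add: D_def Q_def)
  qed
  ultimately show ?thesis by blast
qed

definition strassen where
  "strassen = (SOME F. F \<in> hom_poly V 9 \<and>
     (\<forall>T\<in>V. det (slice T (e 1)) * F T = det (comm3 (slice T (e 1)) (slice T (e 2)) (slice T (e 3)))))"

lemma strassen_hom: "strassen \<in> hom_poly V 9"
  and strassen_eq: "T \<in> V \<Longrightarrow> det (slice T (e 1)) * strassen T = det (comm3 (slice T (e 1)) (slice T (e 2)) (slice T (e 3)))"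
  using someI_ex[OF strassen_exists] unfolding strassen_def by blast+

definition F3 :: "mat3 \<Rightarrow> mat3 \<Rightarrow> mat3 \<Rightarrow> complex" where
  "F3 L Y Z = strassen (ten3 L Y Z)"

lemma F3_div: "det L \<noteq> 0 \<Longrightarrow> F3 L Y Z = det (comm3 L Y Z) / det L"
  using strassen_eq[OF ten3_in_V, of L Y Z] by (simp add: F3_def field_simps)

lemma hom_poly_ten3_line:
  assumes "P \<in> hom_poly V d"
  shows "poly_fun (\<lambda>t. P (ten3 (L + msc t X') (Y + msc t Y') (Z + msc t Z')))"
proof -
  obtain p where "\<And>t. P (ten3 L Y Z + fscale t (ten3 X' Y' Z')) = poly p t"
    by (rule hom_poly_on_line[OF subspace_V ten3_in_V[of L Y Z] ten3_in_V[of X' Y' Z'] assms]) blast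
  then show ?thesis unfolding poly_fun_def ten3_line by blast
qed

lemma F3_line:
  assumes "\<And>t. A t = L + msc t X'" "\<And>t. B t = Y + msc t Y'" "\<And>t. C t = Z + msc t Z'"
  shows "poly_fun (\<lambda>t. F3 (A t) (B t) (C t))"
  unfolding F3_def assms by (rule hom_poly_ten3_line[OF strassen_hom])

text \<open>Identities for \<open>F3\<close> are checked for an invertible first slice, where
  \<open>F3\<close> is a quotient, and then extended along \<open>L + mat t\<close>.\<close>

lemma F3_density:
  assumes "poly_fun g" "poly_fun k" "\<And>t. det (L + mat t :: mat3) \<noteq> 0 \<Longrightarrow> g t = k t"
  shows "g 0 = k 0"
  by (rule poly_fun_eq[OF assms(1,2) finite_det_shift[of L]]) (use assms(3) in auto)

lemmas mat_line_simps = msc_def mat_def vec_eq_iff algebra_simps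

lemma msc_0 [simp]: "msc t 0 = 0" "msc 0 M = 0" "mat 0 = (0 :: mat3)"
  by (simp_all add: msc_def vec_eq_iff mat_def)

lemma F3_shift_line: "poly_fun (\<lambda>t. F3 (L + mat t) Y Z)"
  by (rule F3_line[of _ L "mat 1" _ Y 0 _ Z 0]) (simp_all add: mat_line_simps)

lemma F3_shear_YX: "F3 L (Y + msc r L) Z = F3 L Y Z"
proof -
  have l: "poly_fun (\<lambda>t. F3 (L + mat t) (Y + msc r (L + mat t)) Z)"
    by (rule F3_line[of _ L "mat 1" _ "Y + msc r L" "mat r" _ Z 0]) (simp_all add: mat_line_simps)
  have "F3 (L + mat 0) (Y + msc r (L + mat 0)) Z = F3 (L + mat 0) Y Z"
    by (rule F3_density[OF l F3_shift_line, of L]) (simp add: F3_div comm3_shear)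
  then show ?thesis by simp
qed

lemma F3_shear_ZX: "F3 L Y (Z + msc r L) = F3 L Y Z"
proof -
  have l: "poly_fun (\<lambda>t. F3 (L + mat t) Y (Z + msc r (L + mat t)))"
    by (rule F3_line[of _ L "mat 1" _ Y 0 _ "Z + msc r L" "mat r"]) (simp_all add: mat_line_simps)
  have "F3 (L + mat 0) Y (Z + msc r (L + mat 0)) = F3 (L + mat 0) Y Z"
    by (rule F3_density[OF l F3_shift_line, of L]) (simp add: F3_div comm3_shear)
  then show ?thesis by simp
qed

lemma F3_shear_YZ: "F3 L (Y + msc r Z) Z = F3 L Y Z"
  and F3_shear_ZY: "F3 L Y (Z + msc r Y) = F3 L Y Z"
  and F3_scale_Y: "F3 L (msc r Y) Z = r ^ 3 * F3 L Y Z"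
  and F3_scale_Z: "F3 L Y (msc r Z) = r ^ 3 * F3 L Y Z"
  and F3_swap_YZ: "F3 L Z Y = - 1 * F3 L Y Z"
proof -
  note l = F3_shift_line
  have "F3 (L + mat 0) (Y + msc r Z) Z = F3 (L + mat 0) Y Z"
    by (rule F3_density[OF l l, of L]) (simp add: F3_div comm3_shear)
  then show "F3 L (Y + msc r Z) Z = F3 L Y Z" by simp
  have "F3 (L + mat 0) Y (Z + msc r Y) = F3 (L + mat 0) Y Z"
    by (rule F3_density[OF l l, of L]) (simp add: F3_div comm3_shear)
  then show "F3 L Y (Z + msc r Y) = F3 L Y Z" by simp
  have "F3 (L + mat 0) (msc r Y) Z = r ^ 3 * F3 (L + mat 0) Y Z"
    by (rule F3_density[OF l poly_fun_cmult[OF l], of L]) (simp add: F3_div comm3_msc det_msc)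
  then show "F3 L (msc r Y) Z = r ^ 3 * F3 L Y Z" by simp
  have "F3 (L + mat 0) Y (msc r Z) = r ^ 3 * F3 (L + mat 0) Y Z"
    by (rule F3_density[OF l poly_fun_cmult[OF l], of L]) (simp add: F3_div comm3_msc det_msc)
  then show "F3 L Y (msc r Z) = r ^ 3 * F3 L Y Z" by simp
  have "F3 (L + mat 0) Z Y = - 1 * F3 (L + mat 0) Y Z"
    by (rule F3_density[OF l poly_fun_cmult[OF l], of L]) (simp add: F3_div comm3_swap[of _ Z Y] det_msc)
  then show "F3 L Z Y = - 1 * F3 L Y Z" by simp
qed

text \<open>\<open>comm3\<close> gains r^2 from the adjugate, its determinant r^6, and the division
  by the determinant of the first slice takes away r^3.\<close>

lemma F3_scale_X:
  assumes "r \<noteq> 0"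
  shows "F3 (msc r L) Y Z = r ^ 3 * F3 L Y Z"
proof -
  have "F3 (msc r (L + mat 0)) Y Z = r ^ 3 * F3 (L + mat 0) Y Z"
  proof (rule F3_density[of "\<lambda>t. F3 (msc r (L + mat t)) Y Z" "\<lambda>t. r ^ 3 * F3 (L + mat t) Y Z" L])
    show "poly_fun (\<lambda>t. F3 (msc r (L + mat t)) Y Z)"
      by (rule F3_line[of _ "msc r L" "mat r" _ Y 0 _ Z 0]) (simp_all add: mat_line_simps)
    show "poly_fun (\<lambda>t. r ^ 3 * F3 (L + mat t) Y Z)"
      by (intro poly_fun_cmult F3_shift_line)
    show "F3 (msc r (L + mat t)) Y Z = r ^ 3 * F3 (L + mat t) Y Z" if "det (L + mat t) \<noteq> 0" for t
      using that assms by (simp add: F3_div det_msc comm3_msc eval_nat_numeral)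
  qed
  then show ?thesis by simp
qed

lemma det_comm3_swap_nonzero:
  assumes "det L \<noteq> 0" "det Y \<noteq> 0"
  shows "det Y * det (comm3 L Y Z) = - (det L * det (comm3 Y L Z))"
proof (rule mult_left_cancel[THEN iffD1])
  show "det L ^ 2 * det Y ^ 3 \<noteq> 0" using assms by simp
  show "det L ^ 2 * det Y ^ 3 * (det Y * det (comm3 L Y Z)) = det L ^ 2 * det Y ^ 3 * - (det L * det (comm3 Y L Z))"
    using det_comm3_swap[of L Y Z] by (simp only: mult_minus_right)
qed

text \<open>The construction singles out the first slice. The symmetry becomes visible after both
  slices are shifted until they are invertible.\<close>

lemma F3_swap_XY: "F3 L Y Z = - 1 * F3 Y L Z"
proof -
  have "F3 (L + mat 0) (Y + mat 0) Z = - 1 * F3 (Y + mat 0) (L + mat 0) Z"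
  proof (rule poly_fun_eq[of "\<lambda>t. F3 (L + mat t) (Y + mat t) Z" "\<lambda>t. - 1 * F3 (Y + mat t) (L + mat t) Z"
        "{t. det (L + mat t) = 0} \<union> {t. det (Y + mat t) = 0}"])
    show "poly_fun (\<lambda>t. F3 (L + mat t) (Y + mat t) Z)"
      by (rule F3_line[of _ L "mat 1" _ Y "mat 1" _ Z 0]) (simp_all add: mat_line_simps)
    show "poly_fun (\<lambda>t. - 1 * F3 (Y + mat t) (L + mat t) Z)"
      by (intro poly_fun_cmult F3_line[of _ Y "mat 1" _ L "mat 1" _ Z 0]) (simp_all add: mat_line_simps)
    show "finite ({t. det (L + mat t) = 0} \<union> {t. det (Y + mat t) = 0})"
      by (simp add: finite_det_shift)
    show "F3 (L + mat t) (Y + mat t) Z = - 1 * F3 (Y + mat t) (L + mat t) Z"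
      if "t \<notin> {t. det (L + mat t) = 0} \<union> {t. det (Y + mat t) = 0}" for t
    proof -
      have nz: "det (L + mat t) \<noteq> 0" "det (Y + mat t) \<noteq> 0" using that by auto
      have "det (comm3 (L + mat t) (Y + mat t) Z) * det (Y + mat t) =
          (- det (comm3 (Y + mat t) (L + mat t) Z)) * det (L + mat t)"
        using det_comm3_swap_nonzero[OF nz, of Z] by (simp add: mult.commute)
      then have "det (comm3 (L + mat t) (Y + mat t) Z) / det (L + mat t) =
          (- det (comm3 (Y + mat t) (L + mat t) Z)) / det (Y + mat t)"
        by (simp only: frac_eq_eq[OF nz])
      with nz show ?thesis by (simp add: F3_div)
    qed
  qed
  then show ?thesis by simp
qed

lemma F3_shear_XY: "F3 (L + msc r Y) Y Z = F3 L Y Z"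
  by (subst F3_swap_XY, subst F3_shear_YX, subst F3_swap_XY) simp

lemma F3_shear_XZ: "F3 (L + msc r Z) Y Z = F3 L Y Z"
  by (subst F3_swap_YZ, subst F3_shear_XY, subst F3_swap_YZ) simp

lemma F3_equivariant_BC:
  assumes "det H \<noteq> 0" "det K \<noteq> 0"
  shows "F3 (H ** L ** K) (H ** Y ** K) (H ** Z ** K) = (det H * det K) ^ 3 * F3 L Y Z"
proof -
  have "F3 (H ** (L + mat 0) ** K) (H ** Y ** K) (H ** Z ** K) = (det H * det K) ^ 3 * F3 (L + mat 0) Y Z"
  proof (rule F3_density[of "\<lambda>t. F3 (H ** (L + mat t) ** K) (H ** Y ** K) (H ** Z ** K)"
        "\<lambda>t. (det H * det K) ^ 3 * F3 (L + mat t) Y Z" L])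
    show "poly_fun (\<lambda>t. F3 (H ** (L + mat t) ** K) (H ** Y ** K) (H ** Z ** K))"
      by (rule F3_line[of _ "H ** L ** K" "H ** K" _ "H ** Y ** K" 0 _ "H ** Z ** K" 0])
        (simp_all add: mat3_distrib mat_mult msc_mult)
    show "poly_fun (\<lambda>t. (det H * det K) ^ 3 * F3 (L + mat t) Y Z)"
      by (intro poly_fun_cmult F3_shift_line)
    show "F3 (H ** (L + mat t) ** K) (H ** Y ** K) (H ** Z ** K) = (det H * det K) ^ 3 * F3 (L + mat t) Y Z"
      if "det (L + mat t) \<noteq> 0" for t
      using that assms by (simp add: F3_div det_mul det_comm3_mult) (simp add: field_simps eval_nat_numeral)
  qed
  then show ?thesis by simp
qed

text \<open>Gaussian elimination without exchanges decomposes M into shears, which leave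
  \<open>F3\<close> unchanged, and scalings by the pivots \<open>p\<close>, \<open>m\<close>,
  \<open>l\<close>. Each pivot contributes its cube, and their product is
  \<open>det M\<close>.\<close>

lemma F3_equivariant_A_generic:
  fixes M :: mat3
  assumes "M$1$1 \<noteq> 0" "M$1$1 * M$2$2 - M$1$2 * M$2$1 \<noteq> 0"
  shows "F3 (msc (M$1$1) L + msc (M$2$1) Y + msc (M$3$1) Z) (msc (M$1$2) L + msc (M$2$2) Y + msc (M$3$2) Z)
    (msc (M$1$3) L + msc (M$2$3) Y + msc (M$3$3) Z) = det M ^ 3 * F3 L Y Z"
proof -
  define p where "p = M$1$1"
  define m where "m = M$2$2 - M$1$2 * M$2$1 / p"
  define n where "n = M$3$2 - M$1$2 * M$3$1 / p"
  define s where "s = M$2$3 - M$1$3 * M$2$1 / p"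
  define l where "l = M$3$3 - M$1$3 * M$3$1 / p - s * n / m"
  define X' where "X' = msc p (L + msc (M$2$1 / p) Y + msc (M$3$1 / p) Z)"
  define Y' where "Y' = msc m (Y + msc (n / m) Z) + msc (M$1$2 / p) X'"
  have p: "p \<noteq> 0" using assms by (simp add: p_def)
  have m: "m \<noteq> 0" using assms p by (simp add: m_def p_def field_simps)
  have X': "msc (M$1$1) L + msc (M$2$1) Y + msc (M$3$1) Z = X'"
    using p by (simp add: X'_def p_def[symmetric] msc_def vec_eq_iff algebra_simps)
  have Y': "msc (M$1$2) L + msc (M$2$2) Y + msc (M$3$2) Z = Y'"
    using p m by (simp add: Y'_def X'_def m_def[symmetric] msc_def vec_eq_iff)
      (simp add: m_def n_def field_simps)
  have Z': "msc (M$1$3) L + msc (M$2$3) Y + msc (M$3$3) Z =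
      msc l Z + msc (s / m) Y' + msc (M$1$3 / p - s / m * (M$1$2 / p)) X'"
  proof -
    have "msc (M$1$3) L + msc (M$2$3) Y + msc (M$3$3) Z =
      msc l Z + msc s (Y + msc (n / m) Z) + msc (M$1$3 / p) X'"
      using p m by (simp add: X'_def msc_def vec_eq_iff) (simp add: l_def s_def field_simps)
    also have "msc s (Y + msc (n / m) Z) = msc (s / m) (Y' - msc (M$1$2 / p) X')"
      using m by (simp add: Y'_def msc_def vec_eq_iff)
    finally show ?thesis by (simp add: msc_def vec_eq_iff algebra_simps)
  qed
  have pm: "p * m = M$1$1 * M$2$2 - M$1$2 * M$2$1"
    using p by (simp add: m_def p_def[symmetric] field_simps)
  have ps: "p * s = p * M$2$3 - M$1$3 * M$2$1"
    using p by (simp add: s_def field_simps)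
  have pn: "p * n = p * M$3$2 - M$1$2 * M$3$1"
    using p by (simp add: n_def field_simps)
  have "p * (p * m * l) = (p * m) * (p * M$3$3 - M$1$3 * M$3$1) - (p * s) * (p * n)"
    using p m by (simp add: l_def field_simps)
  also have "\<dots> = p * det M"
    unfolding pm ps pn by (simp add: det_3 p_def algebra_simps)
  finally have det: "det M = p * m * l" using p by simp
  have "F3 X' Y' (msc l Z + msc (s / m) Y' + msc (M$1$3 / p - s / m * (M$1$2 / p)) X') = l ^ 3 * F3 X' Y' Z"
    by (simp add: F3_shear_ZX F3_shear_ZY F3_scale_Z)
  also have "F3 X' Y' Z = m ^ 3 * F3 X' Y Z"
    by (simp add: Y'_def F3_shear_YX F3_scale_Y F3_shear_YZ)
  also have "F3 X' Y Z = p ^ 3 * F3 L Y Z"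
    by (simp add: X'_def F3_scale_X[OF p] F3_shear_XZ F3_shear_XY)
  finally show ?thesis unfolding X' Y' Z' det by (simp add: power_mult_distrib)
qed

text \<open>The leading minors of \<open>M + mat t\<close> are monic in \<open>t\<close>, so
  elimination succeeds for all but finitely many \<open>t\<close>.\<close>

lemma F3_equivariant_A:
  fixes M :: mat3
  shows
  "F3 (msc (M$1$1) L + msc (M$2$1) Y + msc (M$3$1) Z) (msc (M$1$2) L + msc (M$2$2) Y + msc (M$3$2) Z)
    (msc (M$1$3) L + msc (M$2$3) Y + msc (M$3$3) Z) = det M ^ 3 * F3 L Y Z"
proof -
  define N where "N t = M + mat t" for t
  define S where "S = {t. poly [:M$1$1, 1:] t = 0} \<union>
    {t. poly [:M$1$1 * M$2$2 - M$1$2 * M$2$1, M$1$1 + M$2$2, 1:] t = 0}"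
  have "F3 (msc (N 0$1$1) L + msc (N 0$2$1) Y + msc (N 0$3$1) Z) (msc (N 0$1$2) L + msc (N 0$2$2) Y + msc (N 0$3$2) Z)
    (msc (N 0$1$3) L + msc (N 0$2$3) Y + msc (N 0$3$3) Z) = det (N 0) ^ 3 * F3 L Y Z"
  proof (rule poly_fun_eq[of "\<lambda>t. F3 (msc (N t$1$1) L + msc (N t$2$1) Y + msc (N t$3$1) Z)
      (msc (N t$1$2) L + msc (N t$2$2) Y + msc (N t$3$2) Z) (msc (N t$1$3) L + msc (N t$2$3) Y + msc (N t$3$3) Z)"
      "\<lambda>t. det (N t) ^ 3 * F3 L Y Z" S])
    show "poly_fun (\<lambda>t. F3 (msc (N t$1$1) L + msc (N t$2$1) Y + msc (N t$3$1) Z)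
      (msc (N t$1$2) L + msc (N t$2$2) Y + msc (N t$3$2) Z) (msc (N t$1$3) L + msc (N t$2$3) Y + msc (N t$3$3) Z))"
      by (rule F3_line[of _ "msc (M$1$1) L + msc (M$2$1) Y + msc (M$3$1) Z" L _
            "msc (M$1$2) L + msc (M$2$2) Y + msc (M$3$2) Z" Y _ "msc (M$1$3) L + msc (M$2$3) Y + msc (M$3$3) Z" Z])
        (simp_all add: N_def mat_line_simps)
    show "poly_fun (\<lambda>t. det (N t) ^ 3 * F3 L Y Z)"
      unfolding N_def by (intro poly_fun_mult poly_fun_power poly_fun_det_shift poly_fun_const)
    show "finite S" unfolding S_def by (intro finite_UnI poly_roots_finite) simp_all
    fix t assume t: "t \<notin> S"
    have "N t$1$1 = poly [:M$1$1, 1:] t"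
      "N t$1$1 * N t$2$2 - N t$1$2 * N t$2$1 = poly [:M$1$1 * M$2$2 - M$1$2 * M$2$1, M$1$1 + M$2$2, 1:] t"
      by (simp_all add: N_def mat_def algebra_simps)
    with t have "N t$1$1 \<noteq> 0" "N t$1$1 * N t$2$2 - N t$1$2 * N t$2$1 \<noteq> 0" by (auto simp: S_def)
    then show "F3 (msc (N t$1$1) L + msc (N t$2$1) Y + msc (N t$3$1) Z)
      (msc (N t$1$2) L + msc (N t$2$2) Y + msc (N t$3$2) Z) (msc (N t$1$3) L + msc (N t$2$3) Y + msc (N t$3$3) Z) =
      det (N t) ^ 3 * F3 L Y Z"
      by (rule F3_equivariant_A_generic)
  qed
  then show ?thesis by (simp add: N_def)
qed

lemma slice_pull:
  assumes T: "T \<in> V" and lin: "Vector_Spaces.linear sA sA g" "Vector_Spaces.linear sB sB g'"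
    "Vector_Spaces.linear sC sC g''"
  shows "slice (pull g g' g'' T) (e i) =
    msc (A.mat_of g $ 1 $ i) (transpose (B.mat_of g') ** slice T (e 1) ** C.mat_of g'') +
    msc (A.mat_of g $ 2 $ i) (transpose (B.mat_of g') ** slice T (e 2) ** C.mat_of g'') +
    msc (A.mat_of g $ 3 $ i) (transpose (B.mat_of g') ** slice T (e 3) ** C.mat_of g'')"
proof -
  have "T (g (e i), g' (f j), g'' (h k)) = (\<Sum>l\<in>UNIV. A.mat_of g $ l $ i *
      (\<Sum>n\<in>UNIV. (\<Sum>m\<in>UNIV. B.mat_of g' $ m $ j * T (e l, f m, h n)) * C.mat_of g'' $ n $ k))" for j k
    unfolding A.linear_on_basis[OF lin(1)] B.linear_on_basis[OF lin(2)] C.linear_on_basis[OF lin(3)]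
    by (simp add: dualD(2,3,5)[OF V_dual(1)[OF T]] dualD(2,3,5)[OF V_dual(2)[OF T]] dualD(2,3,5)[OF V_dual(3)[OF T]] sum_3)
      (simp add: algebra_simps)
  then show ?thesis
    by (simp add: slice_def vec_eq_iff msc_def matrix_matrix_mult_def Finite_Cartesian_Product.transpose_def sum_3)
qed

lemma strassen_equivariant:
  assumes "(g, g', g'') \<in> G"
  shows "strassen (pull g g' g'' T) = (det (A.mat_of g) * det (B.mat_of g') * det (C.mat_of g'')) ^ 3 * strassen T"
proof (cases "T \<in> V")
  case True
  have GL: "g \<in> GL sA" "g' \<in> GL sB" "g'' \<in> GL sC" using assms by auto
  then have lin: "Vector_Spaces.linear sA sA g" "Vector_Spaces.linear sB sB g'" "Vector_Spaces.linear sC sC g''"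
    by (auto simp: GL_def)
  let ?H = "transpose (B.mat_of g')" and ?K = "C.mat_of g''"
  have det: "det ?H = det (B.mat_of g')" "det ?H \<noteq> 0" "det ?K \<noteq> 0"
    using B.det_mat_of[OF GL(2)] C.det_mat_of[OF GL(3)] by (simp_all add: det_transpose)
  have "strassen (pull g g' g'' T) = F3 (slice (pull g g' g'' T) (e 1)) (slice (pull g g' g'' T) (e 2))
      (slice (pull g g' g'' T) (e 3))"
    unfolding F3_def using ten3_slice[OF pull_in_V[OF True lin]] by simp
  also have "\<dots> = det (A.mat_of g) ^ 3 * F3 (?H ** slice T (e 1) ** ?K) (?H ** slice T (e 2) ** ?K) (?H ** slice T (e 3) ** ?K)"
    unfolding slice_pull[OF True lin] by (rule F3_equivariant_A)
  also have "\<dots> = det (A.mat_of g) ^ 3 * ((det ?H * det ?K) ^ 3 * F3 (slice T (e 1)) (slice T (e 2)) (slice T (e 3)))"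
    unfolding F3_equivariant_BC[OF det(2,3)] ..
  also have "F3 (slice T (e 1)) (slice T (e 2)) (slice T (e 3)) = strassen T"
    unfolding F3_def using ten3_slice[OF True] by simp
  finally show ?thesis by (simp add: det power_mult_distrib)
next
  case False
  then have "pull g g' g'' T \<notin> V" using assms by (auto simp: pull_in_V_iff)
  with False show ?thesis using hom_poly_outside[OF strassen_hom] by simp
qed

text \<open>If \<open>k\<close> is nonzero, shears with the first slice clear the rank one matrix
  from the other two, and \<open>det_comm3_diag_outer\<close> applies. The case \<open>k = 0\<close>
  follows by varying \<open>k\<close>.\<close>

lemma F3_rank_4_normal: "F3 (dg x + msc k (outer u v)) (dg y + msc m (outer u v)) (dg z + msc n (outer u v)) = 0"
proof -
  have 1: "F3 (dg x + msc k (outer u v)) (dg y) (dg z) = 0" for x k y z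
  proof -
    have "F3 (dg x + msc k (outer u v) + mat 0) (dg y) (dg z) = 0"
    proof (rule F3_density[of "\<lambda>t. F3 (dg x + msc k (outer u v) + mat t) (dg y) (dg z)" "\<lambda>t. 0" "dg x + msc k (outer u v)"])
      show "poly_fun (\<lambda>t. F3 (dg x + msc k (outer u v) + mat t) (dg y) (dg z))"
        by (rule F3_line[of _ "dg x + msc k (outer u v)" "mat 1" _ "dg y" 0 _ "dg z" 0]) (simp_all add: mat_line_simps)
      have eq: "dg x + msc k (outer u v) + mat t = dg (\<lambda>i. x i + t) + msc k (outer u v)" for t
        by (simp add: dg_def mat_def vec_eq_iff)
      show "F3 (dg x + msc k (outer u v) + mat t) (dg y) (dg z) = 0"
        if "det (dg x + msc k (outer u v) + mat t) \<noteq> 0" for t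
        using that unfolding eq by (simp add: F3_div det_comm3_diag_outer)
    qed (rule poly_fun_const)
    then show ?thesis by simp
  qed
  have 2: "F3 (dg x + msc k (outer u v)) (dg y + msc m (outer u v)) (dg z + msc n (outer u v)) = 0" if "k \<noteq> 0" for k
  proof -
    have eq: "dg y + msc m (outer u v) = dg (\<lambda>i. y i - m / k * x i) + msc (m / k) (dg x + msc k (outer u v))" for y m
      using that by (simp add: dg_def msc_def vec_eq_iff algebra_simps)
    show ?thesis unfolding eq[of y m] eq[of z n] F3_shear_YX F3_shear_ZX by (rule 1)
  qed
  have "F3 (dg x + msc (k + 0) (outer u v)) (dg y + msc m (outer u v)) (dg z + msc n (outer u v)) = 0"
  proof (rule poly_fun_eq[of "\<lambda>t. F3 (dg x + msc (k + t) (outer u v)) (dg y + msc m (outer u v)) (dg z + msc n (outer u v))"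
        "\<lambda>t. 0" "{- k}"])
    show "poly_fun (\<lambda>t. F3 (dg x + msc (k + t) (outer u v)) (dg y + msc m (outer u v)) (dg z + msc n (outer u v)))"
      by (rule F3_line[of _ "dg x + msc k (outer u v)" "outer u v" _ "dg y + msc m (outer u v)" 0 _ "dg z + msc n (outer u v)" 0])
        (simp_all add: mat_line_simps)
    show "F3 (dg x + msc (k + t) (outer u v)) (dg y + msc m (outer u v)) (dg z + msc n (outer u v)) = 0" if "t \<notin> {- k}" for t
      using that by (intro 2) (simp add: add_eq_0_iff)
  qed (simp_all add: poly_fun_const)
  then show ?thesis by simp
qed

text \<open>These are the slices of a sum of four decomposable tensors: three summands give the
  diagonal part between \<open>H\<close> and \<open>K\<close>, the fourth a multiple of one rank one
  matrix. Invertible \<open>H\<close> and \<open>K\<close> are removed by equivariance, the others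
  are reached along \<open>H + mat t\<close> and \<open>K + mat t\<close>.\<close>

lemma F3_rank_4: "F3 (H ** dg x ** K + msc k (outer p q)) (H ** dg y ** K + msc m (outer p q)) (H ** dg z ** K + msc n (outer p q)) = 0"
proof -
  have 1: "F3 (H ** dg x ** K + msc k (outer p q)) (H ** dg y ** K + msc m (outer p q)) (H ** dg z ** K + msc n (outer p q)) = 0"
    if nz: "det H \<noteq> 0" "det K \<noteq> 0" for H K
  proof -
    obtain H' where H': "H ** H' = mat 1"
      using nz(1) invertible_det_nz[of H] unfolding invertible_def by blast
    obtain K' where K': "K' ** K = mat 1"
      using nz(2) invertible_det_nz[of K] unfolding invertible_def by blast
    define u where "u i = (\<Sum>k\<in>UNIV. H' $ i $ k * p k)" for i
    define v where "v j = (\<Sum>k\<in>UNIV. q k * K' $ k $ j)" for j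
    have uv: "H' ** outer p q ** K' = outer u v"
      by (simp only: mult_outer u_def[abs_def] v_def[abs_def])
    have "H ** outer u v ** K = (H ** H') ** outer p q ** (K' ** K)"
      by (simp add: uv[symmetric] matrix_mul_assoc)
    then have "H ** outer u v ** K = outer p q" by (simp add: H' K')
    then have "H ** dg x ** K + msc k (outer p q) = H ** (dg x + msc k (outer u v)) ** K" for x k
      by (simp add: mat3_distrib msc_mult)
    then show ?thesis by (simp only: F3_equivariant_BC[OF nz] F3_rank_4_normal mult_zero_right)
  qed
  have shift: "(H + mat t) ** D ** K + E = H ** D ** K + E + msc t (D ** K)"
    "H ** D ** (K + mat t) + E = H ** D ** K + E + msc t (H ** D)" for H D K E t
    by (simp_all add: mat3_distrib mat_mult msc_mult)
  have 2: "F3 (H ** dg x ** K + msc k (outer p q)) (H ** dg y ** K + msc m (outer p q)) (H ** dg z ** K + msc n (outer p q)) = 0"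
    if nz: "det K \<noteq> 0" for H K
  proof -
    have "F3 ((H + mat 0) ** dg x ** K + msc k (outer p q)) ((H + mat 0) ** dg y ** K + msc m (outer p q))
        ((H + mat 0) ** dg z ** K + msc n (outer p q)) = 0"
    proof (rule F3_density[of "\<lambda>t. F3 ((H + mat t) ** dg x ** K + msc k (outer p q)) ((H + mat t) ** dg y ** K + msc m (outer p q))
        ((H + mat t) ** dg z ** K + msc n (outer p q))" "\<lambda>t. 0" H])
      show "poly_fun (\<lambda>t. F3 ((H + mat t) ** dg x ** K + msc k (outer p q)) ((H + mat t) ** dg y ** K + msc m (outer p q))
        ((H + mat t) ** dg z ** K + msc n (outer p q)))"
        by (rule F3_line) (rule shift)+
    qed (rule poly_fun_const, rule 1[OF _ nz])
    then show ?thesis by simp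
  qed
  have "F3 (H ** dg x ** (K + mat 0) + msc k (outer p q)) (H ** dg y ** (K + mat 0) + msc m (outer p q))
      (H ** dg z ** (K + mat 0) + msc n (outer p q)) = 0"
  proof (rule F3_density[of "\<lambda>t. F3 (H ** dg x ** (K + mat t) + msc k (outer p q)) (H ** dg y ** (K + mat t) + msc m (outer p q))
      (H ** dg z ** (K + mat t) + msc n (outer p q))" "\<lambda>t. 0" K])
    show "poly_fun (\<lambda>t. F3 (H ** dg x ** (K + mat t) + msc k (outer p q)) (H ** dg y ** (K + mat t) + msc m (outer p q))
      (H ** dg z ** (K + mat t) + msc n (outer p q)))"
      by (rule F3_line) (rule shift)+
  qed (rule poly_fun_const, rule 2)
  then show ?thesis by simp
qed

lemma sum_4: "(\<Sum>i<4. t i) = t 0 + t 1 + t 2 + t (3::nat)" for t :: "nat \<Rightarrow> 'x::comm_monoid_add"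
  by (simp add: eval_nat_numeral)

lemma strassen_vanishes:
  assumes "\<forall>i<4::nat. \<alpha> i \<in> dual sA \<and> \<beta> i \<in> dual sB \<and> \<gamma> i \<in> dual sC"
  shows "strassen (\<Sum>i<4. tensor3 (\<alpha> i) (\<beta> i) (\<gamma> i)) = 0"
proof -
  let ?T = "\<Sum>i<4. tensor3 (\<alpha> i) (\<beta> i) (\<gamma> i)"
  define ix where "ix l = (if l = 1 then 0 else if l = 2 then 1 else 2 :: nat)" for l :: 3
  define H where "H = (\<chi> j l. \<beta> (ix l) (f j))"
  define K where "K = (\<chi> l k. \<gamma> (ix l) (h k))"
  have T: "?T \<in> V" using assms by (intro fv.subspace_sum[OF subspace_V] tensor3_in_V) auto
  have "slice ?T x = H ** dg (\<lambda>l. \<alpha> (ix l) x) ** K + msc (\<alpha> 3 x) (outer (\<lambda>j. \<beta> 3 (f j)) (\<lambda>k. \<gamma> 3 (h k)))" for x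
    unfolding sum_4
    by (simp add: slice_def tensor3_def vec_eq_iff matrix_matrix_mult_def sum_3 H_def K_def dg_def msc_def outer_def ix_def)
  then have "F3 (slice ?T (e 1)) (slice ?T (e 2)) (slice ?T (e 3)) = 0" by (simp only: F3_rank_4)
  then show ?thesis unfolding F3_def using ten3_slice[OF T] by simp
qed

text \<open>Off the diagonal, the third slice agrees with the rank one matrix
  \<open>outer u v\<close>. Subtracting that matrix makes all three slices diagonal, which leaves
  three decomposable tensors.\<close>

lemma rank_4_tensor:
  assumes abc: "z12 * z23 * z31 = z13 * z32 * z21" "z12 * z23 * z31 \<noteq> 0"
    and van: "\<And>\<alpha> \<beta> \<gamma>. \<forall>i<4::nat. \<alpha> i \<in> dual sA \<and> \<beta> i \<in> dual sB \<and> \<gamma> i \<in> dual sC \<Longrightarrow>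
      P (\<Sum>i<4. tensor3 (\<alpha> i) (\<beta> i) (\<gamma> i)) = 0"
  shows "P (ten3 (mat 1) (dg y) (zmat x z12 z23 z31 z13 z32 z21)) = 0"
proof -
  have nz: "z12 \<noteq> 0" "z23 \<noteq> 0" "z13 \<noteq> 0" using abc by auto
  \<comment> \<open>Solution of u_i v_j = z_ij off the diagonal, normalised by
    \<open>u 1 = 1\<close>. Five entries determine \<open>u\<close> and \<open>v\<close>; the sixth
    condition, \<open>u 3 * v 1 = z31\<close>, is the binomial equation.\<close>
  define u where "u i = (if i = 1 then 1 else if i = 2 then z23 / z13 else z32 / z12)" for i :: 3
  define v where "v i = (if i = 1 then z21 * z13 / z23 else if i = 2 then z12 else z13)" for i :: 3
  define nx :: "nat \<Rightarrow> 3" where "nx l = (if l = 0 then 1 else if l = 1 then 2 else 3)" for l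
  \<comment> \<open>Terms 0, 1, 2 carry the diagonal entries 1, y and x - u v of the three slices;
    term 3 is the rank one matrix, which occurs in the third slice alone.\<close>
  define \<alpha> where "\<alpha> l = (if l = 3 then a 3 else a 1 + fscale (y (nx l)) (a 2) + fscale (x (nx l) - u (nx l) * v (nx l)) (a 3))"
    for l :: nat
  define \<beta> where "\<beta> l = (if l = 3 then b 1 + fscale (u 2) (b 2) + fscale (u 3) (b 3) else b (nx l))" for l :: nat
  define \<gamma> where "\<gamma> l = (if l = 3 then fscale (v 1) (c 1) + fscale (v 2) (c 2) + fscale (v 3) (c 3) else c (nx l))" for l :: nat
  have d: "\<alpha> i \<in> dual sA" "\<beta> i \<in> dual sB" "\<gamma> i \<in> dual sC" for i
    by (auto simp: \<alpha>_def \<beta>_def \<gamma>_def intro!: dual_add dual_fscale A.a_dual B.a_dual C.a_dual)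
  have "z31 * (z12 * z23) = z13 * z32 * z21" using abc(1) by (simp add: algebra_simps)
  then have z31: "u 3 * v 1 = z31" using nz by (simp add: u_def v_def field_simps)
  have "(\<Sum>i<4. tensor3 (\<alpha> i) (\<beta> i) (\<gamma> i)) = ten3 (mat 1) (dg y) (zmat x z12 z23 z31 z13 z32 z21)"
  proof (rule ten3_eqI)
    show "(\<Sum>i<4. tensor3 (\<alpha> i) (\<beta> i) (\<gamma> i)) \<in> V"
      using d by (intro fv.subspace_sum[OF subspace_V] tensor3_in_V)
    have val: "\<alpha> 0 (e i) = (if i = 1 then 1 else if i = 2 then y 1 else x 1 - u 1 * v 1)"
      "\<alpha> 1 (e i) = (if i = 1 then 1 else if i = 2 then y 2 else x 2 - u 2 * v 2)"
      "\<alpha> 2 (e i) = (if i = 1 then 1 else if i = 2 then y 3 else x 3 - u 3 * v 3)"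
      "\<alpha> 3 (e i) = (if i = 3 then 1 else 0)" for i
      using exhaust_3[of i] by (auto simp: \<alpha>_def nx_def fscale_def A.a_e)
    have val': "\<beta> 0 (f j) = (if j = 1 then 1 else 0)" "\<beta> 1 (f j) = (if j = 2 then 1 else 0)"
      "\<beta> 2 (f j) = (if j = 3 then 1 else 0)" "\<beta> 3 (f j) = u j"
      "\<gamma> 0 (h j) = (if j = 1 then 1 else 0)" "\<gamma> 1 (h j) = (if j = 2 then 1 else 0)"
      "\<gamma> 2 (h j) = (if j = 3 then 1 else 0)" "\<gamma> 3 (h j) = v j" for j
      using exhaust_3[of j] by (auto simp: \<beta>_def \<gamma>_def nx_def fscale_def B.a_e C.a_e u_def)
    have s: "slice (\<Sum>i<4. tensor3 (\<alpha> i) (\<beta> i) (\<gamma> i)) (e i) $ j $ k =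
      \<alpha> 0 (e i) * \<beta> 0 (f j) * \<gamma> 0 (h k) + \<alpha> 1 (e i) * \<beta> 1 (f j) * \<gamma> 1 (h k) +
      \<alpha> 2 (e i) * \<beta> 2 (f j) * \<gamma> 2 (h k) + \<alpha> 3 (e i) * \<beta> 3 (f j) * \<gamma> 3 (h k)" for i j k
      unfolding sum_4 by (simp add: slice_def tensor3_def del: One_nat_def)
    show "slice (\<Sum>i<4. tensor3 (\<alpha> i) (\<beta> i) (\<gamma> i)) (e 1) = mat 1"
      "slice (\<Sum>i<4. tensor3 (\<alpha> i) (\<beta> i) (\<gamma> i)) (e 2) = dg y"
      by (simp_all add: vec_eq_iff forall_3 s val val' mat_def dg_def del: One_nat_def)
    have uv: "u 1 * v 2 = z12" "u 1 * v 3 = z13" "u 2 * v 3 = z23" "u 3 * v 2 = z32" "u 2 * v 1 = z21"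
      using nz by (simp_all add: u_def v_def)
    show "slice (\<Sum>i<4. tensor3 (\<alpha> i) (\<beta> i) (\<gamma> i)) (e 3) = zmat x z12 z23 z31 z13 z32 z21"
      by (simp add: vec_eq_iff forall_3 s val val' zmat_def vector_3 uv z31 del: One_nat_def)
  qed
  then show ?thesis using van[of \<alpha> \<beta> \<gamma>] d by simp
qed

lemma vanishes_on_diagonal:
  assumes P: "P \<in> hom_poly V d"
    and van: "\<And>\<alpha> \<beta> \<gamma>. \<forall>i<4::nat. \<alpha> i \<in> dual sA \<and> \<beta> i \<in> dual sB \<and> \<gamma> i \<in> dual sC \<Longrightarrow>
      P (\<Sum>i<4. tensor3 (\<alpha> i) (\<beta> i) (\<gamma> i)) = 0"
    and eq: "Z$1$2 * Z$2$3 * Z$3$1 = Z$1$3 * Z$3$2 * Z$2$1"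
  shows "P (ten3 (mat 1) (dg y) Z) = 0"
proof -
  define x where "x i = Z $ i $ i" for i
  have "P (ten3 (mat 1) (dg y) (zmat x (Z$1$2) (Z$2$3) (Z$3$1) (Z$1$3) (Z$3$2) (Z$2$1))) = 0"
  proof (rule binomial_zero[of "\<lambda>z12 z23 z31 z13 z32 z21. P (ten3 (mat 1) (dg y) (zmat x z12 z23 z31 z13 z32 z21))"])
    fix z12 z12' z23 z23' z31 z31' z13 z13' z32 z32' z21 z21'
    have "zmat x (z12 + t * z12') (z23 + t * z23') (z31 + t * z31') (z13 + t * z13') (z32 + t * z32') (z21 + t * z21') =
      zmat x z12 z23 z31 z13 z32 z21 + msc t (zmat (\<lambda>_. 0) z12' z23' z31' z13' z32' z21')" for t
      by (simp add: vec_eq_iff forall_3 zmat_def vector_3 msc_def)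
    then show "poly_fun (\<lambda>t. P (ten3 (mat 1) (dg y)
      (zmat x (z12 + t * z12') (z23 + t * z23') (z31 + t * z31') (z13 + t * z13') (z32 + t * z32') (z21 + t * z21'))))"
      using hom_poly_ten3_line[OF P, of "mat 1" 0 "dg y" 0] by simp
  qed (use rank_4_tensor van eq in blast)+
  moreover have "zmat x (Z$1$2) (Z$2$3) (Z$3$1) (Z$1$3) (Z$3$2) (Z$2$1) = Z"
    by (simp add: vec_eq_iff forall_3 zmat_def vector_3 x_def)
  ultimately show ?thesis by simp
qed

text \<open>The first two slices are diagonalised simultaneously. The polynomial is moved along with
  the tensor, and its translate again vanishes on sums of four decomposable tensors.\<close>

lemma vanishes_on_strassen:
  assumes P: "P \<in> hom_poly V d"
    and van: "\<And>\<alpha> \<beta> \<gamma>. \<forall>i<4::nat. \<alpha> i \<in> dual sA \<and> \<beta> i \<in> dual sB \<and> \<gamma> i \<in> dual sC \<Longrightarrow>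
      P (\<Sum>i<4. tensor3 (\<alpha> i) (\<beta> i) (\<gamma> i)) = 0"
    and F: "F3 L Y Z = 0" and L: "det L \<noteq> 0" and disc: "disc3 L Y \<noteq> 0"
  shows "P (ten3 L Y Z) = 0"
proof -
  obtain H K y where HK: "det H \<noteq> 0" "det K \<noteq> 0" "H ** L ** K = mat 1" "H ** Y ** K = dg y"
    and y: "y 1 \<noteq> y 2" "y 2 \<noteq> y 3" "y 1 \<noteq> y 3"
    by (rule simultaneous_diagonalization[OF L disc])
  have one: "mat 1 = dg (\<lambda>_. 1)" by (simp add: mat_def dg_def)
  have "F3 (mat 1) (dg y) (H ** Z ** K) = 0"
    using F3_equivariant_BC[OF HK(1,2), of L Y Z] F HK by simp
  then have "det (comm3 (mat 1) (dg y) (H ** Z ** K)) = 0"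
    by (simp add: F3_div)
  \<comment> \<open>The minors are differences of the distinct eigenvalues, so only the binomial
    factor can vanish.\<close>
  then have eq: "(H ** Z ** K)$1$2 * (H ** Z ** K)$2$3 * (H ** Z ** K)$3$1 =
      (H ** Z ** K)$1$3 * (H ** Z ** K)$3$2 * (H ** Z ** K)$2$1"
    unfolding one det_comm3_diag using y by auto
  obtain H' where H': "H' ** H = mat 1"
    using HK(1) invertible_det_nz[of H] unfolding invertible_def by blast
  obtain K' where K': "K ** K' = mat 1"
    using HK(2) invertible_det_nz[of K] unfolding invertible_def by blast
  have det': "det H' \<noteq> 0" "det K' \<noteq> 0"
    using arg_cong[OF H', of det] arg_cong[OF K', of det] by (auto simp: det_mul)
  have undo: "H' ** (H ** W ** K) ** K' = W" for W
  proof -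
    have "H' ** (H ** W ** K) ** K' = (H' ** H) ** W ** (K ** K')" by (simp add: matrix_mul_assoc)
    then show ?thesis by (simp add: H' K')
  qed
  have inv: "H' ** mat 1 ** K' = L" "H' ** dg y ** K' = Y" "H' ** (H ** Z ** K) ** K' = Z"
    using undo[of L] undo[of Y] undo[of Z] unfolding HK(3,4) .
  define g' where "g' = B.lin_of (transpose H')"
  define g'' where "g'' = C.lin_of K'"
  have "A.lin_of (mat 1) = id" by (simp add: fun_eq_iff A.lin_of_one)
  then have GL: "id \<in> GL sA" "g' \<in> GL sB" "g'' \<in> GL sC"
    using A.lin_of_GL[of "mat 1"] B.lin_of_GL[of "transpose H'"] C.lin_of_GL[of K'] det'
    by (simp_all add: g'_def g''_def det_transpose)
  then have lin: "Vector_Spaces.linear sA sA id" "Vector_Spaces.linear sB sB g'" "Vector_Spaces.linear sC sC g''"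
    by (auto simp: GL_def)
  have idm: "A.mat_of id = mat 1" by (simp add: A.mat_of_def A.a_e mat_def)
  let ?T = "ten3 (mat 1) (dg y) (H ** Z ** K)"
  have "pull id g' g'' ?T = ten3 L Y Z"
  proof (rule ten3_eqI[OF pull_in_V[OF ten3_in_V lin]])
    show "slice (pull id g' g'' ?T) (e 1) = L" "slice (pull id g' g'' ?T) (e 2) = Y" "slice (pull id g' g'' ?T) (e 3) = Z"
      unfolding slice_pull[OF ten3_in_V lin] slice_ten3 idm
      unfolding g'_def g''_def B.mat_of_lin_of C.mat_of_lin_of transpose_transpose inv
      by (simp_all add: msc_def mat_def vec_eq_iff)
  qed
  moreover have "poly_act (id, g', g'') P ?T = 0"
  proof (rule vanishes_on_diagonal[OF poly_act_hom_poly[OF GL P] _ eq])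
    fix \<alpha> \<beta> \<gamma> assume *: "\<forall>i<4::nat. \<alpha> i \<in> dual sA \<and> \<beta> i \<in> dual sB \<and> \<gamma> i \<in> dual sC"
    have "pull id g' g'' (\<Sum>i<4. tensor3 (\<alpha> i) (\<beta> i) (\<gamma> i)) = (\<Sum>i<4. tensor3 (\<alpha> i) (\<lambda>x. \<beta> i (g' x)) (\<lambda>x. \<gamma> i (g'' x)))"
      unfolding sum_4 by (auto simp: tensor3_def)
    moreover have "P (\<Sum>i<4. tensor3 (\<alpha> i) (\<lambda>x. \<beta> i (g' x)) (\<lambda>x. \<gamma> i (g'' x))) = 0"
      using * dual_compose[OF _ lin(2)] dual_compose[OF _ lin(3)] by (intro van) auto
    ultimately show "poly_act (id, g', g'') P (\<Sum>i<4. tensor3 (\<alpha> i) (\<beta> i) (\<gamma> i)) = 0"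
      by (simp add: poly_act_pull)
  qed
  ultimately show ?thesis by (simp add: poly_act_pull)
qed

text \<open>A line on which Strassen's polynomial has nine distinct roots, at all of which the genericity
  condition of the previous lemma holds. The roots \<open>1, 2\<close>; \<open>- 2, 3\<close>; \<open>- 1, 4\<close> are those of the three
  minors $y_i x_j - y_j x_i$, and \<open>- 4, - 5, 5\<close> are those of the entries of the cyclic matrix.\<close>

definition line_x :: "complex \<Rightarrow> 3 \<Rightarrow> complex" where
  "line_x s i = (if i = 1 then 2 * s - 1 else if i = 2 then s else - s - 3)"

definition line_y :: "complex \<Rightarrow> 3 \<Rightarrow> complex" where
  "line_y s i = (if i = 1 then - s - 1 else if i = 2 then - 2 else s + 1)"

lemma strassen_divides:
  assumes P: "P \<in> hom_poly V d"
    and van: "\<And>\<alpha> \<beta> \<gamma>. \<forall>i<4::nat. \<alpha> i \<in> dual sA \<and> \<beta> i \<in> dual sB \<and> \<gamma> i \<in> dual sC \<Longrightarrow>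
      P (\<Sum>i<4. tensor3 (\<alpha> i) (\<beta> i) (\<gamma> i)) = 0"
  shows "\<exists>k. \<exists>Q \<in> hom_poly V k. P = (\<lambda>v. strassen v * Q v)"
proof -
  \<comment> \<open>Where \<open>N\<close> is nonzero, the simultaneous diagonalisation is
    available. Its degree is 3 + 12.\<close>
  define N where "N T = (if T \<in> V then det (slice T (e 1)) * disc3 (slice T (e 1)) (slice T (e 2)) else 0)" for T
  have N: "N \<in> hom_poly V 15"
  proof -
    note sl = poly_mat_on_slice
    have p: "poly_on V 3 (\<lambda>T. det (slice T x))" for x by (rule poly_on_det[OF sl]) simp
    have trm: "poly_mat_on V 3 (\<lambda>T. adj3 (slice T x) ** slice T y)"
      "poly_mat_on V 3 (\<lambda>T. slice T x ** adj3 (slice T y))" for x y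
      by (rule poly_mat_on_mult[OF poly_mat_on_adj3[OF sl refl] sl] poly_mat_on_mult[OF sl poly_mat_on_adj3[OF sl refl]]; simp)+
    have tr: "poly_on V 3 (\<lambda>T. \<Sum>i\<in>UNIV. (adj3 (slice T x) ** slice T y) $ i $ i)"
      "poly_on V 3 (\<lambda>T. \<Sum>i\<in>UNIV. (slice T x ** adj3 (slice T y)) $ i $ i)" for x y
      using trm by (auto simp: poly_mat_on_def intro!: poly_on_sum)
    have neg: "poly_on V n (\<lambda>T. - g T)" if "poly_on V n g" for n g
      using poly_on_cmult[OF that, of "- 1"] by simp
    define D where "D p q r s = q^2 * r^2 - 4 * p * r^3 - 4 * q^3 * s - 27 * p^2 * s^2 + 18 * p * q * r * s"
      for p q r s :: complex
    have D: "poly_on V 12 (\<lambda>T. D (p T) (q T) (r T) (s T))"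
      if g: "poly_on V 3 p" "poly_on V 3 q" "poly_on V 3 r" "poly_on V 3 s" for p q r s
    proof -
      have 4: "poly_on V 12 (\<lambda>T. w T * x T * y T * z T)"
        if "poly_on V 3 w" "poly_on V 3 x" "poly_on V 3 y" "poly_on V 3 z" for w x y z
        by (rule poly_on_mult[OF poly_on_mult[OF poly_on_mult[OF that(1,2) refl] that(3) refl] that(4)]) simp
      have "D p q r s = q * q * r * r + (- 4) * (p * r * r * r) + (- 4) * (q * q * q * s) +
          (- 27) * (p * p * s * s) + 18 * (p * q * r * s)" for p q r s
        by (simp add: D_def power2_eq_square power3_eq_cube)
      then show ?thesis by (simp only:) (intro poly_on_add poly_on_cmult 4 g)
    qed
    have "poly_on V 15 (\<lambda>T. det (slice T (e 1)) * disc3 (slice T (e 1)) (slice T (e 2)))"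
      unfolding disc3_def Let_def D_def[symmetric]
      by (rule poly_on_mult[OF p D]) (intro neg tr p | simp)+
    then show ?thesis by (simp add: poly_on_def N_def[abs_def])
  qed
  \<comment> \<open>The cyclic matrix is put into the second slice as well. By a shear this does not
    change Strassen's polynomial; but at the roots of the minors, where the diagonal parts alone
    would have a double eigenvalue, it makes the discriminant nonzero.\<close>
  define T where "T = ten3 (dg (line_x 0)) (zmat (line_y 0) 4 5 (- 5) 0 0 0) (zmat (\<lambda>_. 0) 4 5 (- 5) 0 0 0)"
  define x' where "x' i = (if i = 1 then 2 else if i = 2 then 1 else - 1 :: complex)" for i :: 3
  define y' where "y' i = (if i = 1 then - 1 else if i = 2 then 0 else 1 :: complex)" for i :: 3
  define U where "U = ten3 (dg x') (zmat y' 1 1 1 0 0 0) (zmat (\<lambda>_. 0) 1 1 1 0 0 0)"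
  have F3: "F3 (dg x) (zmat y z12 z23 z31 0 0 0) (zmat (\<lambda>_. 0) z12 z23 z31 0 0 0) =
      (y 1 * x 2 - y 2 * x 1) * (y 2 * x 3 - y 3 * x 2) * (y 3 * x 1 - y 1 * x 3) * (z12 * z23 * z31)"
    if "x 1 * x 2 * x 3 \<noteq> 0" for x y z12 z23 z31
  proof -
    have "zmat y z12 z23 z31 0 0 0 = dg y + msc 1 (zmat (\<lambda>_. 0) z12 z23 z31 0 0 0)"
      by (simp add: vec_eq_iff forall_3 zmat_def vector_3 msc_def dg_def)
    then have "F3 (dg x) (zmat y z12 z23 z31 0 0 0) (zmat (\<lambda>_. 0) z12 z23 z31 0 0 0) =
        F3 (dg x) (dg y) (zmat (\<lambda>_. 0) z12 z23 z31 0 0 0)"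
      by (simp only: F3_shear_YZ)
    also have "\<dots> = (y 1 * x 2 - y 2 * x 1) * (y 2 * x 3 - y 3 * x 2) * (y 3 * x 1 - y 1 * x 3) * (z12 * z23 * z31)"
      using that by (simp add: F3_div det_dg det_comm3_diag zmat_def vector_3)
    finally show ?thesis .
  qed
  have line: "T + fscale s U = ten3 (dg (line_x s)) (zmat (line_y s) (s + 4) (s + 5) (s - 5) 0 0 0)
      (zmat (\<lambda>_. 0) (s + 4) (s + 5) (s - 5) 0 0 0)" for s
    unfolding T_def U_def ten3_line
    by (rule arg_cong3[of _ _ _ _ _ _ ten3])
      (simp_all add: vec_eq_iff forall_3 zmat_def vector_3 msc_def dg_def line_x_def line_y_def x'_def y'_def)
  have UV: "U \<in> V" "T \<in> V" by (simp_all add: U_def T_def)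
  have FU: "strassen U \<noteq> 0"
    unfolding U_def F3_def[symmetric] by (subst F3) (simp_all add: x'_def y'_def)
  define S where "S = {1, 2, - 2, 3, - 1, 4, - 4, - 5, 5 :: complex}"
  have S: "finite S" "card S = 9" by (simp_all add: S_def)
  obtain k Q where "Q \<in> hom_poly V k" "P = (\<lambda>v. strassen v * Q v)"
  proof (rule hom_poly_divisible[OF subspace_V strassen_hom P N UV(1) FU UV(2) S])
    fix s assume s: "s \<in> S"
    have x: "line_x s 1 * line_x s 2 * line_x s 3 \<noteq> 0"
      using s by (auto simp: S_def line_x_def)
    show "strassen (T + fscale s U) = 0"
      unfolding line F3_def[symmetric] F3[OF x] using s by (auto simp: S_def line_x_def line_y_def)
    have "disc3 (dg (line_x s)) (zmat (line_y s) (s + 4) (s + 5) (s - 5) 0 0 0) \<noteq> 0"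
      unfolding disc3_diag_cyclic Let_def using s unfolding S_def
      by (elim insertE emptyE; hypsubst; simp add: line_x_def line_y_def)
    then show "N (T + fscale s U) \<noteq> 0"
      unfolding line N_def using x by (simp add: det_dg)
  next
    fix v assume v: "v \<in> V" "strassen v = 0" "N v \<noteq> 0"
    have "P (ten3 (slice v (e 1)) (slice v (e 2)) (slice v (e 3))) = 0"
    proof (rule vanishes_on_strassen[OF P van])
      show "F3 (slice v (e 1)) (slice v (e 2)) (slice v (e 3)) = 0"
        unfolding F3_def ten3_slice[OF v(1), symmetric] by (rule v(2))
    qed (use v in \<open>auto simp: N_def\<close>)
    then show "P v = 0" unfolding ten3_slice[OF v(1), symmetric] .
  qed (rule that)
  then show ?thesis by blast
qed

lemma strassen_nonzero: "strassen \<noteq> 0"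
proof -
  have "F3 (mat 1) (dg (\<lambda>i. if i = 1 then 0 else if i = 2 then 1 else 2)) (zmat (\<lambda>_. 0) 1 1 1 0 0 0) \<noteq> 0"
  proof -
    have one: "mat 1 = dg (\<lambda>_. 1)" by (simp add: mat_def dg_def)
    show ?thesis unfolding one by (simp add: F3_div det_dg det_comm3_diag zmat_def vector_3)
  qed
  then show ?thesis by (auto simp: F3_def)
qed

lemma hypersurface_strassen: "hypersurface_equation V (secant_variety V 4 X) 9 strassen"
  unfolding secant_variety_closure
proof (rule hypersurface_equation_closure[OF secant_points_proj_space])
  have I: "ideal_deg V (secant_points V 4 X) d = ideal_deg V (secant_variety V 4 X) d" for d
    unfolding secant_variety_closure ideal_deg_closure[OF secant_points_proj_space] ..
  show "strassen \<in> ideal_deg V (secant_points V 4 X) 9"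
    unfolding I using strassen_hom strassen_vanishes by (subst ideal_deg_secant) auto
  show "\<exists>k. \<exists>G\<in>hom_poly V k. P = (\<lambda>v. strassen v * G v)" if "P \<in> ideal_deg V (secant_points V 4 X) d" for d P
    using that unfolding I by (subst (asm) ideal_deg_secant) (auto intro!: strassen_divides)
qed (simp_all add: strassen_nonzero)

end

theorem proposition6p1:
  fixes sA :: "complex \<Rightarrow> 'a::ab_group_add \<Rightarrow> 'a"
    and sB :: "complex \<Rightarrow> 'b::ab_group_add \<Rightarrow> 'b"
    and sC :: "complex \<Rightarrow> 'c::ab_group_add \<Rightarrow> 'c"
  assumes "vector_space sA" and "vector_space.dim sA UNIV = 3"
    and "vector_space sB" and "vector_space.dim sB UNIV = 3"
    and "vector_space sC" and "vector_space.dim sC UNIV = 3"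
  shows
    "let V = dual_tensors sA sB sC; X = segre sA sB sC;
         I4 = ideal_deg V (secant_variety V 3 X) 4
     in (schur_copy [2,1,1] sA sB sC I4 \<and>
         (\<forall>M. schur_copy [2,1,1] sA sB sC M \<longrightarrow> M = I4) \<and>
         fv.dim I4 = 27) \<and>
        (\<exists>F. hypersurface_equation V (secant_variety V 4 X) 9 F \<and>
             schur_copy [3,3,3] sA sB sC (fv.span {F}) \<and>
             fv.dim (schur_prod [3,3,3] sA sB sC) = 1)"
proof -
  obtain e a f b h c where "coord3 sA e a" "coord3 sB f b" "coord3 sC h c"
    using coord3_exists[OF assms(1,2)] coord3_exists[OF assms(3,4)] coord3_exists[OF assms(5,6)] by blast
  then interpret three_coord3 sA e a sB f b sC h c by (simp add: three_coord3_def)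
  show ?thesis
    unfolding Let_def quartics_of_secant_3
    using schur_copy_211 schur_copy_211_unique dim_quartics hypersurface_strassen dim_schur_prod_333
      schur_copy_333[OF strassen_hom strassen_nonzero strassen_equivariant] by blast
qed

end
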